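(* Let $\gamma>0$ and let $\mathfrak K\subset\mathbb R^d$ be compact. Let $(\Pi^\varepsilon,\Gamma^\varepsilon)$ be a discrete model with reconstruction operator $\mathcal R^\varepsilon$ satisfying (R1) of the context. Then $$|\iota_\varepsilon(\mathcal R^\varepsilon f-\Pi^\varepsilon_zf(z))(\eta_z^\delta)|\lesssim\delta^\gamma\,\|\Pi^\varepsilon\|^{(\varepsilon)}_{\gamma;\bar{\mathfrak K}}\,|\!|\!|f|\!|\!|^{(\varepsilon)}_{\gamma;[\eta_z^\delta]},$$ uniformly over all test functions $\eta\in\Phi$, all $\delta\in(\varepsilon,1]$, all $f\in\mathcal D^\gamma_\varepsilon(\Gamma^\varepsilon)$, all $z\in\mathfrak K$ and all $\varepsilon\in(0,1]$. If $(\bar\Pi^\varepsilon,\bar\Gamma^\varepsilon)$ is a second discrete model with reconstruction operator $\bar{\mathcal R}^\varepsilon$ such that (R2) also holds, then for all $f\in\mathcal D^\gamma_\varepsilon(\Gamma^\varepsilon)$ and $\bar f\in\mathcal D^\gamma_\varepsilon(\bar\Gamma^\varepsilon)$, $$|\iota_\varepsilon(\mathcal R^\varepsilon f-\bar{\mathcal R}^\varepsilon\bar f-\Pi^\varepsilon_zf(z)+\bar\Pi^\varepsilon_z\bar f(z))(\eta_z^\delta)|\lesssim\delta^\gamma\Big(\|\bar\Pi^\varepsilon\|^{(\varepsilon)}_{\gamma;\bar{\mathfrak K}}|\!|\!|f;\bar f|\!|\!|^{(\varepsilon)}_{\gamma;[\eta_z^\delta]}+\|\Pi^\varepsilon-\bar\Pi^\varepsilon\|^{(\varepsilon)}_{\gamma;\bar{\mathfrak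 K}}|\!|\!|f|\!|\!|^{(\varepsilon)}_{\gamma;[\eta_z^\delta]}\Big),$$ uniformly over all parameters as before. Finally, if $\mathcal R$ is the reconstruction operator of a continuous model $(\Pi,\Gamma)$ such that (R3) holds, $f\in\mathcal D^\gamma(\Gamma)$ and $f^\varepsilon\in\mathcal D^\gamma_\varepsilon(\Gamma^\varepsilon)$, then $$|(\iota_\varepsilon(\mathcal R^\varepsilon f^\varepsilon-\Pi^\varepsilon_zf^\varepsilon(z))-\mathcal Rf+\Pi_zf(z))(\eta_z^\delta)|\lesssim\delta^\gamma\Big(\|\Pi^\varepsilon\|^{(\varepsilon)}_{\gamma;\bar{\mathfrak K}}|\!|\!|f;f^\varepsilon|\!|\!|_{\gamma;[\eta_z^\delta]}+\|\Pi;\Pi^\varepsilon\|_{\gamma;\bar{\mathfrak K}}|\!|\!|f|\!|\!|_{\gamma;[\eta_z^\delta]}\Big),$$ uniformly over all parameters as before.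
   Context: **Scaling.** $\mathfrak s\in\mathbb N_{\ge1}^d$ is fixed; $\|y-z\|_{\mathfrak s}=d_{\mathfrak s}(y,z)=\sup_i|y_i-z_i|^{1/\mathfrak s_i}$, $|\mathfrak s|=\sum_i\mathfrak s_i$, $|k|_{\mathfrak s}=\sum_i\mathfrak s_ik_i$; $\mathcal B_{\mathfrak s}(z,\delta)$ is the $d_{\mathfrak s}$-ball. For $\varphi:\mathbb R^d\to\mathbb R$, $\varphi_z^\delta(y)=(\mathcal S^\delta_{\mathfrak s,z}\varphi)(y)=\delta^{-|\mathfrak s|}\varphi(\delta^{-\mathfrak s_1}(y_1-z_1),\dots,\delta^{-\mathfrak s_d}(y_d-z_d))$. $[\eta]$ is the support of $\eta$; $\bar{\mathfrak K}$ is the $1$-fattening of a compact set $\mathfrak K$. $\mathfrak K_\varepsilon$ always denotes a compact set of diameter at most $2\varepsilon$. **Regularity structure.** $\mathscr T=(A,\mathcal T,G)$ is a regularity structure in Hairer's sense ($\mathcal T=\bigoplus_{\alpha\in A}\mathcal T_\alpha$, $A\subset\mathbb R$ locally finite and bounded below, $G$ acting on $\mathcal T$ with $\Gamma\tau-\tau\in\bigoplus_{\beta<\alpha}\mathcal T_\beta$ for $\tau\in\mathcal T_\alpha$) containing the $\mathfrak s$-scaled polynomials in $d$ indeterminates. $\mathcal T_{<\gamma}=\bigoplus_{\alpha<\gamma}\mathcal T_\alpha$; $\|\tau\|_\alpha$ is the norm of the $\mathcal T_\alpha$-component, $\|\tau\|$ the norm in $\mathcal T$, $|\tau|$ the homogeneity.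 Fix $r>|\min A|$; $\Phi$ is the set of $\phi\in\mathcal C^r$ with $\|\phi\|_{\mathcal C^r}\le1$ and $\operatorname{supp}\phi\subset\mathcal B_{\mathfrak s}(0,1)$ ("test functions"). **Discretisation.** We are given: (1) linear spaces $\mathcal X_\varepsilon$, $\varepsilon\in(0,1]$, with inclusions $\iota_\varepsilon:\mathcal X_\varepsilon\hookrightarrow\mathcal D'(\mathbb R^d)$. (2) Extended seminorms (possibly $+\infty$) $\|\cdot\|_{\alpha;\mathfrak K_\varepsilon;z;\varepsilon}$ on $\mathcal X_\varepsilon$ ($\alpha\in\mathbb R$, $z\in\mathbb R^d$), local in the sense that $\|f-g\|_{\alpha;\mathfrak K_\varepsilon;z;\varepsilon}=0$ if $\iota_\varepsilon f$ and $\iota_\varepsilon g$ agree on all $\phi\in\mathcal C^r$ supported in $\mathfrak K_\varepsilon$. (3) $|(\iota_\varepsilon f)(\phi_z^\varepsilon)|\lesssim\varepsilon^\alpha\|f\|_{\alpha;[\phi_z^\varepsilon];z;\varepsilon}$ uniformly over $f\in\mathcal X_\varepsilon$, $z$, $\alpha$, $\phi\in\Phi$. (4) For every $\Gamma:\mathbb R^d\times\mathbb R^d\to G$, extended seminorms $|\!|\!|\cdot|\!|\!|_{\gamma;\mathfrak K;\varepsilon}$ on functions $f:\mathbb R^d\to\mathcal T_{<\gamma}$, and for every pair $\Gamma_1,\Gamma_2:\mathbb R^d\times\mathbb R^d\to G$, seminorms $|\!|\!|\cdot;\cdot|\!|\!|_{\gamma;\mathfrak K;\varepsilon}$ on pairs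 of such functions ($\gamma\in\mathbb R$, $\mathfrak K$ compact, $\varepsilon\in(0,1]$), depending only on the values of the functions in a $\mathbf c\varepsilon$-neighbourhood of $\mathfrak K$, with $\mathbf c\ge0$ fixed. The dependence on $\Gamma,\Gamma_1,\Gamma_2$ is suppressed from the notation. **Discrete model.** Maps $z\mapsto\Pi_z^\varepsilon\in\mathcal L(\mathcal T,\mathcal X_\varepsilon)$ (linear maps), $(x,y)\mapsto\Gamma^\varepsilon_{xy}\in G$ with $\Gamma_{zz}^\varepsilon=\mathrm{id}$, $\Gamma_{xy}^\varepsilon\Gamma_{yz}^\varepsilon=\Gamma_{xz}^\varepsilon$, $\Pi_z^\varepsilon=\Pi_y^\varepsilon\Gamma_{yz}^\varepsilon$, and for every compact $\mathfrak K$ and $\gamma>0$ (P) $|(\iota_\varepsilon\Pi^\varepsilon_z\tau)(\mathcal S^\lambda_{\mathfrak s,z}\phi)|\lesssim\|\tau\|\lambda^{|\tau|}$ and $\|\Pi_z^\varepsilon\tau\|_{|\tau|;\mathfrak K_\varepsilon;z;\varepsilon}\lesssim\|\tau\|$; (G) $\|\Gamma^\varepsilon_{zz'}\tau\|_m\lesssim\|\tau\|\|z-z'\|_{\mathfrak s}^{|\tau|-m}$ and $|\!|\!|f_z^{\tau,\Gamma^\varepsilon}|\!|\!|_{|\tau|;\mathfrak K;\varepsilon}\lesssim\|\tau\|$ where $f_z^{\tau,\Gamma^\varepsilon}(y)=\Gamma^\varepsilon_{yz}\tau-\tau$; uniformly over $\lambda\in(\varepsilon,1]$, $\phi\in\Phi$,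 homogeneous $\tau$ with $|\tau|<\gamma$, $m<|\tau|$, $z,z'\in\mathfrak K$ with $\|z-z'\|_{\mathfrak s}\in(\varepsilon,1]$ (and compact $\mathfrak K_\varepsilon$ of diameter at most $2\varepsilon$). $\|\Pi^\varepsilon\|^{(\varepsilon)}_{\gamma;\mathfrak K}$ and $\|\Gamma^\varepsilon\|^{(\varepsilon)}_{\gamma;\mathfrak K}$ are the smallest constants in (P) and (G); $\|\Pi^\varepsilon-\bar\Pi^\varepsilon\|^{(\varepsilon)}_{\gamma;\mathfrak K}$ is the smallest constant in (P) with $\Pi^\varepsilon$ replaced by the difference. **Modelled distributions.** $\mathcal D^\gamma_\varepsilon(\Gamma^\varepsilon)$ is the space of $f:\mathbb R^d\to\mathcal T_{<\gamma}$ with, for all compact $\mathfrak K$, $$|\!|\!|f|\!|\!|^{(\varepsilon)}_{\gamma;\mathfrak K}=\sup_{y,z\in\mathfrak K,\ \varepsilon\le\|y-z\|_{\mathfrak s}\le1}\ \sup_{\beta<\gamma}\frac{\|f(z)-\Gamma^\varepsilon_{zy}f(y)\|_\beta}{\|y-z\|_{\mathfrak s}^{\gamma-\beta}}+|\!|\!|f|\!|\!|_{\gamma;\mathfrak K;\varepsilon}<\infty.$$ For $f\in\mathcal D_\varepsilon^\gamma(\Gamma^\varepsilon)$, $\bar f\in\mathcal D^\gamma_\varepsilon(\bar\Gamma^\varepsilon)$, $|\!|\!|f;\bar f|\!|\!|^{(\varepsilon)}_{\gamma;\mathfrak K}$ is the same supremum with numerator $\|f(z)-\bar f(z)-\Gamma^\varepsilon_{zy}f(y)+\bar\Gamma^\varepsilon_{zy}\bar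 f(y)\|_\beta$, plus $|\!|\!|f;\bar f|\!|\!|_{\gamma;\mathfrak K;\varepsilon}$. **Continuous models and comparison.** A continuous model $(\Pi,\Gamma)$ is a model in Hairer's sense: $\Pi_z:\mathcal T\to\mathcal D'(\mathbb R^d)$, same algebraic relations, with the first bounds of (P) and (G) for all $\lambda\in(0,1]$ and all $\|z-z'\|_{\mathfrak s}\le1$. $\mathcal D^\gamma(\Gamma)$ is the space of $f:\mathbb R^d\to\mathcal T_{<\gamma}$ with $|\!|\!|f|\!|\!|_{\gamma;\mathfrak K}=\sup_{y,z\in\mathfrak K,\|y-z\|_{\mathfrak s}\le1}\sup_{\beta<\gamma}\|f(z)-\Gamma_{zy}f(y)\|_\beta\|y-z\|_{\mathfrak s}^{\beta-\gamma}<\infty$. Put $$\|\Pi-\Pi^\varepsilon\|_{\gamma;\mathfrak K;\ge\varepsilon}=\sup\lambda^{-|\tau|}|(\Pi_z\tau-\iota_\varepsilon\Pi_z^\varepsilon\tau)(\mathcal S^\lambda_{\mathfrak s,z}\varphi)|$$ over $\lambda\in(\varepsilon,1]$, $\ell\in A$ with $\ell<\gamma$, $\tau\in\mathcal T_\ell$ (normalised, $\|\tau\|\le 1$), $\varphi\in\Phi$, $z\in\mathfrak K$, and $$\|\Pi;\Pi^\varepsilon\|_{\gamma;\mathfrak K}=\|\Pi-\Pi^\varepsilon\|_{\gamma;\mathfrak K;\ge\varepsilon}+\sup\|\Pi^\varepsilon_z\tau\|_{|\tau|;\mathfrak K_\varepsilon;z;\varepsilon}+\sup\lambda^{-|\tau|}|(\Pi_z\tau)(\mathcal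 S^\lambda_{\mathfrak s,z}\varphi)|,$$ the suprema being over the same index sets, except that in the last one $\lambda$ additionally ranges over $(0,\varepsilon]$. For $f\in\mathcal D^\gamma(\Gamma)$ and $f^\varepsilon\in\mathcal D_\varepsilon^\gamma(\Gamma^\varepsilon)$, $$|\!|\!|f;f^\varepsilon|\!|\!|_{\gamma;\mathfrak K}=\sup_{\|y-z\|_{\mathfrak s}<\varepsilon}\sup_{\beta<\gamma}\frac{\|f(z)-\Gamma_{zy}f(y)\|_\beta}{\|y-z\|_{\mathfrak s}^{\gamma-\beta}}+|\!|\!|f^\varepsilon|\!|\!|_{\gamma;\mathfrak K;\varepsilon}+\sup_{\varepsilon\le\|y-z\|_{\mathfrak s}\le1}\sup_{\beta<\gamma}\frac{\|f(z)-f^\varepsilon(z)-\Gamma_{zy}f(y)+\Gamma_{zy}^\varepsilon f^\varepsilon(y)\|_\beta}{\|y-z\|_{\mathfrak s}^{\gamma-\beta}},$$ with $y,z\in\mathfrak K$. **Reconstruction assumptions.** A reconstruction operator for $(\Pi^\varepsilon,\Gamma^\varepsilon)$ is a linear map $\mathcal R^\varepsilon:\mathcal D^\gamma_\varepsilon(\Gamma^\varepsilon)\to\mathcal X_\varepsilon$ such that, locally uniformly over $z$, over compact $\mathfrak K_\varepsilon\ni z$ of diameter at most $2\varepsilon$, and over $\varepsilon$, (R1) $\|\mathcal R^\varepsilon f-\Pi^\varepsilon_zf(z)\|_{\gamma;\mathfrak K_\varepsilon;z;\varepsilon}\lesssim\|\Pi^\varepsilon\|^{(\varepsilon)}_{\gamma;\bar{\mathfrak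 K}_\varepsilon}|\!|\!|f|\!|\!|_{\gamma;\mathfrak K_\varepsilon;\varepsilon}$. For two discrete models with reconstruction operators $\mathcal R^\varepsilon,\bar{\mathcal R}^\varepsilon$, with the same uniformity, (R2) $\|\mathcal R^\varepsilon f-\Pi_z^\varepsilon f(z)-\bar{\mathcal R}^\varepsilon\bar f+\bar\Pi_z^\varepsilon\bar f(z)\|_{\gamma;\mathfrak K_\varepsilon;z;\varepsilon}\lesssim\|\bar\Pi^\varepsilon\|^{(\varepsilon)}_{\gamma;\bar{\mathfrak K}_\varepsilon}|\!|\!|f;\bar f|\!|\!|_{\gamma;\mathfrak K_\varepsilon;\varepsilon}+\|\Pi^\varepsilon-\bar\Pi^\varepsilon\|^{(\varepsilon)}_{\gamma;\bar{\mathfrak K}_\varepsilon}|\!|\!|f|\!|\!|_{\gamma;\mathfrak K_\varepsilon;\varepsilon}$. For a continuous model with (Hairer's) reconstruction operator $\mathcal R$, $f\in\mathcal D^\gamma(\Gamma)$, $f^\varepsilon\in\mathcal D_\varepsilon^\gamma(\Gamma^\varepsilon)$, every $\eta\in\Phi$, locally uniformly in $z$ and uniformly in $\varepsilon$, (R3) $|[\iota_\varepsilon(\mathcal R^\varepsilon f^\varepsilon-\Pi_z^\varepsilon f^\varepsilon(z))-(\mathcal Rf-\Pi_zf(z))](\eta_z^\varepsilon)|\lesssim\varepsilon^\gamma\big[\|\Pi^\varepsilon\|^{(\varepsilon)}_{\gamma;\overline{[\eta_z^\varepsilon]}}|\!|\!|f;f^\varepsilon|\!|\!|_{\gamma;[\eta_z^\varepsilon]}+\|\Pi;\Pi^\varepsilon\|_{\gamma;\overline{[\eta_z^\varepsilon]}}|\!|\!|f|\!|\!|_{\gamma;[\eta_z^\varepsilon]}\big]$.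 $\lesssim$ denotes inequality up to a proportionality constant with the stated uniformity; constants in the definition of a model may depend on $\varepsilon$, and if the constants in the assumptions do not depend on $\varepsilon$ then neither do those in the conclusions.
   Formalization: The localisation set [η_z^δ] (also in (3) and (R3)) includes the base point z; the seminorms |||·|||_{γ;K;ε} and |||·;·|||_{γ;K;ε} are assumed increasing in K; model norms in the conclusions are over the 1-fattening of K ∪ [η_z^δ] instead of K. The literal claim fails without these. *)

theory Defs
  imports "HOL-Analysis.Analysis"
begin

type_synonym 'd functional = "((real^'d) \<Rightarrow> real) \<Rightarrow> real"


section \<open>Scaling and test functions\<close>

definition sdist :: "('d::finite \<Rightarrow> nat) \<Rightarrow> real^'d \<Rightarrow> real^'d \<Rightarrow> real" where
  "sdist s y z = (MAX i\<in>UNIV. \<bar>y $ i - z $ i\<bar> powr (1 / real (s i)))"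

definition sball :: "('d::finite \<Rightarrow> nat) \<Rightarrow> real^'d \<Rightarrow> real \<Rightarrow> (real^'d) set" where
  "sball s z \<delta> = {y. sdist s y z < \<delta>}"

definition fatten :: "('d::finite \<Rightarrow> nat) \<Rightarrow> (real^'d) set \<Rightarrow> (real^'d) set" where
  "fatten s K = {y. \<exists>x\<in>K. sdist s y x \<le> 1}"

text \<open>The sets that are written with an index \<open>\<epsilon>\<close>: compact, of diameter at most \<open>2\<epsilon>\<close>.\<close>

definition small_compact :: "('d::finite \<Rightarrow> nat) \<Rightarrow> real \<Rightarrow> (real^'d) set \<Rightarrow> bool" where
  "small_compact s \<epsilon> K \<longleftrightarrow> compact K \<and> (\<forall>x\<in>K. \<forall>y\<in>K. sdist s x y \<le> 2 * \<epsilon>)"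

definition rescale ::
  "('d::finite \<Rightarrow> nat) \<Rightarrow> real^'d \<Rightarrow> real \<Rightarrow> ((real^'d) \<Rightarrow> real) \<Rightarrow> (real^'d) \<Rightarrow> real" where
  "rescale s z \<delta> \<phi> y =
     (1 / \<delta> ^ (\<Sum>i\<in>UNIV. s i)) * \<phi> (\<chi> i. (y $ i - z $ i) / \<delta> ^ s i)"

definition fsupp :: "((real^'d::finite) \<Rightarrow> real) \<Rightarrow> (real^'d) set" where
  "fsupp \<phi> = closure {x. \<phi> x \<noteq> 0}"

text \<open>The localisation set \<open>[\<phi>\<^sub>z\<^sup>\<delta>]\<close>: the support of the rescaled test function together
  with its base point \<open>z\<close>. The two agree when \<open>0\<close> lies in the support of \<open>\<phi>\<close>. The base point
  has to be included because the quantities localised to this set also involve the value at \<open>z\<close>.\<close>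

definition tsupp ::
  "('d::finite \<Rightarrow> nat) \<Rightarrow> ((real^'d) \<Rightarrow> real) \<Rightarrow> real^'d \<Rightarrow> real \<Rightarrow> (real^'d) set" where
  "tsupp s \<phi> z \<delta> = insert z (fsupp (rescale s z \<delta> \<phi>))"

definition partial :: "'d::finite \<Rightarrow> ((real^'d) \<Rightarrow> real) \<Rightarrow> (real^'d) \<Rightarrow> real" where
  "partial i f x = frechet_derivative f (at x) (axis i 1)"

primrec C_diff :: "nat \<Rightarrow> ((real^'d::finite) \<Rightarrow> real) \<Rightarrow> bool" where
  "C_diff 0 f \<longleftrightarrow> continuous_on UNIV f"
| "C_diff (Suc n) f \<longleftrightarrow> (\<forall>x. f differentiable (at x)) \<and> (\<forall>i. C_diff n (partial i f))"

text \<open>Partial derivatives of order at most \<open>r\<close> are indexed by lists of directions.\<close>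

definition C_norm :: "nat \<Rightarrow> ((real^'d::finite) \<Rightarrow> real) \<Rightarrow> ennreal" where
  "C_norm r f = (SUP is\<in>{is. length is \<le> r}. SUP x. ennreal \<bar>foldr partial is f x\<bar>)"

definition test_functions :: "('d::finite \<Rightarrow> nat) \<Rightarrow> nat \<Rightarrow> ((real^'d) \<Rightarrow> real) set" where
  "test_functions s r = {\<phi>. C_diff r \<phi> \<and> C_norm r \<phi> \<le> 1 \<and> fsupp \<phi> \<subseteq> sball s 0 1}"

definition Cc :: "nat \<Rightarrow> ((real^'d::finite) \<Rightarrow> real) set" where
  "Cc r = {\<phi>. C_diff r \<phi> \<and> compact (fsupp \<phi>)}"

text \<open>Distributions are paired with functions that are merely \<open>C\<^sup>r\<close>, so they are taken to be of
  order at most \<open>r\<close>, i.e. continuous linear functionals on \<open>Cc r\<close>. They are set to \<open>0\<close> off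
  \<open>Cc r\<close>, which makes equality of functions equality of distributions.\<close>

definition distributions :: "nat \<Rightarrow> 'd::finite functional set" where
  "distributions r = {u.
     (\<forall>\<phi>. \<phi> \<notin> Cc r \<longrightarrow> u \<phi> = 0) \<and>
     (\<forall>\<phi>\<in>Cc r. \<forall>\<psi>\<in>Cc r. u (\<lambda>x. \<phi> x + \<psi> x) = u \<phi> + u \<psi>) \<and>
     (\<forall>a. \<forall>\<phi>\<in>Cc r. u (\<lambda>x. a * \<phi> x) = a * u \<phi>) \<and>
     (\<forall>K. compact K \<longrightarrow> (\<exists>C::real. \<forall>\<phi>\<in>Cc r. fsupp \<phi> \<subseteq> K \<longrightarrow>
        ennreal \<bar>u \<phi>\<bar> \<le> ennreal C * C_norm r \<phi>))}"


section \<open>Regularity structures\<close>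

text \<open>The space \<open>\<T>\<close> is the type \<open>'v\<close>. Its grading is given by the projections \<open>proj T \<alpha>\<close>, so that
  \<open>\<T>\<^sub>\<alpha>\<close> is the range of \<open>proj T \<alpha>\<close>, and \<open>rnorm T \<alpha>\<close> is only meaningful on \<open>\<T>\<^sub>\<alpha>\<close>.
  \<open>monomial T k\<close> is the monomial \<open>X\<^sup>k\<close>.\<close>

record ('d, 'v) reg_struct =
  homs :: "real set"
  proj :: "real \<Rightarrow> 'v \<Rightarrow> 'v"
  rnorm :: "real \<Rightarrow> 'v \<Rightarrow> real"
  sgroup :: "('v \<Rightarrow> 'v) set"
  monomial :: "('d \<Rightarrow> nat) \<Rightarrow> 'v"

definition hom_space :: "('d, 'v) reg_struct \<Rightarrow> real \<Rightarrow> 'v set" where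
  "hom_space T \<alpha> = range (proj T \<alpha>)"

definition below :: "('d, 'v::real_vector) reg_struct \<Rightarrow> real \<Rightarrow> 'v set" where
  "below T \<gamma> = {\<tau>. \<forall>\<beta>\<ge>\<gamma>. proj T \<beta> \<tau> = 0}"

definition cnorm :: "('d, 'v) reg_struct \<Rightarrow> real \<Rightarrow> 'v \<Rightarrow> real" where
  "cnorm T \<alpha> \<tau> = rnorm T \<alpha> (proj T \<alpha> \<tau>)"

definition graded :: "('d, 'v::real_vector) reg_struct \<Rightarrow> bool" where
  "graded T \<longleftrightarrow>
     bdd_below (homs T) \<and> (\<forall>a b. finite (homs T \<inter> {a..b})) \<and>
     (\<forall>\<alpha>. linear (proj T \<alpha>)) \<and>
     (\<forall>\<alpha> \<beta> \<tau>. proj T \<alpha> (proj T \<beta> \<tau>) = (if \<alpha> = \<beta> then proj T \<alpha> \<tau> else 0)) \<and>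
     (\<forall>\<alpha> \<tau>. \<alpha> \<notin> homs T \<longrightarrow> proj T \<alpha> \<tau> = 0) \<and>
     (\<forall>\<tau>. finite {\<alpha>. proj T \<alpha> \<tau> \<noteq> 0} \<and> \<tau> = (\<Sum>\<alpha> | proj T \<alpha> \<tau> \<noteq> 0. proj T \<alpha> \<tau>))"

definition banach_components :: "('d, 'v::real_vector) reg_struct \<Rightarrow> bool" where
  "banach_components T \<longleftrightarrow> (\<forall>\<alpha>\<in>homs T.
     (\<forall>\<tau>\<in>hom_space T \<alpha>. 0 \<le> rnorm T \<alpha> \<tau> \<and> (rnorm T \<alpha> \<tau> = 0 \<longleftrightarrow> \<tau> = 0)) \<and>
     (\<forall>a. \<forall>\<tau>\<in>hom_space T \<alpha>. rnorm T \<alpha> (a *\<^sub>R \<tau>) = \<bar>a\<bar> * rnorm T \<alpha> \<tau>) \<and>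
     (\<forall>\<tau>\<in>hom_space T \<alpha>. \<forall>\<sigma>\<in>hom_space T \<alpha>.
        rnorm T \<alpha> (\<tau> + \<sigma>) \<le> rnorm T \<alpha> \<tau> + rnorm T \<alpha> \<sigma>) \<and>
     (\<forall>x :: nat \<Rightarrow> 'v. range x \<subseteq> hom_space T \<alpha> \<longrightarrow>
        (\<forall>e>0. \<exists>N. \<forall>m\<ge>N. \<forall>n\<ge>N. rnorm T \<alpha> (x m - x n) < e) \<longrightarrow>
        (\<exists>l\<in>hom_space T \<alpha>. (\<lambda>n. rnorm T \<alpha> (x n - l)) \<longlonglongrightarrow> 0)))"

definition structure_group :: "('d, 'v::real_vector) reg_struct \<Rightarrow> bool" where
  "structure_group T \<longleftrightarrow>
     (\<forall>g\<in>sgroup T. linear g) \<and> id \<in> sgroup T \<and>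
     (\<forall>g\<in>sgroup T. \<forall>h\<in>sgroup T. g \<circ> h \<in> sgroup T) \<and>
     (\<forall>g\<in>sgroup T. \<exists>h\<in>sgroup T. g \<circ> h = id \<and> h \<circ> g = id) \<and>
     (\<forall>g\<in>sgroup T. \<forall>\<alpha>\<in>homs T. \<forall>\<tau>\<in>hom_space T \<alpha>. g \<tau> - \<tau> \<in> below T \<alpha>)"

text \<open>The polynomial sector: \<open>|X\<^sup>k| = |k|\<^sub>s\<close>, and every element of the structure group acts by
  some translation \<open>X\<^sup>k \<mapsto> (X + h)\<^sup>k\<close>.\<close>

definition contains_polynomials ::
  "('d::finite \<Rightarrow> nat) \<Rightarrow> ('d, 'v::real_vector) reg_struct \<Rightarrow> bool" where
  "contains_polynomials s T \<longleftrightarrow>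
     (\<forall>k. monomial T k \<in> hom_space T (real (\<Sum>i\<in>UNIV. s i * k i))) \<and>
     inj (monomial T) \<and> independent (range (monomial T)) \<and>
     (\<forall>g\<in>sgroup T. \<exists>h :: real^'d. \<forall>k. g (monomial T k) =
        (\<Sum>l | \<forall>i. l i \<le> k i.
           (\<Prod>i\<in>UNIV. real (k i choose l i) * h $ i ^ (k i - l i)) *\<^sub>R monomial T l))"

text \<open>The last condition is the requirement that \<open>\<T>\<^sub>0\<close> is spanned by the unit \<open>\<one> = X\<^sup>0\<close>;
  that \<open>0\<close> belongs to the index set and that \<open>\<one>\<close> is fixed by the structure group
  are consequences of the inclusion of the polynomials.\<close>

definition regularity_structure ::
  "('d::finite \<Rightarrow> nat) \<Rightarrow> ('d, 'v::real_vector) reg_struct \<Rightarrow> bool" where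
  "regularity_structure s T \<longleftrightarrow>
     graded T \<and> banach_components T \<and> structure_group T \<and> contains_polynomials s T \<and>
     hom_space T 0 = span {monomial T (\<lambda>_. 0)}"


section \<open>Discretisations\<close>

type_synonym ('d, 'v) transport = "real^'d \<Rightarrow> real^'d \<Rightarrow> 'v \<Rightarrow> 'v"

text \<open>The spaces \<open>\<X>\<^sub>\<epsilon>\<close> are subspaces of one common type \<open>'x\<close>. \<open>fnorm\<close> and \<open>pnorm\<close> are the
  seminorms on functions and on pairs of functions, with the transports they depend on as
  explicit arguments; \<open>range_const\<close> is the constant \<open>c\<close> in their locality.\<close>

record ('d, 'v, 'x) discretisation =
  dspace :: "real \<Rightarrow> 'x set"
  emb :: "real \<Rightarrow> 'x \<Rightarrow> 'd functional"
  xnorm :: "real \<Rightarrow> (real^'d) set \<Rightarrow> real^'d \<Rightarrow> real \<Rightarrow> 'x \<Rightarrow> ennreal"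
  fnorm :: "('d, 'v) transport \<Rightarrow> real \<Rightarrow> (real^'d) set \<Rightarrow> real \<Rightarrow> (real^'d \<Rightarrow> 'v) \<Rightarrow> ennreal"
  pnorm :: "('d, 'v) transport \<Rightarrow> ('d, 'v) transport \<Rightarrow> real \<Rightarrow> (real^'d) set \<Rightarrow> real \<Rightarrow>
              (real^'d \<Rightarrow> 'v) \<Rightarrow> (real^'d \<Rightarrow> 'v) \<Rightarrow> ennreal"
  range_const :: real

definition dspaces :: "nat \<Rightarrow> ('d::finite, 'v, 'x::real_vector) discretisation \<Rightarrow> bool" where
  "dspaces r D \<longleftrightarrow> (\<forall>\<epsilon>\<in>{0<..1}.
     subspace (dspace D \<epsilon>) \<and> inj_on (emb D \<epsilon>) (dspace D \<epsilon>) \<and>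
     (\<forall>f\<in>dspace D \<epsilon>. emb D \<epsilon> f \<in> distributions r) \<and>
     (\<forall>f\<in>dspace D \<epsilon>. \<forall>g\<in>dspace D \<epsilon>. emb D \<epsilon> (f + g) = (\<lambda>\<phi>. emb D \<epsilon> f \<phi> + emb D \<epsilon> g \<phi>)) \<and>
     (\<forall>a. \<forall>f\<in>dspace D \<epsilon>. emb D \<epsilon> (a *\<^sub>R f) = (\<lambda>\<phi>. a * emb D \<epsilon> f \<phi>)))"

definition local_xnorms ::
  "('d::finite \<Rightarrow> nat) \<Rightarrow> nat \<Rightarrow> ('d, 'v, 'x::real_vector) discretisation \<Rightarrow> bool" where
  "local_xnorms s r D \<longleftrightarrow> (\<forall>\<epsilon>\<in>{0<..1}. \<forall>\<alpha> z K. small_compact s \<epsilon> K \<longrightarrow>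
     (\<forall>a. \<forall>f\<in>dspace D \<epsilon>. xnorm D \<alpha> K z \<epsilon> (a *\<^sub>R f) = ennreal \<bar>a\<bar> * xnorm D \<alpha> K z \<epsilon> f) \<and>
     (\<forall>f\<in>dspace D \<epsilon>. \<forall>g\<in>dspace D \<epsilon>.
        xnorm D \<alpha> K z \<epsilon> (f + g) \<le> xnorm D \<alpha> K z \<epsilon> f + xnorm D \<alpha> K z \<epsilon> g) \<and>
     (\<forall>f\<in>dspace D \<epsilon>. \<forall>g\<in>dspace D \<epsilon>.
        (\<forall>\<phi>. C_diff r \<phi> \<and> fsupp \<phi> \<subseteq> K \<longrightarrow> emb D \<epsilon> f \<phi> = emb D \<epsilon> g \<phi>) \<longrightarrow>
        xnorm D \<alpha> K z \<epsilon> (f - g) = 0))"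

definition xnorm_controls ::
  "('d::finite \<Rightarrow> nat) \<Rightarrow> nat \<Rightarrow> ('d, 'v, 'x::real_vector) discretisation \<Rightarrow> bool" where
  "xnorm_controls s r D \<longleftrightarrow> (\<exists>C::real. \<forall>\<epsilon>\<in>{0<..1}. \<forall>f\<in>dspace D \<epsilon>. \<forall>z \<alpha>. \<forall>\<phi>\<in>test_functions s r.
     ennreal \<bar>emb D \<epsilon> f (rescale s z \<epsilon> \<phi>)\<bar>
       \<le> ennreal (C * \<epsilon> powr \<alpha>) * xnorm D \<alpha> (tsupp s \<phi> z \<epsilon>) z \<epsilon> f)"

definition functions_below :: "('d::finite, 'v::real_vector) reg_struct \<Rightarrow> real \<Rightarrow> (real^'d \<Rightarrow> 'v) set" where
  "functions_below T \<gamma> = {f. \<forall>y. f y \<in> below T \<gamma>}"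

definition transports :: "('d::finite, 'v) reg_struct \<Rightarrow> ('d, 'v) transport set" where
  "transports T = {\<Gamma>. \<forall>x y. \<Gamma> x y \<in> sgroup T}"

definition eq_near ::
  "('d::finite \<Rightarrow> nat) \<Rightarrow> real \<Rightarrow> (real^'d) set \<Rightarrow> (real^'d \<Rightarrow> 'v) \<Rightarrow> (real^'d \<Rightarrow> 'v) \<Rightarrow> bool" where
  "eq_near s \<rho> K f g \<longleftrightarrow> (\<forall>y. (\<exists>x\<in>K. sdist s y x \<le> \<rho>) \<longrightarrow> f y = g y)"

definition local_fnorms ::
  "('d::finite \<Rightarrow> nat) \<Rightarrow> ('d, 'v::real_vector) reg_struct \<Rightarrow> ('d, 'v, 'x) discretisation \<Rightarrow> bool" where
  "local_fnorms s T D \<longleftrightarrow> (\<forall>\<Gamma>\<in>transports T. \<forall>\<gamma> K. \<forall>\<epsilon>\<in>{0<..1}. compact K \<longrightarrow>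
     (\<forall>a. \<forall>f\<in>functions_below T \<gamma>.
        fnorm D \<Gamma> \<gamma> K \<epsilon> (\<lambda>y. a *\<^sub>R f y) = ennreal \<bar>a\<bar> * fnorm D \<Gamma> \<gamma> K \<epsilon> f) \<and>
     (\<forall>f\<in>functions_below T \<gamma>. \<forall>g\<in>functions_below T \<gamma>.
        fnorm D \<Gamma> \<gamma> K \<epsilon> (\<lambda>y. f y + g y) \<le> fnorm D \<Gamma> \<gamma> K \<epsilon> f + fnorm D \<Gamma> \<gamma> K \<epsilon> g) \<and>
     (\<forall>f\<in>functions_below T \<gamma>. \<forall>g\<in>functions_below T \<gamma>.
        eq_near s (range_const D * \<epsilon>) K f g \<longrightarrow> fnorm D \<Gamma> \<gamma> K \<epsilon> f = fnorm D \<Gamma> \<gamma> K \<epsilon> g))"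

definition local_pnorms ::
  "('d::finite \<Rightarrow> nat) \<Rightarrow> ('d, 'v::real_vector) reg_struct \<Rightarrow> ('d, 'v, 'x) discretisation \<Rightarrow> bool" where
  "local_pnorms s T D \<longleftrightarrow>
     (\<forall>\<Gamma>\<in>transports T. \<forall>\<Gamma>'\<in>transports T. \<forall>\<gamma> K. \<forall>\<epsilon>\<in>{0<..1}. compact K \<longrightarrow>
     (\<forall>a. \<forall>f\<in>functions_below T \<gamma>. \<forall>f'\<in>functions_below T \<gamma>.
        pnorm D \<Gamma> \<Gamma>' \<gamma> K \<epsilon> (\<lambda>y. a *\<^sub>R f y) (\<lambda>y. a *\<^sub>R f' y)
          = ennreal \<bar>a\<bar> * pnorm D \<Gamma> \<Gamma>' \<gamma> K \<epsilon> f f') \<and>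
     (\<forall>f\<in>functions_below T \<gamma>. \<forall>f'\<in>functions_below T \<gamma>.
      \<forall>g\<in>functions_below T \<gamma>. \<forall>g'\<in>functions_below T \<gamma>.
        pnorm D \<Gamma> \<Gamma>' \<gamma> K \<epsilon> (\<lambda>y. f y + g y) (\<lambda>y. f' y + g' y)
          \<le> pnorm D \<Gamma> \<Gamma>' \<gamma> K \<epsilon> f f' + pnorm D \<Gamma> \<Gamma>' \<gamma> K \<epsilon> g g') \<and>
     (\<forall>f\<in>functions_below T \<gamma>. \<forall>f'\<in>functions_below T \<gamma>.
      \<forall>g\<in>functions_below T \<gamma>. \<forall>g'\<in>functions_below T \<gamma>.
        eq_near s (range_const D * \<epsilon>) K f g \<longrightarrow> eq_near s (range_const D * \<epsilon>) K f' g' \<longrightarrow>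
        pnorm D \<Gamma> \<Gamma>' \<gamma> K \<epsilon> f f' = pnorm D \<Gamma> \<Gamma>' \<gamma> K \<epsilon> g g'))"

definition discretisation ::
  "('d::finite \<Rightarrow> nat) \<Rightarrow> nat \<Rightarrow> ('d, 'v::real_vector) reg_struct \<Rightarrow>
     ('d, 'v, 'x::real_vector) discretisation \<Rightarrow> bool" where
  "discretisation s r T D \<longleftrightarrow>
     dspaces r D \<and> local_xnorms s r D \<and> xnorm_controls s r D \<and>
     0 \<le> range_const D \<and> local_fnorms s T D \<and> local_pnorms s T D"

text \<open>The seminorms on functions grow with the compact set. A bound on all small compact sets
  says nothing about a larger one without this.\<close>

definition monotone_seminorms ::
  "('d::finite, 'v::real_vector) reg_struct \<Rightarrow> ('d, 'v, 'x) discretisation \<Rightarrow> bool" where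
  "monotone_seminorms T D \<longleftrightarrow>
     (\<forall>\<Gamma>\<in>transports T. \<forall>\<gamma> K L. \<forall>\<epsilon>\<in>{0<..1}. \<forall>f\<in>functions_below T \<gamma>.
        compact K \<and> compact L \<and> K \<subseteq> L \<longrightarrow> fnorm D \<Gamma> \<gamma> K \<epsilon> f \<le> fnorm D \<Gamma> \<gamma> L \<epsilon> f) \<and>
     (\<forall>\<Gamma>\<in>transports T. \<forall>\<Gamma>'\<in>transports T. \<forall>\<gamma> K L. \<forall>\<epsilon>\<in>{0<..1}.
      \<forall>f\<in>functions_below T \<gamma>. \<forall>f'\<in>functions_below T \<gamma>.
        compact K \<and> compact L \<and> K \<subseteq> L \<longrightarrow>
        pnorm D \<Gamma> \<Gamma>' \<gamma> K \<epsilon> f f' \<le> pnorm D \<Gamma> \<Gamma>' \<gamma> L \<epsilon> f f')"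


section \<open>Discrete models\<close>

definition Pi_bound ::
  "('d::finite \<Rightarrow> nat) \<Rightarrow> nat \<Rightarrow> ('d, 'v) reg_struct \<Rightarrow> ('d, 'v, 'x) discretisation \<Rightarrow>
     real \<Rightarrow> real \<Rightarrow> (real^'d) set \<Rightarrow> (real^'d \<Rightarrow> 'v \<Rightarrow> 'x) \<Rightarrow> ennreal \<Rightarrow> bool" where
  "Pi_bound s r T D \<epsilon> \<gamma> K P C \<longleftrightarrow>
     (\<forall>z\<in>K. \<forall>\<alpha>\<in>homs T. \<alpha> < \<gamma> \<longrightarrow> (\<forall>\<tau>\<in>hom_space T \<alpha>.
        (\<forall>l\<in>{\<epsilon><..1}. \<forall>\<phi>\<in>test_functions s r.
           ennreal \<bar>emb D \<epsilon> (P z \<tau>) (rescale s z l \<phi>)\<bar> \<le> C * ennreal (rnorm T \<alpha> \<tau> * l powr \<alpha>)) \<and>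
        (\<forall>L. small_compact s \<epsilon> L \<longrightarrow>
           xnorm D \<alpha> L z \<epsilon> (P z \<tau>) \<le> C * ennreal (rnorm T \<alpha> \<tau>))))"

definition Pi_norm ::
  "('d::finite \<Rightarrow> nat) \<Rightarrow> nat \<Rightarrow> ('d, 'v) reg_struct \<Rightarrow> ('d, 'v, 'x) discretisation \<Rightarrow>
     real \<Rightarrow> real \<Rightarrow> (real^'d) set \<Rightarrow> (real^'d \<Rightarrow> 'v \<Rightarrow> 'x) \<Rightarrow> ennreal" where
  "Pi_norm s r T D \<epsilon> \<gamma> K P = Inf {C. Pi_bound s r T D \<epsilon> \<gamma> K P C}"

definition Gamma_bound ::
  "('d::finite \<Rightarrow> nat) \<Rightarrow> ('d, 'v::real_vector) reg_struct \<Rightarrow> ('d, 'v, 'x) discretisation \<Rightarrow>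
     real \<Rightarrow> real \<Rightarrow> (real^'d) set \<Rightarrow> ('d, 'v) transport \<Rightarrow> ennreal \<Rightarrow> bool" where
  "Gamma_bound s T D \<epsilon> \<gamma> K \<Gamma> C \<longleftrightarrow>
     (\<forall>z\<in>K. \<forall>\<alpha>\<in>homs T. \<alpha> < \<gamma> \<longrightarrow> (\<forall>\<tau>\<in>hom_space T \<alpha>.
        (\<forall>z'\<in>K. sdist s z z' \<in> {\<epsilon><..1} \<longrightarrow> (\<forall>m\<in>homs T. m < \<alpha> \<longrightarrow>
           ennreal (cnorm T m (\<Gamma> z z' \<tau>)) \<le> C * ennreal (rnorm T \<alpha> \<tau> * sdist s z z' powr (\<alpha> - m)))) \<and>
        fnorm D \<Gamma> \<alpha> K \<epsilon> (\<lambda>y. \<Gamma> y z \<tau> - \<tau>) \<le> C * ennreal (rnorm T \<alpha> \<tau>)))"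

definition transport_rules :: "('d::finite, 'v) reg_struct \<Rightarrow> ('d, 'v) transport \<Rightarrow> bool" where
  "transport_rules T \<Gamma> \<longleftrightarrow> \<Gamma> \<in> transports T \<and>
     (\<forall>z. \<Gamma> z z = id) \<and> (\<forall>x y z. \<Gamma> x y \<circ> \<Gamma> y z = \<Gamma> x z)"

definition discrete_model ::
  "('d::finite \<Rightarrow> nat) \<Rightarrow> nat \<Rightarrow> ('d, 'v::real_vector) reg_struct \<Rightarrow>
     ('d, 'v, 'x::real_vector) discretisation \<Rightarrow>
     real \<Rightarrow> (real^'d \<Rightarrow> 'v \<Rightarrow> 'x) \<Rightarrow> ('d, 'v) transport \<Rightarrow> bool" where
  "discrete_model s r T D \<epsilon> P \<Gamma> \<longleftrightarrow>
     (\<forall>z. linear (P z) \<and> range (P z) \<subseteq> dspace D \<epsilon>) \<and>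
     transport_rules T \<Gamma> \<and> (\<forall>y z. P z = P y \<circ> \<Gamma> y z) \<and>
     (\<forall>K \<gamma>. compact K \<and> \<gamma> > 0 \<longrightarrow>
        (\<exists>C::real. Pi_bound s r T D \<epsilon> \<gamma> K P (ennreal C)) \<and>
        (\<exists>C::real. Gamma_bound s T D \<epsilon> \<gamma> K \<Gamma> (ennreal C)))"


section \<open>Modelled distributions\<close>

text \<open>Supremum over the pairs of points of \<open>K\<close> whose distance lies in \<open>I\<close>, and over \<open>\<beta> < \<gamma>\<close>, of the
  increments \<open>F y z\<close>, measured with weight \<open>\<gamma> - \<beta>\<close>. On the diagonal the quotient is \<open>0\<close>.\<close>

definition increment_sup ::
  "('d::finite \<Rightarrow> nat) \<Rightarrow> ('d, 'v) reg_struct \<Rightarrow> real \<Rightarrow> (real^'d) set \<Rightarrow> real set \<Rightarrow>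
     (real^'d \<Rightarrow> real^'d \<Rightarrow> 'v) \<Rightarrow> ennreal" where
  "increment_sup s T \<gamma> K I F =
     (SUP (y, z)\<in>{(y, z). y \<in> K \<and> z \<in> K \<and> sdist s y z \<in> I}. SUP \<beta>\<in>{\<beta>\<in>homs T. \<beta> < \<gamma>}.
        ennreal (cnorm T \<beta> (F y z) / sdist s y z powr (\<gamma> - \<beta>)))"

definition D_norm ::
  "('d::finite \<Rightarrow> nat) \<Rightarrow> ('d, 'v::real_vector) reg_struct \<Rightarrow> ('d, 'v, 'x) discretisation \<Rightarrow>
     real \<Rightarrow> real \<Rightarrow> (real^'d) set \<Rightarrow> ('d, 'v) transport \<Rightarrow> (real^'d \<Rightarrow> 'v) \<Rightarrow> ennreal" where
  "D_norm s T D \<epsilon> \<gamma> K \<Gamma> f =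
     increment_sup s T \<gamma> K {\<epsilon>..1} (\<lambda>y z. f z - \<Gamma> z y (f y)) + fnorm D \<Gamma> \<gamma> K \<epsilon> f"

definition D_space ::
  "('d::finite \<Rightarrow> nat) \<Rightarrow> ('d, 'v::real_vector) reg_struct \<Rightarrow> ('d, 'v, 'x) discretisation \<Rightarrow>
     real \<Rightarrow> real \<Rightarrow> ('d, 'v) transport \<Rightarrow> (real^'d \<Rightarrow> 'v) set" where
  "D_space s T D \<epsilon> \<gamma> \<Gamma> =
     {f \<in> functions_below T \<gamma>. \<forall>K. compact K \<longrightarrow> D_norm s T D \<epsilon> \<gamma> K \<Gamma> f < \<infinity>}"

definition D_dist ::
  "('d::finite \<Rightarrow> nat) \<Rightarrow> ('d, 'v::real_vector) reg_struct \<Rightarrow> ('d, 'v, 'x) discretisation \<Rightarrow>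
     real \<Rightarrow> real \<Rightarrow> (real^'d) set \<Rightarrow> ('d, 'v) transport \<Rightarrow> ('d, 'v) transport \<Rightarrow>
     (real^'d \<Rightarrow> 'v) \<Rightarrow> (real^'d \<Rightarrow> 'v) \<Rightarrow> ennreal" where
  "D_dist s T D \<epsilon> \<gamma> K \<Gamma> \<Gamma>' f f' =
     increment_sup s T \<gamma> K {\<epsilon>..1} (\<lambda>y z. f z - f' z - \<Gamma> z y (f y) + \<Gamma>' z y (f' y))
     + pnorm D \<Gamma> \<Gamma>' \<gamma> K \<epsilon> f f'"


section \<open>Continuous models\<close>

definition continuous_model ::
  "('d::finite \<Rightarrow> nat) \<Rightarrow> nat \<Rightarrow> ('d, 'v::real_vector) reg_struct \<Rightarrow>
     (real^'d \<Rightarrow> 'v \<Rightarrow> 'd functional) \<Rightarrow> ('d, 'v) transport \<Rightarrow> bool" where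
  "continuous_model s r T P \<Gamma> \<longleftrightarrow>
     (\<forall>z \<tau>. P z \<tau> \<in> distributions r) \<and>
     (\<forall>z \<tau> \<sigma>. P z (\<tau> + \<sigma>) = (\<lambda>\<phi>. P z \<tau> \<phi> + P z \<sigma> \<phi>)) \<and>
     (\<forall>z a \<tau>. P z (a *\<^sub>R \<tau>) = (\<lambda>\<phi>. a * P z \<tau> \<phi>)) \<and>
     transport_rules T \<Gamma> \<and> (\<forall>y z. P z = P y \<circ> \<Gamma> y z) \<and>
     (\<forall>K \<gamma>. compact K \<and> \<gamma> > 0 \<longrightarrow> (\<exists>C::real. \<forall>z\<in>K. \<forall>\<alpha>\<in>homs T. \<alpha> < \<gamma> \<longrightarrow> (\<forall>\<tau>\<in>hom_space T \<alpha>.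
        (\<forall>l\<in>{0<..1}. \<forall>\<phi>\<in>test_functions s r.
           \<bar>P z \<tau> (rescale s z l \<phi>)\<bar> \<le> C * rnorm T \<alpha> \<tau> * l powr \<alpha>) \<and>
        (\<forall>z'\<in>K. sdist s z z' \<le> 1 \<longrightarrow> (\<forall>m\<in>homs T. m < \<alpha> \<longrightarrow>
           cnorm T m (\<Gamma> z z' \<tau>) \<le> C * rnorm T \<alpha> \<tau> * sdist s z z' powr (\<alpha> - m))))))"

definition Dc_norm ::
  "('d::finite \<Rightarrow> nat) \<Rightarrow> ('d, 'v::real_vector) reg_struct \<Rightarrow>
     real \<Rightarrow> (real^'d) set \<Rightarrow> ('d, 'v) transport \<Rightarrow> (real^'d \<Rightarrow> 'v) \<Rightarrow> ennreal" where
  "Dc_norm s T \<gamma> K \<Gamma> f = increment_sup s T \<gamma> K {..1} (\<lambda>y z. f z - \<Gamma> z y (f y))"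

definition Dc_space ::
  "('d::finite \<Rightarrow> nat) \<Rightarrow> ('d, 'v::real_vector) reg_struct \<Rightarrow>
     real \<Rightarrow> ('d, 'v) transport \<Rightarrow> (real^'d \<Rightarrow> 'v) set" where
  "Dc_space s T \<gamma> \<Gamma> = {f \<in> functions_below T \<gamma>. \<forall>K. compact K \<longrightarrow> Dc_norm s T \<gamma> K \<Gamma> f < \<infinity>}"

text \<open>Hairer's reconstruction operator: for \<open>\<gamma> > 0\<close> the bound determines \<open>R f\<close> uniquely.\<close>

definition continuous_reconstruction ::
  "('d::finite \<Rightarrow> nat) \<Rightarrow> nat \<Rightarrow> ('d, 'v::real_vector) reg_struct \<Rightarrow> real \<Rightarrow>
     (real^'d \<Rightarrow> 'v \<Rightarrow> 'd functional) \<Rightarrow> ('d, 'v) transport \<Rightarrow>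
     ((real^'d \<Rightarrow> 'v) \<Rightarrow> 'd functional) \<Rightarrow> bool" where
  "continuous_reconstruction s r T \<gamma> P \<Gamma> R \<longleftrightarrow>
     (\<forall>f\<in>Dc_space s T \<gamma> \<Gamma>. R f \<in> distributions r) \<and>
     (\<forall>f\<in>Dc_space s T \<gamma> \<Gamma>. \<forall>g\<in>Dc_space s T \<gamma> \<Gamma>. R (\<lambda>y. f y + g y) = (\<lambda>\<phi>. R f \<phi> + R g \<phi>)) \<and>
     (\<forall>a. \<forall>f\<in>Dc_space s T \<gamma> \<Gamma>. R (\<lambda>y. a *\<^sub>R f y) = (\<lambda>\<phi>. a * R f \<phi>)) \<and>
     (\<forall>f\<in>Dc_space s T \<gamma> \<Gamma>. \<forall>K. compact K \<longrightarrow> (\<exists>C::real.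
        \<forall>z\<in>K. \<forall>\<delta>\<in>{0<..1}. \<forall>\<eta>\<in>test_functions s r.
          \<bar>R f (rescale s z \<delta> \<eta>) - P z (f z) (rescale s z \<delta> \<eta>)\<bar> \<le> C * \<delta> powr \<gamma>))"


section \<open>Comparison of continuous and discrete objects\<close>

text \<open>In these definitions \<open>Pc\<close>, \<open>\<Gamma>c\<close>, \<open>f\<close> are the continuous and \<open>P\<close>, \<open>\<Gamma>\<close>, \<open>fe\<close> the discrete
  objects.\<close>

definition unit_hom :: "('d, 'v) reg_struct \<Rightarrow> real \<Rightarrow> (real \<times> 'v) set" where
  "unit_hom T \<gamma> = {(\<alpha>, \<tau>). \<alpha> \<in> homs T \<and> \<alpha> < \<gamma> \<and> \<tau> \<in> hom_space T \<alpha> \<and> rnorm T \<alpha> \<tau> \<le> 1}"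

definition Pi_diff_above ::
  "('d::finite \<Rightarrow> nat) \<Rightarrow> nat \<Rightarrow> ('d, 'v) reg_struct \<Rightarrow> ('d, 'v, 'x) discretisation \<Rightarrow>
     real \<Rightarrow> real \<Rightarrow> (real^'d) set \<Rightarrow> (real^'d \<Rightarrow> 'v \<Rightarrow> 'd functional) \<Rightarrow> (real^'d \<Rightarrow> 'v \<Rightarrow> 'x) \<Rightarrow>
     ennreal" where
  "Pi_diff_above s r T D \<epsilon> \<gamma> K Pc P =
     (SUP z\<in>K. SUP (\<alpha>, \<tau>)\<in>unit_hom T \<gamma>. SUP l\<in>{\<epsilon><..1}. SUP \<phi>\<in>test_functions s r.
        ennreal (l powr (-\<alpha>) *
          \<bar>Pc z \<tau> (rescale s z l \<phi>) - emb D \<epsilon> (P z \<tau>) (rescale s z l \<phi>)\<bar>))"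

definition Pi_dist ::
  "('d::finite \<Rightarrow> nat) \<Rightarrow> nat \<Rightarrow> ('d, 'v) reg_struct \<Rightarrow> ('d, 'v, 'x) discretisation \<Rightarrow>
     real \<Rightarrow> real \<Rightarrow> (real^'d) set \<Rightarrow> (real^'d \<Rightarrow> 'v \<Rightarrow> 'd functional) \<Rightarrow> (real^'d \<Rightarrow> 'v \<Rightarrow> 'x) \<Rightarrow>
     ennreal" where
  "Pi_dist s r T D \<epsilon> \<gamma> K Pc P =
     Pi_diff_above s r T D \<epsilon> \<gamma> K Pc P
     + (SUP z\<in>K. SUP (\<alpha>, \<tau>)\<in>unit_hom T \<gamma>. SUP L\<in>{L. small_compact s \<epsilon> L}. xnorm D \<alpha> L z \<epsilon> (P z \<tau>))
     + (SUP z\<in>K. SUP (\<alpha>, \<tau>)\<in>unit_hom T \<gamma>. SUP l\<in>{\<epsilon><..1} \<union> {0<..\<epsilon>}. SUP \<phi>\<in>test_functions s r.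
          ennreal (l powr (-\<alpha>) * \<bar>Pc z \<tau> (rescale s z l \<phi>)\<bar>))"

definition Dc_dist ::
  "('d::finite \<Rightarrow> nat) \<Rightarrow> ('d, 'v::real_vector) reg_struct \<Rightarrow> ('d, 'v, 'x) discretisation \<Rightarrow>
     real \<Rightarrow> real \<Rightarrow> (real^'d) set \<Rightarrow> ('d, 'v) transport \<Rightarrow> ('d, 'v) transport \<Rightarrow>
     (real^'d \<Rightarrow> 'v) \<Rightarrow> (real^'d \<Rightarrow> 'v) \<Rightarrow> ennreal" where
  "Dc_dist s T D \<epsilon> \<gamma> K \<Gamma>c \<Gamma> f fe =
     increment_sup s T \<gamma> K {..<\<epsilon>} (\<lambda>y z. f z - \<Gamma>c z y (f y))
     + fnorm D \<Gamma> \<gamma> K \<epsilon> fe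
     + increment_sup s T \<gamma> K {\<epsilon>..1} (\<lambda>y z. f z - fe z - \<Gamma>c z y (f y) + \<Gamma> z y (fe y))"


section \<open>Reconstruction assumptions\<close>

text \<open>From here on \<open>P\<close>, \<open>\<Gamma>\<close> and \<open>R\<close> are families indexed by \<open>\<epsilon>\<close>.\<close>

definition R1 ::
  "('d::finite \<Rightarrow> nat) \<Rightarrow> nat \<Rightarrow> ('d, 'v::real_vector) reg_struct \<Rightarrow>
     ('d, 'v, 'x::real_vector) discretisation \<Rightarrow> real \<Rightarrow>
     (real \<Rightarrow> real^'d \<Rightarrow> 'v \<Rightarrow> 'x) \<Rightarrow> (real \<Rightarrow> ('d, 'v) transport) \<Rightarrow>
     (real \<Rightarrow> (real^'d \<Rightarrow> 'v) \<Rightarrow> 'x) \<Rightarrow> bool" where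
  "R1 s r T D \<gamma> P \<Gamma> R \<longleftrightarrow> (\<forall>K. compact K \<longrightarrow> (\<exists>C::real.
     \<forall>\<epsilon>\<in>{0<..1}. \<forall>z\<in>K. \<forall>L. small_compact s \<epsilon> L \<and> z \<in> L \<longrightarrow> (\<forall>f\<in>D_space s T D \<epsilon> \<gamma> (\<Gamma> \<epsilon>).
       xnorm D \<gamma> L z \<epsilon> (R \<epsilon> f - P \<epsilon> z (f z))
         \<le> ennreal C * (Pi_norm s r T D \<epsilon> \<gamma> (fatten s L) (P \<epsilon>) * fnorm D (\<Gamma> \<epsilon>) \<gamma> L \<epsilon> f))))"

definition reconstruction ::
  "('d::finite \<Rightarrow> nat) \<Rightarrow> nat \<Rightarrow> ('d, 'v::real_vector) reg_struct \<Rightarrow>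
     ('d, 'v, 'x::real_vector) discretisation \<Rightarrow> real \<Rightarrow>
     (real \<Rightarrow> real^'d \<Rightarrow> 'v \<Rightarrow> 'x) \<Rightarrow> (real \<Rightarrow> ('d, 'v) transport) \<Rightarrow>
     (real \<Rightarrow> (real^'d \<Rightarrow> 'v) \<Rightarrow> 'x) \<Rightarrow> bool" where
  "reconstruction s r T D \<gamma> P \<Gamma> R \<longleftrightarrow>
     (\<forall>\<epsilon>\<in>{0<..1}.
        (\<forall>f\<in>D_space s T D \<epsilon> \<gamma> (\<Gamma> \<epsilon>). R \<epsilon> f \<in> dspace D \<epsilon>) \<and>
        (\<forall>f\<in>D_space s T D \<epsilon> \<gamma> (\<Gamma> \<epsilon>). \<forall>g\<in>D_space s T D \<epsilon> \<gamma> (\<Gamma> \<epsilon>).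
           R \<epsilon> (\<lambda>y. f y + g y) = R \<epsilon> f + R \<epsilon> g) \<and>
        (\<forall>a. \<forall>f\<in>D_space s T D \<epsilon> \<gamma> (\<Gamma> \<epsilon>). R \<epsilon> (\<lambda>y. a *\<^sub>R f y) = a *\<^sub>R R \<epsilon> f)) \<and>
     R1 s r T D \<gamma> P \<Gamma> R"

definition R2 ::
  "('d::finite \<Rightarrow> nat) \<Rightarrow> nat \<Rightarrow> ('d, 'v::real_vector) reg_struct \<Rightarrow>
     ('d, 'v, 'x::real_vector) discretisation \<Rightarrow> real \<Rightarrow>
     (real \<Rightarrow> real^'d \<Rightarrow> 'v \<Rightarrow> 'x) \<Rightarrow> (real \<Rightarrow> ('d, 'v) transport) \<Rightarrow>
     (real \<Rightarrow> (real^'d \<Rightarrow> 'v) \<Rightarrow> 'x) \<Rightarrow>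
     (real \<Rightarrow> real^'d \<Rightarrow> 'v \<Rightarrow> 'x) \<Rightarrow> (real \<Rightarrow> ('d, 'v) transport) \<Rightarrow>
     (real \<Rightarrow> (real^'d \<Rightarrow> 'v) \<Rightarrow> 'x) \<Rightarrow> bool" where
  "R2 s r T D \<gamma> P \<Gamma> R P' \<Gamma>' R' \<longleftrightarrow> (\<forall>K. compact K \<longrightarrow> (\<exists>C::real.
     \<forall>\<epsilon>\<in>{0<..1}. \<forall>z\<in>K. \<forall>L. small_compact s \<epsilon> L \<and> z \<in> L \<longrightarrow>
     (\<forall>f\<in>D_space s T D \<epsilon> \<gamma> (\<Gamma> \<epsilon>). \<forall>f'\<in>D_space s T D \<epsilon> \<gamma> (\<Gamma>' \<epsilon>).
       xnorm D \<gamma> L z \<epsilon> (R \<epsilon> f - P \<epsilon> z (f z) - R' \<epsilon> f' + P' \<epsilon> z (f' z))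
         \<le> ennreal C *
           (Pi_norm s r T D \<epsilon> \<gamma> (fatten s L) (P' \<epsilon>) * pnorm D (\<Gamma> \<epsilon>) (\<Gamma>' \<epsilon>) \<gamma> L \<epsilon> f f'
            + Pi_norm s r T D \<epsilon> \<gamma> (fatten s L) (\<lambda>x \<tau>. P \<epsilon> x \<tau> - P' \<epsilon> x \<tau>)
              * fnorm D (\<Gamma> \<epsilon>) \<gamma> L \<epsilon> f))))"

definition R3 ::
  "('d::finite \<Rightarrow> nat) \<Rightarrow> nat \<Rightarrow> ('d, 'v::real_vector) reg_struct \<Rightarrow>
     ('d, 'v, 'x::real_vector) discretisation \<Rightarrow> real \<Rightarrow>
     (real \<Rightarrow> real^'d \<Rightarrow> 'v \<Rightarrow> 'x) \<Rightarrow> (real \<Rightarrow> ('d, 'v) transport) \<Rightarrow>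
     (real \<Rightarrow> (real^'d \<Rightarrow> 'v) \<Rightarrow> 'x) \<Rightarrow>
     (real^'d \<Rightarrow> 'v \<Rightarrow> 'd functional) \<Rightarrow> ('d, 'v) transport \<Rightarrow>
     ((real^'d \<Rightarrow> 'v) \<Rightarrow> 'd functional) \<Rightarrow> bool" where
  "R3 s r T D \<gamma> P \<Gamma> R Pc \<Gamma>c Rc \<longleftrightarrow> (\<forall>K. compact K \<longrightarrow> (\<exists>C::real.
     \<forall>\<epsilon>\<in>{0<..1}. \<forall>z\<in>K. \<forall>\<eta>\<in>test_functions s r.
     \<forall>f\<in>Dc_space s T \<gamma> \<Gamma>c. \<forall>fe\<in>D_space s T D \<epsilon> \<gamma> (\<Gamma> \<epsilon>).
       ennreal \<bar>emb D \<epsilon> (R \<epsilon> fe - P \<epsilon> z (fe z)) (rescale s z \<epsilon> \<eta>)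
                - (Rc f (rescale s z \<epsilon> \<eta>) - Pc z (f z) (rescale s z \<epsilon> \<eta>))\<bar>
         \<le> ennreal (C * \<epsilon> powr \<gamma>) *
           (Pi_norm s r T D \<epsilon> \<gamma> (fatten s (tsupp s \<eta> z \<epsilon>)) (P \<epsilon>)
              * Dc_dist s T D \<epsilon> \<gamma> (tsupp s \<eta> z \<epsilon>) \<Gamma>c (\<Gamma> \<epsilon>) f fe
            + Pi_dist s r T D \<epsilon> \<gamma> (fatten s (tsupp s \<eta> z \<epsilon>)) Pc (P \<epsilon>)
              * Dc_norm s T \<gamma> (tsupp s \<eta> z \<epsilon>) \<Gamma>c f)))"

text \<open>The reconstruction theorem evaluates the model norms on the 1-fattening of
  \<open>K \<union> [\<eta>\<^sub>z\<^sup>\<delta>]\<close>. This is the 1-fattening of \<open>K\<close> itself when \<open>[\<eta>\<^sub>z\<^sup>\<delta>] \<subseteq> K\<close>. In general the larger set is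
  needed: the assumptions are applied at points of \<open>[\<eta>\<^sub>z\<^sup>\<delta>]\<close>, which may lie at distance up
  to \<open>1\<close> from \<open>K\<close>, and there they involve the model on a further 1-fattening.\<close>

end

theory Submission
  imports Defs
begin

text \<open>All three bounds say that functionals \<open>U x\<close>, indexed by base points \<open>x\<close>, are of order \<open>\<delta> powr \<gamma>\<close> on test
  functions at scale \<open>\<delta>\<close> centred at their base point; in the first one \<open>U x\<close> is \<open>R f - \<Pi>\<^sub>x f(x)\<close>, in
  the others it is a difference of two such terms. Two facts are available. At scale
  \<open>\<epsilon>\<close> the bound follows from the assumptions. And \<open>U y - U x\<close> does not involve the
  reconstruction: in the first case, since \<open>\<Pi>\<^sub>x = \<Pi>\<^sub>y \<Gamma>\<^sub>y\<^sub>x\<close>, it is up to sign \<open>\<Pi>\<^sub>y\<close>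
  applied to an increment of the modelled distribution, in the others a sum of two terms of this kind. It is
  therefore of order \<open>\<delta> powr \<gamma>\<close> when \<open>x\<close> and \<open>y\<close> are at distance at most \<open>\<delta>\<close> and it is tested at a
  scale comparable to \<open>\<delta>\<close>.

  The bound is carried from a scale \<open>l\<close> to a larger scale \<open>\<delta>\<close> by cutting a test function into
  cells of size \<open>l\<close> with a partition of unity (\<open>test_function_splitting\<close>) and evaluating each cell with the
  functional of a base point in or near the cell (\<open>scale_step\<close>). If the bound at scale \<open>l\<close> holds with the
  constant \<open>A\<close>, the one at scale \<open>\<delta>\<close> then holds with the constant \<open>C0 * ((l / \<delta>) powr \<gamma> * A + B)\<close>, where \<open>B\<close> comes
  from the second fact. The point is that
  \<open>C0\<close> does not depend on the ratio \<open>M = \<delta> / l\<close>, since the total mass of the cells does not. As \<open>\<gamma> > 0\<close>,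
  a ratio with \<open>C0 * M powr (- \<gamma>) \<le> 1 / 2\<close> exists, and with it the bound propagates from \<open>\<epsilon>\<close> through all
  scales with a single constant (\<open>multiscale_bound\<close>).

  The norms of the modelled distributions are localised to the support of the test function
  and its base point, and increments are controlled only at distances between \<open>\<epsilon>\<close> and 1.
  Both restrictions are met by the choice of the base point of a cell. A cell is cut out of the
  test function, so its support lies in that of the test function, and any of its points
  may be used. A point at distance at least \<open>\<epsilon>\<close> from the original base point is chosen if there
  is one; otherwise the cell is so close to the original base point that this can be kept.\<close>


section \<open>Functions with bounded derivatives\<close>

text \<open>The bound is an extended number: the value \<open>top\<close> expresses plain \<open>C\<^sup>n\<close> regularity, so that the
  rules below serve both regularity and quantitative control of the norm.\<close>

definition Cr_bounded :: "nat \<Rightarrow> ennreal \<Rightarrow> ((real^'d::finite) \<Rightarrow> real) \<Rightarrow> bool" where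
  "Cr_bounded n B f \<longleftrightarrow> C_diff n f \<and> C_norm n f \<le> B"

lemma Cr_bounded_0:
  "Cr_bounded 0 B f \<longleftrightarrow> continuous_on UNIV f \<and> (\<forall>x. ennreal \<bar>f x\<bar> \<le> B)"
  by (auto simp: Cr_bounded_def C_norm_def SUP_le_iff)

text \<open>The last direction in a list is the one differentiated first, so the recursion on the order
  peels lists of directions from the end.\<close>

lemma Cr_bounded_Suc:
  "Cr_bounded (Suc n) B f \<longleftrightarrow> (\<forall>x. f differentiable (at x)) \<and> (\<forall>x. ennreal \<bar>f x\<bar> \<le> B)
     \<and> (\<forall>i. Cr_bounded n B (partial i f))"
proof -
  have "C_norm (Suc n) f \<le> B \<longleftrightarrow> (\<forall>x. ennreal \<bar>f x\<bar> \<le> B) \<and> (\<forall>i. C_norm n (partial i f) \<le> B)"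
    (is "?L \<longleftrightarrow> ?R")
  proof
    assume L: ?L
    then have bd: "ennreal \<bar>foldr partial is f x\<bar> \<le> B" if "length is \<le> Suc n" for "is" x
      using that by (auto simp: C_norm_def SUP_le_iff)
    show ?R
      using bd[of "[]"] bd[of "_ @ [_]"] by (auto simp: C_norm_def SUP_le_iff)
  next
    assume R: ?R
    have "ennreal \<bar>foldr partial is f x\<bar> \<le> B" if "length is \<le> Suc n" for "is" x
      using that R by (cases "is" rule: rev_cases) (auto simp: C_norm_def SUP_le_iff)
    then show ?L by (auto simp: C_norm_def SUP_le_iff)
  qed
  then show ?thesis by (auto simp: Cr_bounded_def)
qed

lemma C_diff_iff: "C_diff n f \<longleftrightarrow> Cr_bounded n top f"
  by (simp add: Cr_bounded_def)

lemma Cr_bounded_mono: "Cr_bounded n A f \<Longrightarrow> A \<le> B \<Longrightarrow> Cr_bounded n B f"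
  by (auto simp: Cr_bounded_def)

lemma Cr_bounded_SucD: "Cr_bounded (Suc n) B f \<Longrightarrow> Cr_bounded n B f"
proof (induction n arbitrary: f)
  case 0
  then have "continuous_on UNIV f"
    by (auto simp: Cr_bounded_Suc continuous_on_eq_continuous_at differentiable_imp_continuous_within)
  then show ?case using 0 by (auto simp: Cr_bounded_Suc Cr_bounded_0)
next
  case (Suc n)
  then show ?case by (metis Cr_bounded_Suc)
qed

lemma Cr_bounded_value: "Cr_bounded n B f \<Longrightarrow> ennreal \<bar>f x\<bar> \<le> B"
  by (cases n) (auto simp: Cr_bounded_Suc Cr_bounded_0)

lemma Cr_bounded_continuous: "Cr_bounded n B f \<Longrightarrow> continuous_on UNIV f"
  by (induction n) (auto simp: Cr_bounded_0 dest: Cr_bounded_SucD)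

lemma partial_eq: "(f has_derivative f') (at x) \<Longrightarrow> partial i f x = f' (axis i 1)"
  unfolding partial_def by (simp add: frechet_derivative_at[symmetric])

lemma differentiable_has_partial:
  "f differentiable (at x) \<Longrightarrow>
     \<exists>f'. (f has_derivative f') (at x) \<and> (\<forall>i. f' (axis i 1) = partial i f x)"
  by (metis differentiable_def partial_eq)

lemma ennreal_abs_add_le:
  assumes "ennreal \<bar>x\<bar> \<le> A" "ennreal \<bar>y\<bar> \<le> B"
  shows "ennreal \<bar>x + y\<bar> \<le> A + B"
proof -
  have "ennreal \<bar>x + y\<bar> \<le> ennreal \<bar>x\<bar> + ennreal \<bar>y\<bar>"
    by (simp add: ennreal_plus[symmetric] ennreal_leI abs_triangle_ineq del: ennreal_plus)
  also have "\<dots> \<le> A + B"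
    using assms by (rule add_mono)
  finally show ?thesis .
qed

lemma Cr_bounded_add:
  "Cr_bounded n A f \<Longrightarrow> Cr_bounded n B g \<Longrightarrow> Cr_bounded n (A + B) (\<lambda>x. f x + g x)"
proof (induction n arbitrary: f g)
  case 0
  then show ?case
    by (auto simp: Cr_bounded_0 intro!: continuous_intros ennreal_abs_add_le)
next
  case (Suc n)
  have d: "((\<lambda>x. f x + g x) has_derivative (\<lambda>h. f' h + g' h)) (at x)"
    if "(f has_derivative f') (at x)" "(g has_derivative g') (at x)" for f' g' x
    using that by (rule has_derivative_add)
  have p: "partial i (\<lambda>x. f x + g x) = (\<lambda>x. partial i f x + partial i g x)" for i
  proof
    fix x
    show "partial i (\<lambda>x. f x + g x) x = partial i f x + partial i g x"
      using Suc.prems differentiable_has_partial[of f x] differentiable_has_partial[of g x]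
      by (auto simp: Cr_bounded_Suc dest!: partial_eq[OF d])
  qed
  have "ennreal \<bar>f x + g x\<bar> \<le> A + B" for x
    using Cr_bounded_value[OF Suc.prems(1), of x] Cr_bounded_value[OF Suc.prems(2), of x]
    by (rule ennreal_abs_add_le)
  then show ?case
    using Suc unfolding Cr_bounded_Suc p by (auto intro: differentiable_add)
qed

text \<open>The product rule turns each derivative of a product into two terms, and the bound for lower
  orders is inherited by both factors; \<open>n\<close> derivatives therefore cost \<open>2 ^ n\<close>.\<close>

lemma Cr_bounded_mult:
  "Cr_bounded n A f \<Longrightarrow> Cr_bounded n B g \<Longrightarrow> Cr_bounded n (2 ^ n * (A * B)) (\<lambda>x. f x * g x)"
proof (induction n arbitrary: f g)
  case 0
  then show ?case
    by (auto simp: Cr_bounded_0 abs_mult ennreal_mult intro!: continuous_intros mult_mono)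
next
  case (Suc n)
  have d: "((\<lambda>x. f x * g x) has_derivative (\<lambda>h. f x * g' h + f' h * g x)) (at x)"
    if "(f has_derivative f') (at x)" "(g has_derivative g') (at x)" for f' g' x
    using that by (rule has_derivative_mult)
  have p: "partial i (\<lambda>x. f x * g x) = (\<lambda>x. partial i f x * g x + f x * partial i g x)" for i
  proof
    fix x
    obtain f' g' where "(f has_derivative f') (at x)" "\<forall>i. f' (axis i 1) = partial i f x"
      "(g has_derivative g') (at x)" "\<forall>i. g' (axis i 1) = partial i g x"
      using Suc.prems differentiable_has_partial[of f x] differentiable_has_partial[of g x]
      by (auto simp: Cr_bounded_Suc)
    then show "partial i (\<lambda>x. f x * g x) x = partial i f x * g x + f x * partial i g x"
      using partial_eq[OF d, of f' x g' i] by simp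
  qed
  have "ennreal \<bar>f x * g x\<bar> \<le> 1 * (A * B)" for x
    using Cr_bounded_value[OF Suc.prems(1), of x] Cr_bounded_value[OF Suc.prems(2), of x]
    by (simp add: abs_mult ennreal_mult mult_mono)
  moreover have "1 * (A * B) \<le> 2 ^ Suc n * (A * B)"
    by (intro mult_right_mono one_le_power) auto
  ultimately have "ennreal \<bar>f x * g x\<bar> \<le> 2 ^ Suc n * (A * B)" for x
    using order_trans by blast
  moreover have "Cr_bounded n (2 ^ Suc n * (A * B)) (partial i (\<lambda>x. f x * g x))" for i
  proof -
    have eq: "2 ^ Suc n * (A * B) = 2 ^ n * (A * B) + 2 ^ n * (A * B)"
      by (simp add: mult_2 distrib_right)
    have "Cr_bounded n A f" "Cr_bounded n B g"
      "Cr_bounded n A (partial i f)" "Cr_bounded n B (partial i g)"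
      using Suc.prems Cr_bounded_SucD by (auto simp: Cr_bounded_Suc)
    then show ?thesis
      unfolding p eq by (intro Cr_bounded_add Suc.IH)
  qed
  ultimately show ?case
    using Suc.prems unfolding Cr_bounded_Suc by (auto intro: differentiable_mult)
qed

lemma partial_const: "partial i (\<lambda>x. c) = (\<lambda>x. 0)"
  by (rule ext) (simp add: partial_eq[OF has_derivative_const])

lemma Cr_bounded_const: "Cr_bounded n (ennreal \<bar>c\<bar>) (\<lambda>x. c)"
proof -
  have z: "Cr_bounded n 0 (\<lambda>x::real^'d. 0)" for n
    by (induction n) (auto simp: Cr_bounded_0 Cr_bounded_Suc partial_const)
  show ?thesis
    by (cases n) (auto simp: Cr_bounded_0 Cr_bounded_Suc partial_const
      intro: Cr_bounded_mono[OF z])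
qed

lemma Cr_bounded_scale:
  assumes "Cr_bounded n A f"
  shows "Cr_bounded n (ennreal \<bar>c\<bar> * A) (\<lambda>x. c * f x)"
  using assms
proof (induction n arbitrary: f)
  case 0
  then show ?case
    by (auto simp: Cr_bounded_0 abs_mult ennreal_mult intro!: continuous_intros mult_left_mono)
next
  case (Suc n)
  have d: "((\<lambda>x. c * f x) has_derivative (\<lambda>h. c * f' h)) (at x)"
    if "(f has_derivative f') (at x)" for f' x
    using that by (rule has_derivative_mult_right)
  have p: "partial i (\<lambda>x. c * f x) = (\<lambda>x. c * partial i f x)" for i
  proof
    fix x
    show "partial i (\<lambda>x. c * f x) x = c * partial i f x"
      using Suc.prems differentiable_has_partial[of f x]
      by (auto simp: Cr_bounded_Suc dest!: partial_eq[OF d])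
  qed
  show ?case
    using Suc unfolding Cr_bounded_Suc p
    by (auto simp: abs_mult ennreal_mult intro: differentiable_mult mult_left_mono)
qed

text \<open>The chain rule multiplies derivatives by the slopes \<open>q i\<close>. Slopes of size at most 1 do not
  increase the norm: a test function seen at a smaller scale is still a test function.\<close>

lemma Cr_bounded_affine:
  assumes "Cr_bounded n A f" "(\<forall>i. \<bar>q i\<bar> \<le> 1) \<or> A = top"
  shows "Cr_bounded n A (\<lambda>x. f (\<chi> i. p i + q i * x $ i))"
  using assms
proof (induction n arbitrary: f)
  case 0
  then have "continuous_on UNIV (f \<circ> (\<lambda>x. \<chi> i. p i + q i * x $ i))"
    by (intro continuous_on_compose)
       (auto simp: Cr_bounded_0 intro!: continuous_intros intro: continuous_on_subset)
  with 0 show ?case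
    by (auto simp: Cr_bounded_0 o_def)
next
  case (Suc n)
  let ?h = "\<lambda>x::real^'a. (\<chi> i. p i + q i * x $ i) :: real^'a"
  have h: "(?h has_derivative (\<lambda>v. \<chi> i. q i * v $ i)) (at x)" for x
  proof -
    have "linear (\<lambda>v::real^'a. (\<chi> i. q i * v $ i) :: real^'a)"
      by (rule linearI) (auto simp: vec_eq_iff algebra_simps)
    moreover have "?h = (\<lambda>x. (\<chi> i. p i) + (\<chi> i. q i * x $ i))"
      by (auto simp: vec_eq_iff)
    ultimately show ?thesis
      using has_derivative_add[OF has_derivative_const linear_imp_has_derivative] by force
  qed
  have d: "((\<lambda>x. f (?h x)) has_derivative (\<lambda>v. f' (\<chi> i. q i * v $ i))) (at x)"
    if "(f has_derivative f') (at (?h x))" for f' x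
    using has_derivative_compose[OF h that] .
  have p: "partial i (\<lambda>x. f (?h x)) = (\<lambda>x. q i * partial i f (?h x))" for i
  proof
    fix x
    obtain f' where f': "(f has_derivative f') (at (?h x))"
        "\<forall>i. f' (axis i 1) = partial i f (?h x)"
      using Suc.prems differentiable_has_partial[of f "?h x"] by (auto simp: Cr_bounded_Suc)
    have "(\<chi> j. q j * (axis i 1 :: real^'a) $ j) = q i *\<^sub>R axis i 1"
      by (auto simp: vec_eq_iff axis_def)
    moreover have "linear f'" using f'(1) has_derivative_linear by blast
    ultimately show "partial i (\<lambda>x. f (?h x)) x = q i * partial i f (?h x)"
      using partial_eq[OF d[OF f'(1)], of i] f'(2) by (simp add: linear_cmul)
  qed
  have "Cr_bounded n A (\<lambda>x. q i * partial i f (?h x))" for i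
  proof (rule Cr_bounded_mono)
    show "Cr_bounded n (ennreal \<bar>q i\<bar> * A) (\<lambda>x. q i * partial i f (?h x))"
      using Suc by (intro Cr_bounded_scale Suc.IH) (auto simp: Cr_bounded_Suc)
    show "ennreal \<bar>q i\<bar> * A \<le> A"
      using Suc.prems(2) mult_right_mono[of "ennreal \<bar>q i\<bar>" 1 A] by auto
  qed
  moreover have "(\<lambda>x. f (?h x)) differentiable at x" for x
    using Suc.prems d[of _ x] unfolding Cr_bounded_Suc differentiable_def by blast
  ultimately show ?case
    using Suc.prems unfolding Cr_bounded_Suc p by auto
qed

lemma C_diff_add: "C_diff n f \<Longrightarrow> C_diff n g \<Longrightarrow> C_diff n (\<lambda>x. f x + g x)"
  unfolding C_diff_iff using Cr_bounded_add by fastforce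

lemma C_diff_mult: "C_diff n f \<Longrightarrow> C_diff n g \<Longrightarrow> C_diff n (\<lambda>x. f x * g x)"
  unfolding C_diff_iff using Cr_bounded_mult Cr_bounded_mono top_greatest by metis

lemma C_diff_const: "C_diff n (\<lambda>x. c)"
  unfolding C_diff_iff using Cr_bounded_const Cr_bounded_mono top_greatest by metis

lemma C_diff_scale: "C_diff n f \<Longrightarrow> C_diff n (\<lambda>x. c * f x)"
  using C_diff_mult C_diff_const by blast

lemma C_diff_diff: "C_diff n f \<Longrightarrow> C_diff n g \<Longrightarrow> C_diff n (\<lambda>x. f x - g x)"
  using C_diff_add[of n f "\<lambda>x. -1 * g x"] C_diff_scale[of n g "-1"] by simp

lemma C_diff_prod: "(\<And>k. k \<in> I \<Longrightarrow> C_diff n (f k)) \<Longrightarrow> C_diff n (\<lambda>x. \<Prod>k\<in>I. f k x)"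
  by (induction I rule: infinite_finite_induct) (auto intro: C_diff_const C_diff_mult)

lemma C_diff_affine: "C_diff n f \<Longrightarrow> C_diff n (\<lambda>x. f (\<chi> i. p i + q i * x $ i))"
  unfolding C_diff_iff by (rule Cr_bounded_affine) auto

lemma C_diff_SucD: "C_diff (Suc n) f \<Longrightarrow> C_diff n f"
  unfolding C_diff_iff by (rule Cr_bounded_SucD)

lemma C_diff_inverse:
  "C_diff n f \<Longrightarrow> (\<And>x. f x \<noteq> 0) \<Longrightarrow> C_diff n (\<lambda>x. inverse (f x))"
proof (induction n)
  case 0
  then show ?case by (simp add: continuous_on_inverse)
next
  case (Suc n)
  have d: "((\<lambda>x. inverse (f x)) has_derivative (\<lambda>h. - (inverse (f x) * f' h * inverse (f x)))) (at x)"
    if "(f has_derivative f') (at x)" for f' x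
    by (rule Deriv.has_derivative_inverse[OF Suc.prems(2) that])
  have p: "partial i (\<lambda>x. inverse (f x)) = (\<lambda>x. - 1 * (inverse (f x) * partial i f x * inverse (f x)))" for i
  proof
    fix x
    show "partial i (\<lambda>x. inverse (f x)) x = - 1 * (inverse (f x) * partial i f x * inverse (f x))"
    proof -
      obtain f' where f': "(f has_derivative f') (at x)" "\<forall>i. f' (axis i 1) = partial i f x"
        using Suc.prems(1) differentiable_has_partial[of f x] by auto
      show ?thesis using partial_eq[OF d[OF f'(1)], of i] f'(2) by simp
    qed
  qed
  have "C_diff n (\<lambda>x. inverse (f x))"
    by (rule Suc.IH[OF C_diff_SucD[OF Suc.prems(1)] Suc.prems(2)])
  then have "C_diff n (partial i (\<lambda>x. inverse (f x)))" for i
    unfolding p using Suc.prems(1) by (intro C_diff_scale C_diff_mult) simp_all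
  moreover have "(\<lambda>x. inverse (f x)) differentiable at x" for x
  proof -
    obtain f' where f': "(f has_derivative f') (at x)"
      using Suc.prems(1) differentiable_has_partial[of f x] by auto
    show ?thesis by (rule differentiableI[OF d[OF f']])
  qed
  ultimately show ?case by simp
qed

text \<open>All cut-off functions below are built from truncated powers by sums, products and inverses, and
  inherit their regularity from them.\<close>

lemma C_diff_truncated_power: "C_diff n (\<lambda>x. max 0 (a + b * x $ i) ^ Suc n)"
proof (induction n)
  case 0
  then show ?case by (auto intro!: continuous_intros)
next
  case (Suc n)
  have tp: "((\<lambda>t::real. max 0 t ^ Suc (Suc n)) has_real_derivative
      real (Suc (Suc n)) * max 0 t ^ Suc n) (at t)" for t
  proof (cases t "0::real" rule: linorder_cases)
    case equal
    have "isCont (\<lambda>t::real. max 0 t ^ Suc n) 0"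
      by (intro continuous_intros)
    then show ?thesis
      unfolding equal CARAT_DERIV
      by (intro exI[of _ "\<lambda>t. max 0 t ^ Suc n"]) (simp add: max_def)
  next
    case greater
    have dv: "((\<lambda>t::real. t ^ Suc (Suc n)) has_real_derivative real (Suc (Suc n)) * t ^ Suc n) (at t)"
      using DERIV_pow[of "Suc (Suc n)" t] by simp
    have ev: "\<forall>\<^sub>F x in nhds t. max 0 x ^ Suc (Suc n) = x ^ Suc (Suc n)"
      using eventually_nhds_in_open[of "{0<..}" t] greater
      by (auto elim!: eventually_mono simp: max_def)
    have "((\<lambda>t::real. max 0 t ^ Suc (Suc n)) has_real_derivative
        real (Suc (Suc n)) * t ^ Suc n) (at t)"
      by (rule DERIV_cong_ev[THEN iffD2, OF refl ev refl dv])
    then show ?thesis using greater by (simp add: max_def)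
  next
    case less
    have ev: "\<forall>\<^sub>F x in nhds t. max 0 x ^ Suc (Suc n) = 0"
      using eventually_nhds_in_open[of "{..<0}" t] less
      by (auto elim!: eventually_mono simp: max_def)
    have "((\<lambda>t::real. max 0 t ^ Suc (Suc n)) has_real_derivative 0) (at t)"
      by (rule DERIV_cong_ev[THEN iffD2, OF refl ev refl DERIV_const])
    then show ?thesis using less by (simp add: max_def)
  qed
  have lin: "((\<lambda>x::real^'a. a + b * x $ i) has_derivative (\<lambda>h. b * h $ i)) (at x)" for x
    by (auto intro!: derivative_eq_intros bounded_linear_imp_has_derivative bounded_linear_vec_nth)
  have d: "((\<lambda>x::real^'a. max 0 (a + b * x $ i) ^ Suc (Suc n)) has_derivative
      (\<lambda>h. real (Suc (Suc n)) * max 0 (a + b * x $ i) ^ Suc n * (b * h $ i))) (at x)" for x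
    using has_derivative_compose[OF lin tp[unfolded has_field_derivative_def]] .
  have p: "partial j (\<lambda>x. max 0 (a + b * x $ i) ^ Suc (Suc n)) =
      (\<lambda>x. (real (Suc (Suc n)) * (b * (axis j 1 :: real^'a) $ i)) * max 0 (a + b * x $ i) ^ Suc n)" for j
    by (rule ext, subst partial_eq[OF d]) (simp only: mult_ac)
  have "(\<lambda>x::real^'a. max 0 (a + b * x $ i) ^ Suc (Suc n)) differentiable at x" for x
    by (rule differentiableI[OF d])
  then show ?case
    unfolding C_diff.simps(2) p using Suc by (intro conjI allI C_diff_scale)
qed

lemma Cr_bounded_of_compact_support:
  assumes "C_diff n f" "compact K" "\<And>x. x \<notin> K \<Longrightarrow> f x = 0"
  shows "\<exists>B::real. Cr_bounded n (ennreal B) f"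
  using assms(1,3)
proof (induction n arbitrary: f)
  case 0
  have "bounded (f ` K)"
    using 0 assms(2) by (metis C_diff.simps(1) compact_continuous_image compact_imp_bounded continuous_on_subset subset_UNIV)
  then obtain B where "\<forall>x\<in>K. \<bar>f x\<bar> \<le> B" by (auto simp: bounded_iff)
  then have "\<bar>f x\<bar> \<le> \<bar>B\<bar>" for x using 0 by (cases "x \<in> K") force+
  then show ?case using 0 by (auto simp: Cr_bounded_0 intro!: exI[of _ "\<bar>B\<bar>"] ennreal_leI)
next
  case (Suc n)
  have "partial i f x = 0" if "x \<notin> K" for i x
  proof -
    have "open (- K)" using assms(2) compact_imp_closed by blast
    then have "(f has_derivative (\<lambda>_. 0)) (at x)"
      using that Suc.prems(2)
      by (intro has_derivative_transform_within_open[OF has_derivative_const[of 0], of "- K"]) auto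
    then show ?thesis by (rule partial_eq)
  qed
  then have "\<forall>i. \<exists>B::real. Cr_bounded n (ennreal B) (partial i f)"
    using Suc by auto
  then obtain B where B: "\<And>i. Cr_bounded n (ennreal (B i)) (partial i f)" by metis
  have "continuous_on UNIV f"
    using Suc.prems C_diff_iff Cr_bounded_continuous by blast
  then have "bounded (f ` K)"
    using assms(2) by (metis compact_continuous_image compact_imp_bounded continuous_on_subset subset_UNIV)
  then obtain B0 where B0: "\<forall>x\<in>K. \<bar>f x\<bar> \<le> B0" by (auto simp: bounded_iff)
  define M where "M = \<bar>B0\<bar> + (\<Sum>i\<in>UNIV. \<bar>B i\<bar>)"
  have "\<bar>f x\<bar> \<le> \<bar>B0\<bar>" for x using B0 Suc.prems by (cases "x \<in> K") force+
  then have 1: "\<bar>f x\<bar> \<le> M" for x unfolding M_def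
    by (meson add_increasing2 sum_nonneg abs_ge_zero)
  have 2: "B i \<le> M" for i
    using member_le_sum[of i UNIV "\<lambda>i. \<bar>B i\<bar>"] unfolding M_def by auto
  have "Cr_bounded n (ennreal M) (partial i f)" for i
    by (rule Cr_bounded_mono[OF B ennreal_leI[OF 2]])
  then show ?case
    using Suc.prems 1 by (auto simp: Cr_bounded_Suc intro!: exI[of _ M] ennreal_leI)
qed

section \<open>Scaled geometry\<close>

lemma powr_inverse_le_iff:
  assumes "n \<ge> 1" "0 \<le> a" "0 \<le> t"
  shows "a powr (1 / real n) \<le> t \<longleftrightarrow> a \<le> t ^ n"
proof -
  have "t = (t ^ n) powr (1 / real n)"
    using assms by (cases "t = 0") (auto simp: powr_realpow[symmetric] powr_powr)
  then have "a powr (1 / real n) \<le> t \<longleftrightarrow> a powr (1 / real n) \<le> (t ^ n) powr (1 / real n)"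
    by simp
  also have "\<dots> \<longleftrightarrow> a \<le> t ^ n"
    using assms by (smt (verit) powr_less_mono2 powr_mono2 zero_le_power zero_less_divide_iff
        of_nat_0_less_iff of_nat_1 of_nat_mono)
  finally show ?thesis .
qed

lemma sdist_le_iff:
  assumes "\<And>i. s i \<ge> 1" "0 \<le> t"
  shows "sdist s y z \<le> t \<longleftrightarrow> (\<forall>i. \<bar>y $ i - z $ i\<bar> \<le> t ^ s i)"
  unfolding sdist_def using assms by (subst Max_le_iff) (auto simp: powr_inverse_le_iff)

lemma sdist_less_iff:
  assumes "\<And>i. s i \<ge> 1" "0 \<le> t"
  shows "sdist s y z < t \<longleftrightarrow> (\<forall>i. \<bar>y $ i - z $ i\<bar> < t ^ s i)"
proof -
  have "sdist s y z < t \<longleftrightarrow> (\<forall>i. \<bar>y $ i - z $ i\<bar> powr (1 / real (s i)) < t)"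
    unfolding sdist_def by (subst Max_less_iff) auto
  moreover have "a powr (1 / real (s i)) < t \<longleftrightarrow> a < t ^ s i" if "0 \<le> a" for a i
  proof (cases "t = 0")
    case True
    then show ?thesis using assms(1)[of i] that by (auto simp: power_0_left not_less)
  next
    case False
    have "t = (t ^ s i) powr (1 / real (s i))"
      using assms(1)[of i] assms(2) False by (auto simp: powr_realpow[symmetric] powr_powr)
    then have "a powr (1 / real (s i)) < t \<longleftrightarrow> a powr (1 / real (s i)) < (t ^ s i) powr (1 / real (s i))"
      by simp
    also have "\<dots> \<longleftrightarrow> a < t ^ s i"
      using assms(1)[of i] assms(2) that
      by (smt (verit) powr_less_mono2 powr_mono2 zero_le_power zero_less_divide_iff
        of_nat_0_less_iff of_nat_1 of_nat_mono)
    finally show ?thesis .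
  qed
  ultimately show ?thesis by simp
qed

lemma sdist_nonneg: "0 \<le> sdist s y z"
  unfolding sdist_def by (subst Max_ge_iff) auto

lemma sdist_self: "sdist s y y = 0"
  unfolding sdist_def by simp

lemma sdist_commute: "sdist s y z = sdist s z y"
  unfolding sdist_def by (simp add: abs_minus_commute)

text \<open>Superadditivity of powers makes the scaled distance satisfy the triangle inequality.\<close>

lemma add_power_le_power_add:
  fixes a b :: real
  assumes "n \<ge> 1" "0 \<le> a" "0 \<le> b"
  shows "a ^ n + b ^ n \<le> (a + b) ^ n"
  using assms(1)
proof (induction n rule: dec_induct)
  case (step n)
  have "a ^ Suc n + b ^ Suc n \<le> (a + b) * (a ^ n + b ^ n)"
    using assms by (simp add: algebra_simps)
  also have "\<dots> \<le> (a + b) * (a + b) ^ n"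
    using step assms by (intro mult_left_mono) auto
  finally show ?case by simp
qed simp

lemma sdist_triangle:
  assumes "\<And>i. s i \<ge> 1"
  shows "sdist s x z \<le> sdist s x y + sdist s y z"
proof -
  have "\<bar>x $ i - z $ i\<bar> \<le> (sdist s x y + sdist s y z) ^ s i" for i
  proof -
    have "\<bar>x $ i - y $ i\<bar> \<le> sdist s x y ^ s i" "\<bar>y $ i - z $ i\<bar> \<le> sdist s y z ^ s i"
      using sdist_le_iff[of s, OF assms sdist_nonneg] by blast+
    then show ?thesis
      using add_power_le_power_add[OF assms[of i] sdist_nonneg[of s x y] sdist_nonneg[of s y z]]
      by linarith
  qed
  then show ?thesis
    using assms by (subst sdist_le_iff) (auto intro: add_nonneg_nonneg sdist_nonneg)
qed

lemma fsupp_subset: "(\<And>x. f x \<noteq> 0 \<Longrightarrow> x \<in> S) \<Longrightarrow> closed S \<Longrightarrow> fsupp f \<subseteq> S"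
  unfolding fsupp_def by (rule closure_minimal) auto

lemma in_fsupp: "f x \<noteq> 0 \<Longrightarrow> x \<in> fsupp f"
  unfolding fsupp_def by (rule subsetD[OF closure_subset]) simp

lemma closed_fsupp: "closed (fsupp f)"
  by (simp add: fsupp_def)

lemma fsupp_comp_subset:
  assumes "continuous_on UNIV h" "\<And>x. g x \<noteq> 0 \<Longrightarrow> f (h x) \<noteq> 0"
  shows "fsupp g \<subseteq> h -` fsupp f"
  using assms by (intro fsupp_subset closed_vimage closed_fsupp) (auto intro: in_fsupp)

lemma continuous_on_affine_vec [continuous_intros]:
  "continuous_on S (\<lambda>x::real^'d. (\<chi> i. p i + q i * x $ i) :: real^'d)"
  by (auto intro!: continuous_intros)

lemma rescale_affine:
  "rescale s z \<delta> \<phi> = (\<lambda>x. (1 / \<delta> ^ (\<Sum>i\<in>UNIV. s i)) *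
     \<phi> (\<chi> i. - (z $ i / \<delta> ^ s i) + (1 / \<delta> ^ s i) * x $ i))"
  unfolding rescale_def by (simp add: diff_divide_distrib)

lemma fsupp_rescale_subset:
  assumes "\<And>i. s i \<ge> 1" "0 < \<delta>" "fsupp \<phi> \<subseteq> sball s 0 1"
  shows "fsupp (rescale s z \<delta> \<phi>) \<subseteq> sball s z \<delta>"
proof
  fix x assume "x \<in> fsupp (rescale s z \<delta> \<phi>)"
  moreover have "fsupp (rescale s z \<delta> \<phi>) \<subseteq>
      (\<lambda>x. \<chi> i. - (z $ i / \<delta> ^ s i) + (1 / \<delta> ^ s i) * x $ i) -` fsupp \<phi>"
    by (rule fsupp_comp_subset[OF continuous_on_affine_vec]) (simp add: rescale_affine)
  ultimately have "sdist s (\<chi> i. - (z $ i / \<delta> ^ s i) + (1 / \<delta> ^ s i) * x $ i) 0 < 1"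
    using assms(3) by (auto simp: sball_def)
  then have "\<bar>(x $ i - z $ i) / \<delta> ^ s i\<bar> < 1" for i
    using assms(1) by (simp add: sdist_less_iff diff_divide_distrib)
  then have "\<bar>x $ i - z $ i\<bar> < \<delta> ^ s i" for i
    using assms(2) by (simp add: abs_divide divide_less_eq)
  then show "x \<in> sball s z \<delta>"
    using assms by (simp add: sball_def sdist_less_iff)
qed

lemma bounded_sball:
  assumes "\<And>i. s i \<ge> 1" "0 \<le> \<delta>"
  shows "bounded (sball s z \<delta>)"
proof (rule bounded_subset[OF bounded_cbox])
  show "sball s z \<delta> \<subseteq> cbox (\<chi> i. z $ i - \<delta> ^ s i) (\<chi> i. z $ i + \<delta> ^ s i)"
    using assms by (auto simp: sball_def sdist_less_iff mem_box_cart abs_less_iff)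
      (smt (verit))+
qed

lemma compact_fsupp: "bounded B \<Longrightarrow> fsupp f \<subseteq> B \<Longrightarrow> compact (fsupp f)"
  by (meson bounded_subset closed_fsupp compact_eq_bounded_closed)

lemma rescale_in_Cc:
  assumes "\<And>i. s i \<ge> 1" "0 < \<delta>" "\<phi> \<in> test_functions s r"
  shows "rescale s z \<delta> \<phi> \<in> Cc r"
proof -
  have "C_diff r (rescale s z \<delta> \<phi>)"
    unfolding rescale_affine using assms(3)
    by (intro C_diff_scale C_diff_affine) (simp add: test_functions_def)
  moreover have "compact (fsupp (rescale s z \<delta> \<phi>))"
    using compact_fsupp[OF bounded_sball fsupp_rescale_subset] assms
    by (auto simp: test_functions_def)
  ultimately show ?thesis by (simp add: Cc_def)
qed

lemma compact_tsupp:
  assumes "\<And>i. s i \<ge> 1" "0 < \<delta>" "\<phi> \<in> test_functions s r"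
  shows "compact (tsupp s \<phi> z \<delta>)"
  using rescale_in_Cc[of s \<delta> \<phi> r z] assms by (simp add: tsupp_def Cc_def)

lemma tsupp_subset_sball:
  assumes "\<And>i. s i \<ge> 1" "0 < \<delta>" "\<phi> \<in> test_functions s r"
  shows "tsupp s \<phi> z \<delta> \<subseteq> sball s z \<delta>"
  using fsupp_rescale_subset[of s \<delta> \<phi> z] assms
  by (auto simp: tsupp_def sball_def sdist_self test_functions_def)

lemma small_compact_tsupp:
  assumes "\<And>i. s i \<ge> 1" "0 < \<delta>" "\<phi> \<in> test_functions s r"
  shows "small_compact s \<delta> (tsupp s \<phi> z \<delta>)"
  unfolding small_compact_def
proof (intro conjI ballI)
  show "compact (tsupp s \<phi> z \<delta>)" using assms by (rule compact_tsupp)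
  fix x y assume "x \<in> tsupp s \<phi> z \<delta>" "y \<in> tsupp s \<phi> z \<delta>"
  then have "sdist s x z < \<delta>" "sdist s z y < \<delta>"
    using tsupp_subset_sball[of s \<delta> \<phi> r z] assms by (auto simp: sball_def sdist_commute)
  then show "sdist s x y \<le> 2 * \<delta>"
    using sdist_triangle[of s x y z, OF assms(1)] by linarith
qed


section \<open>A partition of unity with bounded derivatives\<close>

text \<open>The step climbs from 0 to 1 over \<open>[0, 1]\<close>, and the hat is the difference of two neighbouring
  steps. The sum of integer translates of the hat then telescopes to 1.\<close>

definition smooth_step :: "nat \<Rightarrow> real \<Rightarrow> real" where
  "smooth_step r t = max 0 t ^ Suc r * inverse (max 0 t ^ Suc r + max 0 (1 - t) ^ Suc r)"

definition smooth_hat :: "nat \<Rightarrow> real \<Rightarrow> real" where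
  "smooth_hat r t = smooth_step r (t + 1) - smooth_step r t"

text \<open>\<open>t\<close> and \<open>1 - t\<close> are never both nonpositive; the step is therefore as regular as the truncated powers
  that it is made of.\<close>

lemma step_denominator_pos: "0 < max 0 t ^ Suc r + max 0 (1 - t) ^ Suc r" for t :: real
proof (cases "0 < t")
  case True
  then show ?thesis by (intro add_pos_nonneg zero_less_power zero_le_power) auto
next
  case False
  then show ?thesis by (intro add_nonneg_pos zero_less_power zero_le_power) auto
qed

lemma smooth_step_0: "t \<le> 0 \<Longrightarrow> smooth_step r t = 0"
  by (simp add: smooth_step_def)

lemma smooth_step_1: "1 \<le> t \<Longrightarrow> smooth_step r t = 1"
  by (auto simp: smooth_step_def max_def field_simps)

lemma smooth_hat_support: "smooth_hat r t \<noteq> 0 \<Longrightarrow> \<bar>t\<bar> \<le> 1"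
  by (rule ccontr)
     (auto simp: smooth_hat_def smooth_step_0 smooth_step_1 not_le abs_if split: if_splits)

lemma smooth_hat_sum:
  assumes "\<bar>t\<bar> \<le> real_of_int N"
  shows "(\<Sum>j\<in>{-N..N}. smooth_hat r (t - of_int j)) = 1"
proof -
  have N: "0 \<le> N" using assms by linarith
  have tele: "(\<Sum>j\<in>{-N..<-N + int n}. smooth_hat r (t - of_int j)) =
      smooth_step r (t + 1 + N) - smooth_step r (t + 1 + N - real n)" for n
  proof (induction n)
    case (Suc n)
    have "{-N..<-N + int (Suc n)} = insert (-N + int n) {-N..<-N + int n}" by auto
    then show ?case using Suc by (simp add: smooth_hat_def algebra_simps)
  qed simp
  have "{-N..N} = {-N..<-N + int (nat (2 * N + 1))}" using N by auto
  then show ?thesis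
    using tele[of "nat (2 * N + 1)"] N assms by (simp add: smooth_step_0 smooth_step_1)
qed

lemma C_diff_smooth_step: "C_diff r (\<lambda>x. smooth_step r (a + b * x $ i))"
proof -
  have "C_diff r (\<lambda>x. max 0 (1 - (a + b * x $ i)) ^ Suc r)"
    using C_diff_truncated_power[of r "1 - a" "- b" i] by (simp add: algebra_simps)
  then show ?thesis
    unfolding smooth_step_def using step_denominator_pos
    by (intro C_diff_mult C_diff_inverse C_diff_add C_diff_truncated_power)
       (auto simp del: power_Suc simp: less_imp_neq[symmetric])
qed

text \<open>The factor 3 gives each cell a width of 2/3 in every coordinate. A cell is then contained in
  the open unit box around any of its points, so each of its points can serve as a base point.\<close>

definition cell_bump :: "nat \<Rightarrow> real^'d::finite \<Rightarrow> real" where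
  "cell_bump r u = (\<Prod>i\<in>UNIV. smooth_hat r (3 * u $ i))"

lemma C_diff_cell_bump: "C_diff r (cell_bump r)"
proof -
  have "C_diff r (\<lambda>u. smooth_hat r (3 * u $ i))" for i
    unfolding smooth_hat_def
    using C_diff_diff[OF C_diff_smooth_step[of r 1 3 i] C_diff_smooth_step[of r 0 3 i]]
    by (simp add: add.commute)
  then show ?thesis
    unfolding cell_bump_def by (intro C_diff_prod)
qed

lemma cell_bump_support: "cell_bump r u \<noteq> 0 \<Longrightarrow> \<bar>3 * u $ i\<bar> \<le> 1"
  unfolding cell_bump_def by (intro smooth_hat_support) auto

lemma cell_bump_bounded: "\<exists>B\<ge>1. Cr_bounded r (ennreal B) (cell_bump r :: real^'d::finite \<Rightarrow> real)"
proof -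
  have "cell_bump r u = 0" if "u \<notin> cbox (\<chi> i. -1) (\<chi> i. 1)" for u :: "real^'d"
  proof (rule ccontr)
    assume nz: "cell_bump r u \<noteq> 0"
    have "-1 \<le> u $ i \<and> u $ i \<le> 1" for i
      using cell_bump_support[OF nz, of i] by linarith
    then have "u \<in> cbox (\<chi> i. -1) (\<chi> i. 1)" by (simp add: mem_box_cart)
    then show False using that by simp
  qed
  then obtain B where B: "Cr_bounded r (ennreal B) (cell_bump r :: real^'d \<Rightarrow> real)"
    using Cr_bounded_of_compact_support[OF C_diff_cell_bump compact_cbox] by metis
  then have "Cr_bounded r (ennreal (max 1 B)) (cell_bump r :: real^'d \<Rightarrow> real)"
    by (rule Cr_bounded_mono) (auto intro: ennreal_leI)
  then show ?thesis by (intro exI[of _ "max 1 B"]) auto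
qed

text \<open>The sum over a box of lattice points factorises into one telescoping sum per coordinate.\<close>

lemma cell_bump_sum:
  fixes u :: "real^'d::finite"
  assumes "\<And>i. \<bar>3 * u $ i\<bar> \<le> of_int (N i)"
  shows "(\<Sum>k\<in>PiE UNIV (\<lambda>i. {-N i..N i}). cell_bump r (\<chi> i. u $ i - of_int (k i) / 3)) = 1"
proof -
  have "(\<Prod>i\<in>UNIV. \<Sum>j\<in>{-N i..N i}. smooth_hat r (3 * u $ i - of_int j)) = 1"
    using smooth_hat_sum[OF assms] by simp
  then show ?thesis
    by (subst (asm) prod_sum_PiE) (auto simp: cell_bump_def algebra_simps)
qed

lemma test_functions_iff:
  "\<phi> \<in> test_functions s r \<longleftrightarrow> Cr_bounded r 1 \<phi> \<and> fsupp \<phi> \<subseteq> sball s 0 1"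
  by (auto simp: test_functions_def Cr_bounded_def)

text \<open>Undoing the rescaling about \<open>y\<close> exhibits a function localised near \<open>y\<close> as a multiple of a
  rescaled test function.\<close>

lemma test_function_of_localised:
  fixes s :: "'d::finite \<Rightarrow> nat"
  assumes s: "\<And>i. s i \<ge> 1" and l: "0 < l" and a: "0 < a"
    and supp: "fsupp \<psi> \<subseteq> sball s y l"
    and bd: "Cr_bounded r 1 (\<lambda>u. l ^ (\<Sum>i\<in>UNIV. s i) / a * \<psi> (\<chi> i. y $ i + l ^ s i * u $ i))"
  shows "\<exists>\<phi>\<in>test_functions s r. \<psi> = (\<lambda>x. a * rescale s y l \<phi> x)"
proof (rule bexI)
  let ?\<phi> = "\<lambda>u. l ^ (\<Sum>i\<in>UNIV. s i) / a * \<psi> (\<chi> i. y $ i + l ^ s i * u $ i)"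
  have "fsupp ?\<phi> \<subseteq> (\<lambda>u. \<chi> i. y $ i + l ^ s i * u $ i) -` fsupp \<psi>"
    by (rule fsupp_comp_subset[OF continuous_on_affine_vec]) auto
  then have "sdist s (\<chi> i. y $ i + l ^ s i * u $ i) y < l" if "u \<in> fsupp ?\<phi>" for u
    using supp that by (auto simp: sball_def)
  then have "\<bar>u $ i\<bar> < 1" if "u \<in> fsupp ?\<phi>" for u i
    using that s l by (force simp: sdist_less_iff abs_mult)
  then have "fsupp ?\<phi> \<subseteq> sball s 0 1"
    using s by (auto simp: sball_def sdist_less_iff)
  then show "?\<phi> \<in> test_functions s r"
    using bd by (simp add: test_functions_iff)
  show "\<psi> = (\<lambda>x. a * rescale s y l ?\<phi> x)"
    using l a by (simp add: rescale_def fun_eq_iff)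
qed

text \<open>A test function at scale \<open>\<delta>\<close> is split into cells of size \<open>l\<close>, each of amplitude \<open>a\<close> as a test
  function at scale \<open>l\<close>. The total amplitude stays bounded as \<open>\<delta> / l\<close> grows: there are of the
  order of \<open>(\<delta> / l) ^ |s|\<close> cells, and the amplitude of each is of the order of \<open>(l / \<delta>) ^ |s|\<close> since,
  at scale \<open>l\<close>, the original function is nearly constant. That the constant depends on neither
  scale is what closes the induction over scales. The base point of a cell is left free: any
  point within distance \<open>l\<close> of the whole cell will do.\<close>

lemma test_function_splitting:
  fixes s :: "'d::finite \<Rightarrow> nat"
  assumes s: "\<And>i. s i \<ge> 1"
  obtains C :: real where "C > 0"
    and "\<And>\<eta> \<delta> l z. \<eta> \<in> test_functions s r \<Longrightarrow> 0 < l \<Longrightarrow> l \<le> \<delta> \<Longrightarrow>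
      \<exists>(I :: ('d \<Rightarrow> int) set) (a :: real) \<psi>. finite I \<and> 0 < a \<and> a * card I \<le> C \<and>
        rescale s z \<delta> \<eta> = (\<lambda>x. \<Sum>k\<in>I. \<psi> k x) \<and>
        (\<forall>k\<in>I. \<psi> k \<in> Cc r \<and> fsupp (\<psi> k) \<subseteq> fsupp (rescale s z \<delta> \<eta>) \<and>
          (\<forall>x\<in>fsupp (\<psi> k). fsupp (\<psi> k) \<subseteq> sball s x l) \<and>
          (\<forall>y. fsupp (\<psi> k) \<subseteq> sball s y l \<longrightarrow>
             (\<exists>\<phi>\<in>test_functions s r. \<psi> k = (\<lambda>x. a * rescale s y l \<phi> x))))"
proof -
  obtain B where B: "B \<ge> 1" "Cr_bounded r (ennreal B) (cell_bump r :: real^'d \<Rightarrow> real)"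
    using cell_bump_bounded by blast
  define C where "C = 11 ^ CARD('d) * (2 ^ r * B)"
  have split: "\<exists>(I :: ('d \<Rightarrow> int) set) (a :: real) \<psi>. finite I \<and> 0 < a \<and> a * card I \<le> C \<and>
        rescale s z \<delta> \<eta> = (\<lambda>x. \<Sum>k\<in>I. \<psi> k x) \<and>
        (\<forall>k\<in>I. \<psi> k \<in> Cc r \<and> fsupp (\<psi> k) \<subseteq> fsupp (rescale s z \<delta> \<eta>) \<and>
          (\<forall>x\<in>fsupp (\<psi> k). fsupp (\<psi> k) \<subseteq> sball s x l) \<and>
          (\<forall>y. fsupp (\<psi> k) \<subseteq> sball s y l \<longrightarrow>
             (\<exists>\<phi>\<in>test_functions s r. \<psi> k = (\<lambda>x. a * rescale s y l \<phi> x))))"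
    if \<eta>: "\<eta> \<in> test_functions s r" and l: "0 < l" "l \<le> \<delta>" for \<eta> \<delta> l z
  proof -
    have \<delta>: "0 < \<delta>" using l by simp
    let ?S = "\<Sum>i\<in>UNIV. s i"
    \<comment> \<open>The lattice has spacing a third of \<open>l ^ s i\<close>, and the support reaches to \<open>\<delta> ^ s i\<close>.\<close>
    define N where "N i = \<lceil>3 * (\<delta> / l) ^ s i\<rceil>" for i
    define I where "I = PiE UNIV (\<lambda>i. {- N i..N i})"
    define a where "a = 2 ^ r * B * (l / \<delta>) ^ ?S"
    define \<rho> where "\<rho> k x = cell_bump r (\<chi> i. - (z $ i / l ^ s i) - of_int (k i) / 3 + (1 / l ^ s i) * x $ i)"
      for k :: "'d \<Rightarrow> int" and x :: "real^'d"
    define \<psi> where "\<psi> k x = rescale s z \<delta> \<eta> x * \<rho> k x" for k x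
    have fin: "finite I" unfolding I_def by (intro finite_PiE) auto
    have a: "0 < a" using B l \<delta> by (simp add: a_def)
    have card: "real (card I) \<le> 11 ^ CARD('d) * (\<delta> / l) ^ ?S"
    proof -
      have "real (card {- N i..N i}) \<le> 11 * (\<delta> / l) ^ s i" for i
      proof -
        have "1 \<le> (\<delta> / l) ^ s i" using l by (intro one_le_power) auto
        moreover have "real_of_int (N i) \<le> 3 * (\<delta> / l) ^ s i + 1" "0 \<le> N i"
          using calculation unfolding N_def by linarith+
        ultimately show ?thesis by simp
      qed
      then have "(\<Prod>i\<in>UNIV. real (card {- N i..N i})) \<le> (\<Prod>i\<in>UNIV. 11 * (\<delta> / l) ^ s i)"
        by (intro prod_mono) auto
      then show ?thesis
        by (simp add: I_def card_PiE prod.distrib power_sum)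
    qed
    have "a * card I \<le> a * (11 ^ CARD('d) * (\<delta> / l) ^ ?S)"
      using a card by (intro mult_left_mono) auto
    also have "\<dots> = C"
      using l \<delta> by (simp add: a_def C_def power_divide)
    finally have aC: "a * card I \<le> C" .
    have decomp: "rescale s z \<delta> \<eta> x = (\<Sum>k\<in>I. \<psi> k x)" for x
    proof (cases "rescale s z \<delta> \<eta> x = 0")
      case False
      then have "x \<in> sball s z \<delta>"
        using in_fsupp[of "rescale s z \<delta> \<eta>" x] fsupp_rescale_subset[of s \<delta> \<eta> z] s \<delta> \<eta>
        by (auto simp: test_functions_iff)
      then have x: "\<bar>x $ i - z $ i\<bar> \<le> \<delta> ^ s i" for i
        using s \<delta> by (auto simp: sball_def sdist_less_iff less_imp_le)
      have "\<bar>3 * ((x $ i - z $ i) / l ^ s i)\<bar> \<le> of_int (N i)" for i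
      proof -
        have "\<bar>3 * ((x $ i - z $ i) / l ^ s i)\<bar> = 3 * (\<bar>x $ i - z $ i\<bar> / l ^ s i)"
          by (simp only: abs_mult abs_divide abs_numeral abs_of_pos[OF zero_less_power[OF l(1)]])
        also have "\<dots> \<le> 3 * (\<delta> / l) ^ s i"
          using x l by (simp add: power_divide divide_right_mono)
        also have "\<dots> \<le> of_int (N i)" by (simp add: N_def)
        finally show ?thesis .
      qed
      then have "(\<Sum>k\<in>I. \<rho> k x) = 1"
        using cell_bump_sum[of "\<chi> i. (x $ i - z $ i) / l ^ s i" N r]
        by (simp add: \<rho>_def I_def diff_divide_distrib algebra_simps)
      then show ?thesis by (simp add: \<psi>_def sum_distrib_left[symmetric])
    qed (simp add: \<psi>_def)
    have supp: "fsupp (\<psi> k) \<subseteq> fsupp (rescale s z \<delta> \<eta>)" for k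
      by (rule fsupp_subset[OF in_fsupp closed_fsupp]) (simp add: \<psi>_def)
    have diff: "C_diff r (\<psi> k)" for k
    proof -
      have "C_diff r (rescale s z \<delta> \<eta>)"
        using rescale_in_Cc[OF s \<delta> \<eta>] by (simp add: Cc_def)
      moreover have "C_diff r (\<rho> k)"
        unfolding \<rho>_def by (rule C_diff_affine[OF C_diff_cell_bump])
      ultimately show ?thesis unfolding \<psi>_def by (rule C_diff_mult)
    qed
    have Cc: "\<psi> k \<in> Cc r" for k
      using diff rescale_in_Cc[OF s \<delta> \<eta>, of z] supp[of k]
      by (auto simp: Cc_def intro: compact_fsupp compact_imp_bounded)
    have cell: "fsupp (\<psi> k) \<subseteq> sball s x l" if "x \<in> fsupp (\<psi> k)" for k x
    proof -
      let ?h = "\<lambda>x::real^'d. (\<chi> i. - (z $ i / l ^ s i) - of_int (k i) / 3 + (1 / l ^ s i) * x $ i) :: real^'d"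
      have "fsupp (\<psi> k) \<subseteq> ?h -` fsupp (cell_bump r)"
        by (rule fsupp_comp_subset[OF continuous_on_affine_vec]) (simp add: \<psi>_def \<rho>_def)
      moreover have "fsupp (cell_bump r) \<subseteq> {u. \<forall>i. \<bar>3 * u $ i\<bar> \<le> 1}" (is "_ \<subseteq> ?T")
      proof (rule fsupp_subset)
        show "closed ?T"
          by (intro closed_Collect_all closed_Collect_le continuous_intros)
      qed (auto dest: cell_bump_support)
      ultimately have *: "\<bar>3 * (?h w $ i)\<bar> \<le> 1" if "w \<in> fsupp (\<psi> k)" for w i
        using that by blast
      have "\<bar>w $ i - x $ i\<bar> < l ^ s i" if "w \<in> fsupp (\<psi> k)" for w i
      proof -
        have "\<bar>3 * (?h w $ i) - 3 * (?h x $ i)\<bar> \<le> 2"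
          using *[OF that, of i] *[OF \<open>x \<in> fsupp (\<psi> k)\<close>, of i] by linarith
        moreover have "3 * (?h w $ i) - 3 * (?h x $ i) = 3 * ((w $ i - x $ i) / l ^ s i)"
          by (simp add: algebra_simps diff_divide_distrib)
        ultimately have "\<bar>(w $ i - x $ i) / l ^ s i\<bar> < 1" by linarith
        then show ?thesis using l by (simp add: abs_divide divide_less_eq)
      qed
      then show ?thesis using s l by (auto simp: sball_def sdist_less_iff)
    qed
    have test: "\<exists>\<phi>\<in>test_functions s r. \<psi> k = (\<lambda>x. a * rescale s y l \<phi> x)"
      if y: "fsupp (\<psi> k) \<subseteq> sball s y l" for k y
    proof (rule test_function_of_localised[OF s l(1) a y])
      \<comment> \<open>Recentred at \<open>y\<close> and magnified to unit size, the cell is a product of the magnified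
        test function, of slope \<open>(l / \<delta>) ^ s i \<le> 1\<close>, and a translate of the fixed bump.\<close>
      let ?f = "\<lambda>u. \<eta> (\<chi> i. (y $ i - z $ i) / \<delta> ^ s i + (l / \<delta>) ^ s i * u $ i)"
      let ?g = "\<lambda>u. cell_bump r (\<chi> i. (y $ i - z $ i) / l ^ s i - of_int (k i) / 3 + 1 * u $ i)"
      have "\<bar>(l / \<delta>) ^ s i\<bar> \<le> 1" for i
        using l by (simp add: power_le_one)
      then have f: "Cr_bounded r 1 ?f"
        using \<eta> by (intro Cr_bounded_affine) (auto simp: test_functions_iff)
      have g: "Cr_bounded r (ennreal B) ?g"
        using B(2) by (rule Cr_bounded_affine) simp
      have "Cr_bounded r (ennreal \<bar>1 / (2 ^ r * B)\<bar> * (2 ^ r * (1 * ennreal B)))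
          (\<lambda>u. 1 / (2 ^ r * B) * (?f u * ?g u))"
        by (rule Cr_bounded_scale[OF Cr_bounded_mult[OF f g]])
      moreover have "ennreal \<bar>1 / (2 ^ r * B)\<bar> * (2 ^ r * (1 * ennreal B)) = 1"
      proof -
        have "(2::ennreal) ^ r = ennreal (2 ^ r)"
          by (simp add: ennreal_power[symmetric])
        then show ?thesis
          using B(1) by (simp add: ennreal_mult[symmetric])
      qed
      moreover have "l ^ ?S / a * \<psi> k (\<chi> i. y $ i + l ^ s i * u $ i) = 1 / (2 ^ r * B) * (?f u * ?g u)" for u
      proof -
        have 1: "(\<chi> i. ((\<chi> i. y $ i + l ^ s i * u $ i) $ i - z $ i) / \<delta> ^ s i) =
            ((\<chi> i. (y $ i - z $ i) / \<delta> ^ s i + (l / \<delta>) ^ s i * u $ i) :: real^'d)"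
          by (simp add: vec_eq_iff power_divide diff_divide_distrib add_divide_distrib)
        have 2: "(\<chi> i. - (z $ i / l ^ s i) - of_int (k i) / 3 + (1 / l ^ s i) * (\<chi> i. y $ i + l ^ s i * u $ i) $ i) =
            ((\<chi> i. (y $ i - z $ i) / l ^ s i - of_int (k i) / 3 + 1 * u $ i) :: real^'d)"
          using l by (simp add: vec_eq_iff diff_divide_distrib add_divide_distrib)
        show ?thesis
          unfolding \<psi>_def \<rho>_def rescale_def 1 2 a_def
          using l \<delta> B(1) by (simp add: power_divide)
      qed
      ultimately show "Cr_bounded r 1 (\<lambda>u. l ^ ?S / a * \<psi> k (\<chi> i. y $ i + l ^ s i * u $ i))"
        by simp
    qed
    show ?thesis
      using fin a aC decomp supp Cc cell test
      by (intro exI[of _ I] exI[of _ a] exI[of _ \<psi>]) auto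
  qed
  have "C > 0" using B by (simp add: C_def)
  then show ?thesis by (rule that) (rule split)
qed

section \<open>Induction over scales\<close>

definition Cc_linear :: "nat \<Rightarrow> 'd::finite functional \<Rightarrow> bool" where
  "Cc_linear r u \<longleftrightarrow> (\<forall>\<phi>\<in>Cc r. \<forall>\<psi>\<in>Cc r. u (\<lambda>x. \<phi> x + \<psi> x) = u \<phi> + u \<psi>) \<and>
     (\<forall>a. \<forall>\<phi>\<in>Cc r. u (\<lambda>x. a * \<phi> x) = a * u \<phi>)"

lemma Cc_zero: "(\<lambda>x. 0) \<in> Cc r"
  by (simp add: Cc_def C_diff_const fsupp_def)

lemma Cc_linear_scale: "Cc_linear r u \<Longrightarrow> \<phi> \<in> Cc r \<Longrightarrow> u (\<lambda>x. a * \<phi> x) = a * u \<phi>"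
  by (simp add: Cc_linear_def)

lemma Cc_linear_zero: "Cc_linear r u \<Longrightarrow> u (\<lambda>x. 0) = 0"
  using Cc_linear_scale[OF _ Cc_zero, of r u 0] by simp

lemma Cc_add:
  assumes "\<phi> \<in> Cc r" "\<psi> \<in> Cc r"
  shows "(\<lambda>x. \<phi> x + \<psi> x) \<in> Cc r"
proof -
  have "fsupp (\<lambda>x. \<phi> x + \<psi> x) \<subseteq> fsupp \<phi> \<union> fsupp \<psi>"
  proof (rule fsupp_subset)
    fix x assume "\<phi> x + \<psi> x \<noteq> 0"
    then have "\<phi> x \<noteq> 0 \<or> \<psi> x \<noteq> 0" by auto
    then show "x \<in> fsupp \<phi> \<union> fsupp \<psi>" by (auto dest: in_fsupp)
  qed (simp add: closed_fsupp closed_Un)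
  then show ?thesis
    using assms by (auto simp: Cc_def intro: C_diff_add intro!: compact_fsupp[of "fsupp \<phi> \<union> fsupp \<psi>"]
      compact_imp_bounded)
qed

lemma Cc_sum:
  "(\<And>k. k \<in> I \<Longrightarrow> \<psi> k \<in> Cc r) \<Longrightarrow> (\<lambda>x. \<Sum>k\<in>I. \<psi> k x) \<in> Cc r"
  by (induction I rule: infinite_finite_induct) (auto intro: Cc_zero Cc_add)

lemma Cc_linear_sum:
  assumes "Cc_linear r u"
  shows "(\<And>k. k \<in> I \<Longrightarrow> \<psi> k \<in> Cc r) \<Longrightarrow> u (\<lambda>x. \<Sum>k\<in>I. \<psi> k x) = (\<Sum>k\<in>I. u (\<psi> k))"
proof (induction I rule: infinite_finite_induct)
  case (insert k I)
  then have "u (\<lambda>x. \<psi> k x + (\<Sum>k\<in>I. \<psi> k x)) = u (\<psi> k) + u (\<lambda>x. \<Sum>k\<in>I. \<psi> k x)"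
    using assms Cc_sum[of I \<psi> r] by (auto simp: Cc_linear_def)
  then show ?case using insert by simp
qed (auto simp: Cc_linear_zero[OF assms])

text \<open>One step from scale \<open>l\<close> up to scale \<open>\<delta>\<close>, for a family \<open>U\<close> of functionals indexed by base points.
  Each cell of the test function is evaluated with the functional of its own base point \<open>y\<close>
  (bound \<open>A\<close>), and the change of base point from \<open>z\<close> to \<open>y\<close> costs \<open>B\<close>. Increments are controlled
  only between points at distance at least \<open>\<epsilon>\<close>, and only between points of \<open>S\<close>. If the cell
  has a point at distance at least \<open>\<epsilon>\<close> from \<open>z\<close>, that point is the base point. Otherwise the
  cell lies in the \<open>\<epsilon>\<close>-ball around \<open>z\<close>, and \<open>z\<close> itself is a base point at scale \<open>l \<ge> \<epsilon>\<close>.\<close>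

lemma scale_step:
  fixes s :: "'d::finite \<Rightarrow> nat"
  assumes s: "\<And>i. s i \<ge> 1"
  obtains C :: real where "C > 0"
    and "\<And>\<epsilon> l \<delta> S U A B z \<eta>. 0 < \<epsilon> \<Longrightarrow> \<epsilon> \<le> l \<Longrightarrow> l \<le> \<delta> \<Longrightarrow> 0 \<le> A \<Longrightarrow> 0 \<le> B \<Longrightarrow>
      (\<forall>x\<in>S. Cc_linear r (U x)) \<Longrightarrow>
      (\<forall>x\<in>S. \<forall>\<phi>\<in>test_functions s r. tsupp s \<phi> x l \<subseteq> S \<longrightarrow>
         \<bar>U x (rescale s x l \<phi>)\<bar> \<le> A) \<Longrightarrow>
      (\<forall>x\<in>S. \<forall>y\<in>S. \<forall>\<phi>\<in>test_functions s r. \<epsilon> \<le> sdist s x y \<longrightarrow> sdist s x y \<le> \<delta> \<longrightarrow>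
         \<bar>U y (rescale s y l \<phi>) - U x (rescale s y l \<phi>)\<bar> \<le> B) \<Longrightarrow>
      \<eta> \<in> test_functions s r \<Longrightarrow> tsupp s \<eta> z \<delta> \<subseteq> S \<Longrightarrow>
      \<bar>U z (rescale s z \<delta> \<eta>)\<bar> \<le> C * (A + B)"
proof -
  obtain C :: real where C: "C > 0"
    and split: "\<And>\<eta> \<delta> l z. \<eta> \<in> test_functions s r \<Longrightarrow> 0 < l \<Longrightarrow> l \<le> \<delta> \<Longrightarrow>
      \<exists>(I :: ('d \<Rightarrow> int) set) (a :: real) \<psi>. finite I \<and> 0 < a \<and> a * card I \<le> C \<and>
        rescale s z \<delta> \<eta> = (\<lambda>x. \<Sum>k\<in>I. \<psi> k x) \<and>
        (\<forall>k\<in>I. \<psi> k \<in> Cc r \<and> fsupp (\<psi> k) \<subseteq> fsupp (rescale s z \<delta> \<eta>) \<and>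
          (\<forall>x\<in>fsupp (\<psi> k). fsupp (\<psi> k) \<subseteq> sball s x l) \<and>
          (\<forall>y. fsupp (\<psi> k) \<subseteq> sball s y l \<longrightarrow>
             (\<exists>\<phi>\<in>test_functions s r. \<psi> k = (\<lambda>x. a * rescale s y l \<phi> x))))"
    by (rule test_function_splitting[OF s, where r = r]) (rule that)
  have step: "\<bar>U z (rescale s z \<delta> \<eta>)\<bar> \<le> C * (A + B)"
    if \<epsilon>: "0 < \<epsilon>" "\<epsilon> \<le> l" "l \<le> \<delta>" and AB: "0 \<le> A" "0 \<le> B"
      and lin: "\<forall>x\<in>S. Cc_linear r (U x)"
      and small: "\<forall>x\<in>S. \<forall>\<phi>\<in>test_functions s r. tsupp s \<phi> x l \<subseteq> S \<longrightarrow>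
         \<bar>U x (rescale s x l \<phi>)\<bar> \<le> A"
      and incr: "\<forall>x\<in>S. \<forall>y\<in>S. \<forall>\<phi>\<in>test_functions s r. \<epsilon> \<le> sdist s x y \<longrightarrow> sdist s x y \<le> \<delta> \<longrightarrow>
         \<bar>U y (rescale s y l \<phi>) - U x (rescale s y l \<phi>)\<bar> \<le> B"
      and \<eta>: "\<eta> \<in> test_functions s r" and S: "tsupp s \<eta> z \<delta> \<subseteq> S"
    for \<epsilon> l \<delta> S U A B z \<eta>
  proof -
    have l: "0 < l" and \<delta>: "0 < \<delta>" using \<epsilon> by auto
    have z: "z \<in> S" using S by (auto simp: tsupp_def)
    obtain I :: "('d \<Rightarrow> int) set" and a :: real and \<psi> where I: "finite I" "0 < a" "a * card I \<le> C"
      and dec: "rescale s z \<delta> \<eta> = (\<lambda>x. \<Sum>k\<in>I. \<psi> k x)"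
      and \<psi>: "\<And>k. k \<in> I \<Longrightarrow> \<psi> k \<in> Cc r \<and> fsupp (\<psi> k) \<subseteq> fsupp (rescale s z \<delta> \<eta>) \<and>
          (\<forall>x\<in>fsupp (\<psi> k). fsupp (\<psi> k) \<subseteq> sball s x l) \<and>
          (\<forall>y. fsupp (\<psi> k) \<subseteq> sball s y l \<longrightarrow>
             (\<exists>\<phi>\<in>test_functions s r. \<psi> k = (\<lambda>x. a * rescale s y l \<phi> x)))"
      using split[OF \<eta> l \<epsilon>(3), of z] by (elim exE conjE) (rule that, assumption+, erule (1) bspec)
    have suppS: "fsupp (rescale s z \<delta> \<eta>) \<subseteq> S" using S by (auto simp: tsupp_def)
    have cell: "\<bar>U y (\<psi> k)\<bar> \<le> a * A \<and> (\<exists>\<phi>\<in>test_functions s r. \<psi> k = (\<lambda>x. a * rescale s y l \<phi> x))"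
      if k: "k \<in> I" and y: "y \<in> S" "fsupp (\<psi> k) \<subseteq> sball s y l" for k y
    proof -
      obtain \<phi> where \<phi>: "\<phi> \<in> test_functions s r" "\<psi> k = (\<lambda>x. a * rescale s y l \<phi> x)"
        using \<psi>[OF k] y(2) by blast
      have "fsupp (rescale s y l \<phi>) = fsupp (\<psi> k)"
        using I(2) by (simp add: \<phi>(2) fsupp_def)
      then have "tsupp s \<phi> y l \<subseteq> S"
        using \<psi>[OF k] suppS y(1) by (auto simp: tsupp_def)
      then have "\<bar>U y (rescale s y l \<phi>)\<bar> \<le> A" using small y(1) \<phi>(1) by blast
      moreover have "U y (\<psi> k) = a * U y (rescale s y l \<phi>)"
        unfolding \<phi>(2) by (rule Cc_linear_scale[OF lin[rule_format, OF y(1)] rescale_in_Cc[OF s l \<phi>(1)]])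
      ultimately show ?thesis using I(2) \<phi> by (auto simp: abs_mult)
    qed
    have "\<bar>U z (\<psi> k)\<bar> \<le> a * (A + B)" if k: "k \<in> I" for k
    proof (cases "\<exists>y\<in>fsupp (\<psi> k). \<epsilon> \<le> sdist s z y")
      case True
      then obtain y where y: "y \<in> fsupp (\<psi> k)" "\<epsilon> \<le> sdist s z y" by blast
      have yz: "y \<in> fsupp (rescale s z \<delta> \<eta>)" using \<psi>[OF k] y by blast
      have yS: "y \<in> S" using yz suppS by blast
      have "y \<in> sball s z \<delta>"
        using yz fsupp_rescale_subset[of s \<delta> \<eta> z] s \<delta> \<eta> by (auto simp: test_functions_def)
      then have d: "sdist s z y \<le> \<delta>"
        by (simp add: sball_def sdist_commute)
      obtain \<phi> where \<phi>: "\<phi> \<in> test_functions s r" "\<psi> k = (\<lambda>x. a * rescale s y l \<phi> x)"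
        and b: "\<bar>U y (\<psi> k)\<bar> \<le> a * A"
        using cell[OF k yS] \<psi>[OF k] y(1) by blast
      have "U y (\<psi> k) = a * U y (rescale s y l \<phi>)" "U z (\<psi> k) = a * U z (rescale s y l \<phi>)"
        unfolding \<phi>(2)
        by (rule Cc_linear_scale[OF lin[rule_format, OF yS] rescale_in_Cc[OF s l \<phi>(1)]]
              Cc_linear_scale[OF lin[rule_format, OF z] rescale_in_Cc[OF s l \<phi>(1)]])+
      then have "\<bar>U y (\<psi> k) - U z (\<psi> k)\<bar> = a * \<bar>U y (rescale s y l \<phi>) - U z (rescale s y l \<phi>)\<bar>"
        using I(2) by (simp add: right_diff_distrib[symmetric] abs_mult)
      also have "\<dots> \<le> a * B"
        using incr[rule_format, OF z yS \<phi>(1) y(2) d] I(2) by (intro mult_left_mono) auto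
      finally show ?thesis using b by (simp add: distrib_left)
    next
      case False
      then have "fsupp (\<psi> k) \<subseteq> sball s z l"
        using \<epsilon> by (force simp: sball_def sdist_commute)
      then have "\<bar>U z (\<psi> k)\<bar> \<le> a * A" using cell[OF k z] by blast
      also have "\<dots> \<le> a * (A + B)" using I(2) AB by (intro mult_left_mono) auto
      finally show ?thesis .
    qed
    then have "\<bar>\<Sum>k\<in>I. U z (\<psi> k)\<bar> \<le> (\<Sum>k\<in>I. a * (A + B))"
      by (intro order_trans[OF sum_abs] sum_mono)
    also have "\<dots> = a * card I * (A + B)" by simp
    also have "\<dots> \<le> C * (A + B)" using I(3) AB by (intro mult_right_mono) auto
    finally show ?thesis
      unfolding dec using Cc_linear_sum[OF lin[rule_format, OF z], of I \<psi>] \<psi> by simp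
  qed
  show ?thesis by (rule that[OF C]) (rule step)
qed

text \<open>On distances and scales comparable to \<open>\<delta>\<close> the weight of each homogeneity is of order
  \<open>\<delta> powr \<gamma>\<close>; a negative homogeneity loses a power of the ratio of the scales.\<close>

lemma weight_le:
  fixes M :: real
  assumes "0 < l" "l \<le> \<delta>" "\<delta> \<le> M * l" "0 \<le> t" "t \<le> \<delta>" "\<beta> < \<gamma>" "1 \<le> M"
  shows "t powr (\<gamma> - \<beta>) * l powr \<beta> \<le> \<delta> powr \<gamma> * max 1 (M powr - \<beta>)"
proof -
  have \<delta>: "0 < \<delta>" using assms by simp
  have "t powr (\<gamma> - \<beta>) * l powr \<beta> \<le> \<delta> powr (\<gamma> - \<beta>) * l powr \<beta>"
    using assms by (intro mult_right_mono powr_mono2) auto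
  also have "\<dots> = \<delta> powr \<gamma> * (l / \<delta>) powr \<beta>"
    using assms \<delta> by (simp add: powr_divide powr_diff)
  also have "(l / \<delta>) powr \<beta> \<le> max 1 (M powr - \<beta>)"
  proof (cases "0 \<le> \<beta>")
    case True
    then have "(l / \<delta>) powr \<beta> \<le> 1" using assms \<delta> by (intro powr_le1) auto
    then show ?thesis by simp
  next
    case False
    have "inverse M \<le> l / \<delta>" using assms \<delta> by (simp add: field_simps)
    then have "(l / \<delta>) powr \<beta> \<le> inverse M powr \<beta>"
      using assms False by (intro powr_mono2') auto
    also have "\<dots> = M powr - \<beta>" using assms by (simp add: powr_minus inverse_powr powr_minus)
    finally show ?thesis by simp
  qed
  finally show ?thesis by (simp add: mult_left_mono)
qed

text \<open>The ratio \<open>M\<close> of consecutive scales is chosen so that the constant \<open>C0\<close> of one step is beaten by the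
  gain \<open>M powr (- \<gamma>)\<close>: then \<open>C0 * M powr (- \<gamma>) \<le> 1 / 2\<close>, and one and the same constant \<open>C\<close>
  propagates from scale \<open>\<delta> / M\<close> to scale \<open>\<delta>\<close>, the other half of \<open>C\<close> absorbing the increments. Scales
  below \<open>M * \<epsilon>\<close> are reached in one step from \<open>\<epsilon>\<close>.\<close>

lemma multiscale_bound_real:
  fixes s :: "'d::finite \<Rightarrow> nat" and \<gamma> A B :: real
  assumes s: "\<And>i. s i \<ge> 1" and \<gamma>: "0 < \<gamma>" and H: "\<And>\<beta>. \<beta> \<in> H \<Longrightarrow> \<beta> < \<gamma>"
    and AB: "0 \<le> A" "0 \<le> B"
  obtains C :: real where "C > 0"
    and "\<And>\<epsilon> \<delta> S U Q z \<eta>. 0 < \<epsilon> \<Longrightarrow> 0 \<le> Q \<Longrightarrow>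
      (\<forall>x\<in>S. Cc_linear r (U x)) \<Longrightarrow>
      (\<forall>x\<in>S. \<forall>\<phi>\<in>test_functions s r. tsupp s \<phi> x \<epsilon> \<subseteq> S \<longrightarrow>
         \<bar>U x (rescale s x \<epsilon> \<phi>)\<bar> \<le> A * \<epsilon> powr \<gamma> * Q) \<Longrightarrow>
      (\<forall>x\<in>S. \<forall>y\<in>S. \<forall>l\<in>{\<epsilon>..1}. \<forall>\<phi>\<in>test_functions s r.
         \<epsilon> \<le> sdist s x y \<longrightarrow> sdist s x y \<le> 1 \<longrightarrow>
         \<bar>U y (rescale s y l \<phi>) - U x (rescale s y l \<phi>)\<bar>
           \<le> B * (\<Sum>\<beta>\<in>H. sdist s x y powr (\<gamma> - \<beta>) * l powr \<beta>) * Q) \<Longrightarrow>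
      \<eta> \<in> test_functions s r \<Longrightarrow> tsupp s \<eta> z \<delta> \<subseteq> S \<Longrightarrow> \<epsilon> \<le> \<delta> \<Longrightarrow> \<delta> \<le> 1 \<Longrightarrow>
      \<bar>U z (rescale s z \<delta> \<eta>)\<bar> \<le> C * \<delta> powr \<gamma> * Q"
proof -
  obtain C0 :: real where C0: "C0 > 0"
    and step: "\<And>\<epsilon> l \<delta> S U A B z \<eta>. 0 < \<epsilon> \<Longrightarrow> \<epsilon> \<le> l \<Longrightarrow> l \<le> \<delta> \<Longrightarrow> 0 \<le> A \<Longrightarrow> 0 \<le> B \<Longrightarrow>
      (\<forall>x\<in>S. Cc_linear r (U x)) \<Longrightarrow>
      (\<forall>x\<in>S. \<forall>\<phi>\<in>test_functions s r. tsupp s \<phi> x l \<subseteq> S \<longrightarrow>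
         \<bar>U x (rescale s x l \<phi>)\<bar> \<le> A) \<Longrightarrow>
      (\<forall>x\<in>S. \<forall>y\<in>S. \<forall>\<phi>\<in>test_functions s r. \<epsilon> \<le> sdist s x y \<longrightarrow> sdist s x y \<le> \<delta> \<longrightarrow>
         \<bar>U y (rescale s y l \<phi>) - U x (rescale s y l \<phi>)\<bar> \<le> B) \<Longrightarrow>
      \<eta> \<in> test_functions s r \<Longrightarrow> tsupp s \<eta> z \<delta> \<subseteq> S \<Longrightarrow>
      \<bar>U z (rescale s z \<delta> \<eta>)\<bar> \<le> C0 * (A + B)"
    by (rule scale_step[of s r]) (rule s, rule that)
  define M where "M = (2 * C0 + 1) powr (1 / \<gamma>)"
  have M\<gamma>: "M powr \<gamma> = 2 * C0 + 1" using C0 \<gamma> by (simp add: M_def powr_powr)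
  have M: "1 < M" using powr_less_mono2[of "1 / \<gamma>" 1 "2 * C0 + 1"] C0 \<gamma> by (simp add: M_def)
  define D where "D = (\<Sum>\<beta>\<in>H. max 1 (M powr - \<beta>))"
  have D: "0 \<le> D" unfolding D_def by (intro sum_nonneg) auto
  define C where "C = 2 * C0 * (A + B * D) + 1"
  have bound: "\<bar>U z (rescale s z \<delta> \<eta>)\<bar> \<le> C * \<delta> powr \<gamma> * Q"
    if \<epsilon>: "0 < \<epsilon>" and Q: "0 \<le> Q" and lin: "\<forall>x\<in>S. Cc_linear r (U x)"
      and small: "\<forall>x\<in>S. \<forall>\<phi>\<in>test_functions s r. tsupp s \<phi> x \<epsilon> \<subseteq> S \<longrightarrow>
         \<bar>U x (rescale s x \<epsilon> \<phi>)\<bar> \<le> A * \<epsilon> powr \<gamma> * Q"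
      and incr: "\<forall>x\<in>S. \<forall>y\<in>S. \<forall>l\<in>{\<epsilon>..1}. \<forall>\<phi>\<in>test_functions s r.
         \<epsilon> \<le> sdist s x y \<longrightarrow> sdist s x y \<le> 1 \<longrightarrow>
         \<bar>U y (rescale s y l \<phi>) - U x (rescale s y l \<phi>)\<bar>
           \<le> B * (\<Sum>\<beta>\<in>H. sdist s x y powr (\<gamma> - \<beta>) * l powr \<beta>) * Q"
      and "\<eta> \<in> test_functions s r" "tsupp s \<eta> z \<delta> \<subseteq> S" "\<epsilon> \<le> \<delta>" "\<delta> \<le> 1"
    for \<epsilon> \<delta> S U Q z \<eta>
  proof -
    have one_step: "\<bar>U z (rescale s z \<delta> \<eta>)\<bar> \<le> C0 * (E * (l / \<delta>) powr \<gamma> + B * D) * \<delta> powr \<gamma> * Q"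
      if l: "\<epsilon> \<le> l" "l \<le> \<delta>" "\<delta> \<le> M * l" and E: "0 \<le> E"
        and bd: "\<forall>x\<in>S. \<forall>\<phi>\<in>test_functions s r. tsupp s \<phi> x l \<subseteq> S \<longrightarrow>
           \<bar>U x (rescale s x l \<phi>)\<bar> \<le> E * l powr \<gamma> * Q"
        and \<eta>: "\<eta> \<in> test_functions s r" "tsupp s \<eta> z \<delta> \<subseteq> S" "\<delta> \<le> 1"
      for l \<delta> E \<eta> z
    proof -
      have "\<forall>x\<in>S. \<forall>y\<in>S. \<forall>\<phi>\<in>test_functions s r. \<epsilon> \<le> sdist s x y \<longrightarrow> sdist s x y \<le> \<delta> \<longrightarrow>
          \<bar>U y (rescale s y l \<phi>) - U x (rescale s y l \<phi>)\<bar> \<le> B * D * \<delta> powr \<gamma> * Q"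
      proof (intro ballI impI)
        fix x y \<phi> assume xy: "x \<in> S" "y \<in> S" "\<phi> \<in> test_functions s r"
          "\<epsilon> \<le> sdist s x y" "sdist s x y \<le> \<delta>"
        have "(\<Sum>\<beta>\<in>H. sdist s x y powr (\<gamma> - \<beta>) * l powr \<beta>)
            \<le> (\<Sum>\<beta>\<in>H. \<delta> powr \<gamma> * max 1 (M powr - \<beta>))"
          using xy l \<epsilon> M H by (intro sum_mono weight_le) auto
        also have "\<dots> = D * \<delta> powr \<gamma>" by (simp add: D_def sum_distrib_left mult.commute)
        finally have "B * (\<Sum>\<beta>\<in>H. sdist s x y powr (\<gamma> - \<beta>) * l powr \<beta>) * Q
            \<le> B * (D * \<delta> powr \<gamma>) * Q"
          using AB Q by (intro mult_right_mono mult_left_mono) auto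
        then show "\<bar>U y (rescale s y l \<phi>) - U x (rescale s y l \<phi>)\<bar> \<le> B * D * \<delta> powr \<gamma> * Q"
          using incr[rule_format, of x y l \<phi>] xy l \<eta>(3) by (simp add: mult.assoc)
      qed
      then have "\<bar>U z (rescale s z \<delta> \<eta>)\<bar> \<le> C0 * (E * l powr \<gamma> * Q + B * D * \<delta> powr \<gamma> * Q)"
        using E AB D Q by (intro step[OF \<epsilon> l(1,2) _ _ lin bd _ \<eta>(1,2)]) auto
      also have "\<dots> = C0 * (E * (l / \<delta>) powr \<gamma> + B * D) * \<delta> powr \<gamma> * Q"
        using l \<epsilon> by (simp add: powr_divide algebra_simps)
      finally show ?thesis .
    qed
    have first: "\<bar>U z (rescale s z \<delta> \<eta>)\<bar> \<le> C * \<delta> powr \<gamma> * Q"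
      if "\<epsilon> \<le> \<delta>" "\<delta> \<le> M * \<epsilon>" "\<eta> \<in> test_functions s r" "tsupp s \<eta> z \<delta> \<subseteq> S" "\<delta> \<le> 1" for \<delta> \<eta> z
    proof -
      have "(\<epsilon> / \<delta>) powr \<gamma> \<le> 1" using that \<epsilon> \<gamma> by (intro powr_le1) auto
      then have "C0 * (A * (\<epsilon> / \<delta>) powr \<gamma> + B * D) \<le> C0 * (A * 1 + B * D)"
        using C0 AB by (intro mult_left_mono add_right_mono) auto
      also have "\<dots> \<le> C"
        using C0 AB D unfolding C_def by (simp add: mult_nonneg_nonneg algebra_simps)
      finally have "C0 * (A * (\<epsilon> / \<delta>) powr \<gamma> + B * D) * \<delta> powr \<gamma> * Q \<le> C * \<delta> powr \<gamma> * Q"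
        using Q by (intro mult_right_mono) auto
      then show ?thesis
        using one_step[OF order_refl that(1,2) AB(1) small that(3,4,5)] by linarith
    qed
    have "\<epsilon> \<le> \<delta> \<Longrightarrow> \<delta> \<le> M ^ Suc n * \<epsilon> \<Longrightarrow> \<eta> \<in> test_functions s r \<Longrightarrow> tsupp s \<eta> z \<delta> \<subseteq> S \<Longrightarrow>
        \<delta> \<le> 1 \<Longrightarrow> \<bar>U z (rescale s z \<delta> \<eta>)\<bar> \<le> C * \<delta> powr \<gamma> * Q" for n \<delta> \<eta> z
    proof (induction n arbitrary: \<delta> \<eta> z)
      case 0
      then show ?case using first by simp
    next
      case (Suc n)
      show ?case
      proof (cases "\<delta> \<le> M * \<epsilon>")
        case True
        then show ?thesis using Suc.prems first by blast
      next
        case False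
        define l where "l = \<delta> / M"
        have \<delta>: "0 < \<delta>" using Suc.prems \<epsilon> by simp
        have l: "\<epsilon> \<le> l" "l \<le> \<delta>" "\<delta> \<le> M * l" "l \<le> M ^ Suc n * \<epsilon>"
          using False M \<delta> Suc.prems(2) by (auto simp: l_def field_simps)
        have C: "0 \<le> C" using C0 AB D by (simp add: C_def)
        have "\<bar>U z (rescale s z \<delta> \<eta>)\<bar> \<le> C0 * (C * (l / \<delta>) powr \<gamma> + B * D) * \<delta> powr \<gamma> * Q"
          using Suc.prems l by (intro one_step ballI impI Suc.IH C) auto
        also have "C0 * (C * (l / \<delta>) powr \<gamma> + B * D) \<le> C"
        proof -
          have "(l / \<delta>) powr \<gamma> = 1 / (2 * C0 + 1)"
            using \<delta> M by (simp add: l_def powr_divide M\<gamma>)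
          then have "C0 * (C * (l / \<delta>) powr \<gamma>) = C * (C0 / (2 * C0 + 1))" by simp
          also have "\<dots> \<le> C * (1 / 2)"
            using C C0 by (intro mult_left_mono) (auto simp: field_simps)
          finally have "C0 * (C * (l / \<delta>) powr \<gamma>) \<le> C / 2" by simp
          moreover have "C0 * (B * D) \<le> C / 2"
            using C0 AB by (simp add: C_def algebra_simps)
          ultimately show ?thesis by (simp add: distrib_left)
        qed
        finally show ?thesis using Q by (simp add: mult_right_mono)
      qed
    qed
    moreover obtain n where "1 / \<epsilon> < M ^ n" using real_arch_pow[OF M] by blast
    then have "\<delta> \<le> M ^ Suc n * \<epsilon>"
    proof -
      have "M ^ n \<le> M ^ Suc n" using M by (intro power_increasing) auto
      then have "1 / \<epsilon> < M ^ Suc n" using \<open>1 / \<epsilon> < M ^ n\<close> by linarith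
      then have "1 < M ^ Suc n * \<epsilon>" using \<epsilon> by (simp add: pos_divide_less_eq)
      then show ?thesis using \<open>\<delta> \<le> 1\<close> by linarith
    qed
    ultimately show ?thesis using that by blast
  qed
  have "C > 0" using C0 AB D by (simp add: C_def add_nonneg_pos)
  then show ?thesis by (rule that) (rule bound)
qed

text \<open>The bounds of the theorem have products of norms on the right-hand side, which may be infinite;
  \<open>Q\<close> stands for such a right-hand side.\<close>

definition multiscale_constant ::
  "('d::finite \<Rightarrow> nat) \<Rightarrow> nat \<Rightarrow> real \<Rightarrow> real set \<Rightarrow> real \<Rightarrow> real \<Rightarrow> real \<Rightarrow> bool" where
  "multiscale_constant s r \<gamma> H A B C \<longleftrightarrow> (\<forall>\<epsilon> \<delta> S U Q z \<eta>. 0 < \<epsilon> \<longrightarrow>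
     (\<forall>x\<in>S. Cc_linear r (U x)) \<longrightarrow>
     (\<forall>x\<in>S. \<forall>\<phi>\<in>test_functions s r. tsupp s \<phi> x \<epsilon> \<subseteq> S \<longrightarrow>
        ennreal \<bar>U x (rescale s x \<epsilon> \<phi>)\<bar> \<le> ennreal (A * \<epsilon> powr \<gamma>) * Q) \<longrightarrow>
     (\<forall>x\<in>S. \<forall>y\<in>S. \<forall>l\<in>{\<epsilon>..1}. \<forall>\<phi>\<in>test_functions s r.
        \<epsilon> \<le> sdist s x y \<longrightarrow> sdist s x y \<le> 1 \<longrightarrow>
        ennreal \<bar>U y (rescale s y l \<phi>) - U x (rescale s y l \<phi>)\<bar>
          \<le> ennreal (B * (\<Sum>\<beta>\<in>H. sdist s x y powr (\<gamma> - \<beta>) * l powr \<beta>)) * Q) \<longrightarrow>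
     \<eta> \<in> test_functions s r \<longrightarrow> tsupp s \<eta> z \<delta> \<subseteq> S \<longrightarrow> \<epsilon> \<le> \<delta> \<longrightarrow> \<delta> \<le> 1 \<longrightarrow>
     ennreal \<bar>U z (rescale s z \<delta> \<eta>)\<bar> \<le> ennreal (C * \<delta> powr \<gamma>) * Q)"

lemma multiscale_constantD:
  assumes C: "multiscale_constant s r \<gamma> H A B C"
    and e: "0 < \<epsilon>" and lin: "\<forall>x\<in>S. Cc_linear r (U x)"
    and small: "\<forall>x\<in>S. \<forall>\<phi>\<in>test_functions s r. tsupp s \<phi> x \<epsilon> \<subseteq> S \<longrightarrow>
      ennreal \<bar>U x (rescale s x \<epsilon> \<phi>)\<bar> \<le> ennreal (A * \<epsilon> powr \<gamma>) * Q"
    and incr: "\<forall>x\<in>S. \<forall>y\<in>S. \<forall>l\<in>{\<epsilon>..1}. \<forall>\<phi>\<in>test_functions s r.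
      \<epsilon> \<le> sdist s x y \<longrightarrow> sdist s x y \<le> 1 \<longrightarrow>
      ennreal \<bar>U y (rescale s y l \<phi>) - U x (rescale s y l \<phi>)\<bar>
        \<le> ennreal (B * (\<Sum>\<beta>\<in>H. sdist s x y powr (\<gamma> - \<beta>) * l powr \<beta>)) * Q"
    and \<eta>: "\<eta> \<in> test_functions s r" "tsupp s \<eta> z \<delta> \<subseteq> S" "\<epsilon> \<le> \<delta>" "\<delta> \<le> 1"
  shows "ennreal \<bar>U z (rescale s z \<delta> \<eta>)\<bar> \<le> ennreal (C * \<delta> powr \<gamma>) * Q"
  by (rule C[unfolded multiscale_constant_def, THEN spec, THEN spec, THEN spec, THEN spec,
      THEN spec, THEN spec, THEN spec, THEN mp, THEN mp, THEN mp, THEN mp, THEN mp, THEN mp,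
      THEN mp, THEN mp, OF e lin small incr \<eta>])

lemma multiscale_bound:
  fixes s :: "'d::finite \<Rightarrow> nat" and \<gamma> A B :: real
  assumes s: "\<And>i. s i \<ge> 1" and \<gamma>: "0 < \<gamma>" and H: "\<And>\<beta>. \<beta> \<in> H \<Longrightarrow> \<beta> < \<gamma>"
    and AB: "0 \<le> A" "0 \<le> B"
  shows "\<exists>C. multiscale_constant s r \<gamma> H A B C"
proof -
  obtain C :: real where C: "C > 0"
    and main: "\<And>\<epsilon> \<delta> S U Q z \<eta>. 0 < \<epsilon> \<Longrightarrow> 0 \<le> Q \<Longrightarrow>
      (\<forall>x\<in>S. Cc_linear r (U x)) \<Longrightarrow>
      (\<forall>x\<in>S. \<forall>\<phi>\<in>test_functions s r. tsupp s \<phi> x \<epsilon> \<subseteq> S \<longrightarrow>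
         \<bar>U x (rescale s x \<epsilon> \<phi>)\<bar> \<le> A * \<epsilon> powr \<gamma> * Q) \<Longrightarrow>
      (\<forall>x\<in>S. \<forall>y\<in>S. \<forall>l\<in>{\<epsilon>..1}. \<forall>\<phi>\<in>test_functions s r.
         \<epsilon> \<le> sdist s x y \<longrightarrow> sdist s x y \<le> 1 \<longrightarrow>
         \<bar>U y (rescale s y l \<phi>) - U x (rescale s y l \<phi>)\<bar>
           \<le> B * (\<Sum>\<beta>\<in>H. sdist s x y powr (\<gamma> - \<beta>) * l powr \<beta>) * Q) \<Longrightarrow>
      \<eta> \<in> test_functions s r \<Longrightarrow> tsupp s \<eta> z \<delta> \<subseteq> S \<Longrightarrow> \<epsilon> \<le> \<delta> \<Longrightarrow> \<delta> \<le> 1 \<Longrightarrow>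
      \<bar>U z (rescale s z \<delta> \<eta>)\<bar> \<le> C * \<delta> powr \<gamma> * Q"
    by (rule multiscale_bound_real[of s \<gamma> H A B r]) ((rule s \<gamma> H AB; assumption?)+, rule that)
  have bound: "ennreal \<bar>U z (rescale s z \<delta> \<eta>)\<bar> \<le> ennreal (C * \<delta> powr \<gamma>) * Q"
    if \<epsilon>: "0 < \<epsilon>" and lin: "\<forall>x\<in>S. Cc_linear r (U x)"
      and small: "\<forall>x\<in>S. \<forall>\<phi>\<in>test_functions s r. tsupp s \<phi> x \<epsilon> \<subseteq> S \<longrightarrow>
         ennreal \<bar>U x (rescale s x \<epsilon> \<phi>)\<bar> \<le> ennreal (A * \<epsilon> powr \<gamma>) * Q"
      and incr: "\<forall>x\<in>S. \<forall>y\<in>S. \<forall>l\<in>{\<epsilon>..1}. \<forall>\<phi>\<in>test_functions s r.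
         \<epsilon> \<le> sdist s x y \<longrightarrow> sdist s x y \<le> 1 \<longrightarrow>
         ennreal \<bar>U y (rescale s y l \<phi>) - U x (rescale s y l \<phi>)\<bar>
           \<le> ennreal (B * (\<Sum>\<beta>\<in>H. sdist s x y powr (\<gamma> - \<beta>) * l powr \<beta>)) * Q"
      and \<eta>: "\<eta> \<in> test_functions s r" "tsupp s \<eta> z \<delta> \<subseteq> S" "\<epsilon> \<le> \<delta>" "\<delta> \<le> 1"
    for \<epsilon> \<delta> S U Q z \<eta>
  proof (cases Q)
    case (real q)
    have nn: "0 \<le> B * (\<Sum>\<beta>\<in>H. sdist s x y powr (\<gamma> - \<beta>) * l powr \<beta>)" for x y l
      using AB by (intro mult_nonneg_nonneg sum_nonneg) auto
    have conv: "ennreal \<bar>u\<bar> \<le> ennreal c * Q \<longleftrightarrow> \<bar>u\<bar> \<le> c * q" if "0 \<le> c" for u c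
      using real that by (simp add: ennreal_mult[symmetric])
    have "\<bar>U z (rescale s z \<delta> \<eta>)\<bar> \<le> C * \<delta> powr \<gamma> * q"
    proof (rule main[OF \<epsilon> real(1) lin _ _ \<eta>])
      show "\<forall>x\<in>S. \<forall>\<phi>\<in>test_functions s r. tsupp s \<phi> x \<epsilon> \<subseteq> S \<longrightarrow>
          \<bar>U x (rescale s x \<epsilon> \<phi>)\<bar> \<le> A * \<epsilon> powr \<gamma> * q"
        using small AB conv by simp
      show "\<forall>x\<in>S. \<forall>y\<in>S. \<forall>l\<in>{\<epsilon>..1}. \<forall>\<phi>\<in>test_functions s r.
          \<epsilon> \<le> sdist s x y \<longrightarrow> sdist s x y \<le> 1 \<longrightarrow>
          \<bar>U y (rescale s y l \<phi>) - U x (rescale s y l \<phi>)\<bar>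
           \<le> B * (\<Sum>\<beta>\<in>H. sdist s x y powr (\<gamma> - \<beta>) * l powr \<beta>) * q"
        using incr conv[OF nn] by simp
    qed
    then show ?thesis using C conv by simp
  next
    case top
    then show ?thesis using C \<epsilon> \<eta> by (simp add: ennreal_mult_top)
  qed
  show ?thesis
    unfolding multiscale_constant_def by (intro exI[of _ C] allI impI) (rule bound)
qed

section \<open>Monotonicity of the norms\<close>

lemma fatten_mono: "K \<subseteq> L \<Longrightarrow> fatten s K \<subseteq> fatten s L"
  by (auto simp: fatten_def)

lemma subset_fatten: "K \<subseteq> fatten s K"
proof
  fix x assume "x \<in> K"
  then show "x \<in> fatten s K" unfolding fatten_def by (intro CollectI bexI[of _ x]) (simp add: sdist_self)
qed

lemma bounded_fatten:
  assumes "\<And>i. s i \<ge> 1" "bounded K"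
  shows "bounded (fatten s K)"
proof (rule bounded_subset[OF bounded_sums[OF assms(2) bounded_cbox]])
  show "fatten s K \<subseteq> (\<Union>x\<in>K. \<Union>u\<in>cbox (\<chi> i. -1) (\<chi> i. 1). {x + u})"
  proof
    fix y assume "y \<in> fatten s K"
    then obtain x where x: "x \<in> K" "sdist s y x \<le> 1" by (auto simp: fatten_def)
    have "-1 \<le> (y - x) $ i \<and> (y - x) $ i \<le> 1" for i
    proof -
      have "\<bar>y $ i - x $ i\<bar> \<le> 1"
        using sdist_le_iff[of s 1 y x] assms(1) x(2) by simp
      then show ?thesis unfolding vector_minus_component by linarith
    qed
    then have "y - x \<in> cbox (\<chi> i. -1) (\<chi> i. 1)" by (simp add: mem_box_cart)
    then show "y \<in> (\<Union>x\<in>K. \<Union>u\<in>cbox (\<chi> i. -1) (\<chi> i. 1). {x + u})"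
      using x(1) by (intro UN_I[of x] UN_I[of "y - x"]) auto
  qed
qed

lemma tsupp_subset_fatten:
  assumes "\<And>i. s i \<ge> 1" "0 < \<delta>" "\<delta> \<le> 1" "\<eta> \<in> test_functions s r" "z \<in> K"
  shows "tsupp s \<eta> z \<delta> \<subseteq> fatten s K"
proof
  fix y assume "y \<in> tsupp s \<eta> z \<delta>"
  then have "sdist s y z < \<delta>"
    using tsupp_subset_sball[of s \<delta> \<eta> r z] assms by (auto simp: sball_def)
  then show "y \<in> fatten s K"
    using assms(3,5) unfolding fatten_def by (intro CollectI bexI[of _ z]) auto
qed

lemma increment_sup_mono:
  "K \<subseteq> L \<Longrightarrow> I \<subseteq> J \<Longrightarrow> increment_sup s T \<gamma> K I F \<le> increment_sup s T \<gamma> L J F"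
  unfolding increment_sup_def by (rule SUP_subset_mono) auto

lemma Pi_norm_mono: "K \<subseteq> L \<Longrightarrow> Pi_norm s r T D \<epsilon> \<gamma> K P \<le> Pi_norm s r T D \<epsilon> \<gamma> L P"
  unfolding Pi_norm_def Pi_bound_def by (rule Inf_superset_mono) blast

lemma Pi_dist_mono: "K \<subseteq> L \<Longrightarrow> Pi_dist s r T D \<epsilon> \<gamma> K Pc P \<le> Pi_dist s r T D \<epsilon> \<gamma> L Pc P"
  unfolding Pi_dist_def Pi_diff_above_def by (intro add_mono SUP_subset_mono) auto

text \<open>The norm of a discrete model is an infimum of admissible constants, and this is how it becomes
  an admissible constant itself. As
  \<open>top * 0 = 0\<close>, the empty set has to be excluded when \<open>b = 0\<close>.\<close>

lemma le_Inf_mult_ennreal: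
  fixes X :: "ennreal set"
  assumes "X \<noteq> {}" "\<And>C. C \<in> X \<Longrightarrow> a \<le> C * ennreal b"
  shows "a \<le> Inf X * ennreal b"
proof (cases "0 < b")
  case True
  have "a / ennreal b \<le> C" if "C \<in> X" for C
    using assms(2)[OF that] True by (intro divide_le_posI_ennreal) (auto simp: mult.commute)
  then have "a / ennreal b \<le> Inf X" by (rule Inf_greatest)
  then have "a / ennreal b * ennreal b \<le> Inf X * ennreal b" by (rule mult_right_mono) simp
  then show ?thesis using True by (simp add: ennreal_divide_times ennreal_times_divide ennreal_mult_divide_eq)
next
  case False
  then show ?thesis using assms by (auto simp: ennreal_neg)
qed

section \<open>Elements of the regularity structure\<close>

locale discretised_structure =
  fixes s :: "'d::finite \<Rightarrow> nat" and r :: nat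
    and T :: "('d, 'v::real_vector) reg_struct"
    and D :: "('d, 'v, 'x::real_vector) discretisation"
    and \<gamma> :: real
  assumes s: "\<And>i. s i \<ge> 1"
    and reg: "regularity_structure s T"
    and disc: "discretisation s r T D"
    and mono: "monotone_seminorms T D"
    and \<gamma>: "\<gamma> > 0"
begin

definition levels :: "real set" where
  "levels = {\<beta>\<in>homs T. \<beta> < \<gamma>}"

lemma graded: "graded T" and banach: "banach_components T" and grp: "structure_group T"
  using reg by (auto simp: regularity_structure_def)

lemma finite_levels: "finite levels"
proof -
  obtain m where m: "\<And>a. a \<in> homs T \<Longrightarrow> m \<le> a"
    using graded by (auto simp: graded_def bdd_below_def)
  have "levels \<subseteq> homs T \<inter> {m..\<gamma>}" using m by (auto simp: levels_def)
  moreover have "finite (homs T \<inter> {m..\<gamma>})" using graded by (auto simp: graded_def)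
  ultimately show ?thesis by (rule finite_subset)
qed

lemma linear_proj: "linear (proj T \<alpha>)"
  using graded by (simp add: graded_def)

lemma decomposition:
  assumes "\<tau> \<in> below T \<gamma>"
  shows "\<tau> = (\<Sum>\<beta>\<in>levels. proj T \<beta> \<tau>)"
proof -
  have "\<tau> = (\<Sum>\<alpha> | proj T \<alpha> \<tau> \<noteq> 0. proj T \<alpha> \<tau>)"
    using graded unfolding graded_def by blast
  also have "\<dots> = (\<Sum>\<beta>\<in>levels. proj T \<beta> \<tau>)"
  proof (rule sum.mono_neutral_left[OF finite_levels])
    have "\<alpha> \<in> homs T" if "proj T \<alpha> \<tau> \<noteq> 0" for \<alpha>
      using graded that unfolding graded_def by blast
    moreover have "\<alpha> < \<gamma>" if "proj T \<alpha> \<tau> \<noteq> 0" for \<alpha>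
      using assms that unfolding below_def by (force simp: not_le[symmetric])
    ultimately show "{\<alpha>. proj T \<alpha> \<tau> \<noteq> 0} \<subseteq> levels" by (auto simp: levels_def)
  qed auto
  finally show ?thesis .
qed

lemma subspace_below: "subspace (below T \<alpha>)"
  using linear_proj unfolding subspace_def below_def
  by (auto simp: linear_0 linear_add linear_cmul)

lemma below_mono: "\<alpha> \<le> \<beta> \<Longrightarrow> below T \<alpha> \<subseteq> below T \<beta>"
  by (auto simp: below_def)

lemma hom_space_below:
  assumes "\<tau> \<in> hom_space T \<alpha>" "\<alpha> < \<beta>"
  shows "\<tau> \<in> below T \<beta>"
proof -
  obtain \<sigma> where \<sigma>: "\<tau> = proj T \<alpha> \<sigma>" using assms(1) by (auto simp: hom_space_def)
  have "\<forall>\<alpha> \<beta> \<tau>. proj T \<alpha> (proj T \<beta> \<tau>) = (if \<alpha> = \<beta> then proj T \<alpha> \<tau> else 0)"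
    using graded by (simp add: graded_def)
  then show ?thesis using assms(2) by (auto simp: below_def \<sigma>)
qed

lemma proj_in_hom_space: "proj T \<alpha> \<tau> \<in> hom_space T \<alpha>"
  by (simp add: hom_space_def)

lemma sgroup_below:
  assumes "g \<in> sgroup T" "\<tau> \<in> below T \<gamma>"
  shows "g \<tau> \<in> below T \<gamma>"
proof -
  have lin: "linear g" using assms(1) grp by (simp add: structure_group_def)
  have "g (proj T \<beta> \<tau>) \<in> below T \<gamma>" if "\<beta> \<in> levels" for \<beta>
  proof -
    have \<beta>: "\<beta> \<in> homs T" "\<beta> < \<gamma>" using that by (auto simp: levels_def)
    have "g (proj T \<beta> \<tau>) - proj T \<beta> \<tau> \<in> below T \<beta>"
      using assms(1) grp \<beta>(1) proj_in_hom_space unfolding structure_group_def by blast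
    then have "g (proj T \<beta> \<tau>) - proj T \<beta> \<tau> \<in> below T \<gamma>"
      using below_mono[of \<beta> \<gamma>] \<beta>(2) by auto
    from subspace_add[OF subspace_below this hom_space_below[OF proj_in_hom_space[of \<beta> \<tau>] \<beta>(2)]]
    show ?thesis by simp
  qed
  then have "(\<Sum>\<beta>\<in>levels. g (proj T \<beta> \<tau>)) \<in> below T \<gamma>"
    by (rule subspace_sum[OF subspace_below])
  then have "g (\<Sum>\<beta>\<in>levels. proj T \<beta> \<tau>) \<in> below T \<gamma>"
    by (simp add: linear_sum[OF lin])
  then show ?thesis using decomposition[OF assms(2)] by simp
qed

lemma increment_below:
  assumes "\<Gamma> \<in> transports T" "f \<in> functions_below T \<gamma>"
  shows "f y - \<Gamma> y x (f x) \<in> below T \<gamma>"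
proof -
  have "\<Gamma> y x \<in> sgroup T" "f x \<in> below T \<gamma>" "f y \<in> below T \<gamma>"
    using assms by (auto simp: transports_def functions_below_def)
  then show ?thesis by (simp add: subspace_diff[OF subspace_below] sgroup_below)
qed

text \<open>A functional that is bounded on each homogeneous component, at scale \<open>l\<close>, is applied to an increment
  of a modelled distribution: the component of homogeneity \<open>\<beta>\<close> has size \<open>sdist s x y powr (\<gamma> - \<beta>)\<close>
  and is seen with weight \<open>l powr \<beta>\<close>.\<close>

lemma functional_increment_bound:
  assumes lin: "linear w" and G: "G x y \<in> below T \<gamma>" and xy: "x \<in> S" "y \<in> S"
    and t: "sdist s x y \<in> I" "0 < sdist s x y" and \<kappa>: "0 \<le> \<kappa>"
    and w: "\<And>\<beta> \<sigma>. \<beta> \<in> levels \<Longrightarrow> \<sigma> \<in> hom_space T \<beta> \<Longrightarrow>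
      ennreal \<bar>w \<sigma>\<bar> \<le> ennreal \<kappa> * N * ennreal (rnorm T \<beta> \<sigma> * l powr \<beta>)"
  shows "ennreal \<bar>w (G x y)\<bar> \<le>
    ennreal (\<kappa> * (\<Sum>\<beta>\<in>levels. sdist s x y powr (\<gamma> - \<beta>) * l powr \<beta>)) * (N * increment_sup s T \<gamma> S I G)"
proof -
  let ?\<tau> = "G x y" and ?t = "sdist s x y" and ?M = "increment_sup s T \<gamma> S I G"
  have comp: "ennreal \<bar>w (proj T \<beta> ?\<tau>)\<bar> \<le> ennreal (\<kappa> * (?t powr (\<gamma> - \<beta>) * l powr \<beta>)) * (N * ?M)"
    if \<beta>: "\<beta> \<in> levels" for \<beta>
  proof -
    have "ennreal (cnorm T \<beta> ?\<tau> / ?t powr (\<gamma> - \<beta>)) \<le> ?M"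
      unfolding increment_sup_def using xy t(1) \<beta>
      by (intro SUP_upper2[of "(x, y)"]) (auto intro!: SUP_upper simp: levels_def)
    then have "ennreal (cnorm T \<beta> ?\<tau> / ?t powr (\<gamma> - \<beta>)) * ennreal (?t powr (\<gamma> - \<beta>) * l powr \<beta>)
        \<le> ?M * ennreal (?t powr (\<gamma> - \<beta>) * l powr \<beta>)"
      by (rule mult_right_mono) simp
    then have le: "ennreal (cnorm T \<beta> ?\<tau> * l powr \<beta>) \<le> ?M * ennreal (?t powr (\<gamma> - \<beta>) * l powr \<beta>)"
      using t(2) by (simp add: ennreal_mult''[symmetric])
    have "ennreal \<bar>w (proj T \<beta> ?\<tau>)\<bar> \<le> ennreal \<kappa> * N * ennreal (cnorm T \<beta> ?\<tau> * l powr \<beta>)"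
      using w[OF \<beta> proj_in_hom_space, of ?\<tau>] by (simp add: cnorm_def)
    also have "\<dots> \<le> ennreal \<kappa> * N * (?M * ennreal (?t powr (\<gamma> - \<beta>) * l powr \<beta>))"
      by (intro mult_left_mono le) simp
    also have "\<dots> = ennreal (\<kappa> * (?t powr (\<gamma> - \<beta>) * l powr \<beta>)) * (N * ?M)"
      using \<kappa> by (simp add: ennreal_mult'' mult_ac)
    finally show ?thesis .
  qed
  have "w ?\<tau> = (\<Sum>\<beta>\<in>levels. w (proj T \<beta> ?\<tau>))"
    using arg_cong[OF decomposition[OF G], of w] by (simp add: linear_sum[OF lin])
  then have "ennreal \<bar>w ?\<tau>\<bar> \<le> ennreal (\<Sum>\<beta>\<in>levels. \<bar>w (proj T \<beta> ?\<tau>)\<bar>)"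
    by (simp add: ennreal_leI)
  also have "\<dots> = (\<Sum>\<beta>\<in>levels. ennreal \<bar>w (proj T \<beta> ?\<tau>)\<bar>)"
    by (simp add: sum_ennreal)
  also have "\<dots> \<le> (\<Sum>\<beta>\<in>levels. ennreal (\<kappa> * (?t powr (\<gamma> - \<beta>) * l powr \<beta>)) * (N * ?M))"
    by (intro sum_mono comp)
  also have "\<dots> = (\<Sum>\<beta>\<in>levels. ennreal (\<kappa> * (?t powr (\<gamma> - \<beta>) * l powr \<beta>))) * (N * ?M)"
    by (simp add: sum_distrib_right)
  also have "(\<Sum>\<beta>\<in>levels. ennreal (\<kappa> * (?t powr (\<gamma> - \<beta>) * l powr \<beta>))) =
      ennreal (\<kappa> * (\<Sum>\<beta>\<in>levels. ?t powr (\<gamma> - \<beta>) * l powr \<beta>))"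
    using \<kappa> by (simp add: sum_ennreal sum_distrib_left)
  finally show ?thesis .
qed

section \<open>Models tested at scales down to the discretisation\<close>

lemma dspaces: "dspaces r D" and local_xnorms: "local_xnorms s r D"
  using disc by (auto simp: discretisation_def)

lemma control_exists:
  "\<exists>C\<ge>1. \<forall>\<epsilon>\<in>{0<..1}. \<forall>f\<in>dspace D \<epsilon>. \<forall>z \<alpha>. \<forall>\<phi>\<in>test_functions s r.
     ennreal \<bar>emb D \<epsilon> f (rescale s z \<epsilon> \<phi>)\<bar>
       \<le> ennreal (C * \<epsilon> powr \<alpha>) * xnorm D \<alpha> (tsupp s \<phi> z \<epsilon>) z \<epsilon> f"
proof -
  obtain C :: real where C: "\<And>\<epsilon> f z \<alpha> \<phi>. \<epsilon> \<in> {0<..1} \<Longrightarrow> f \<in> dspace D \<epsilon> \<Longrightarrow> \<phi> \<in> test_functions s r \<Longrightarrow>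
     ennreal \<bar>emb D \<epsilon> f (rescale s z \<epsilon> \<phi>)\<bar>
       \<le> ennreal (C * \<epsilon> powr \<alpha>) * xnorm D \<alpha> (tsupp s \<phi> z \<epsilon>) z \<epsilon> f"
    using disc unfolding discretisation_def xnorm_controls_def by blast
  have "ennreal (C * \<epsilon> powr \<alpha>) \<le> ennreal (max 1 C * \<epsilon> powr \<alpha>)" for \<epsilon> \<alpha> :: real
    by (intro ennreal_leI mult_right_mono) auto
  then have le: "ennreal (C * \<epsilon> powr \<alpha>) * n \<le> ennreal (max 1 C * \<epsilon> powr \<alpha>) * n" for \<epsilon> \<alpha> n
    by (rule mult_right_mono) simp
  have "ennreal \<bar>emb D \<epsilon> f (rescale s z \<epsilon> \<phi>)\<bar>
       \<le> ennreal (max 1 C * \<epsilon> powr \<alpha>) * xnorm D \<alpha> (tsupp s \<phi> z \<epsilon>) z \<epsilon> f"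
    if "\<epsilon> \<in> {0<..1}" "f \<in> dspace D \<epsilon>" "\<phi> \<in> test_functions s r" for \<epsilon> f z \<alpha> \<phi>
    by (rule order_trans[OF C[OF that] le])
  then show ?thesis by (intro exI[of _ "max 1 C"]) simp
qed

text \<open>The constant with which the seminorms dominate tests at scale \<open>\<epsilon>\<close>, chosen at least 1 in order to serve
  at the larger scales as well.\<close>

definition control :: real where
  "control = (SOME C. C \<ge> 1 \<and> (\<forall>\<epsilon>\<in>{0<..1}. \<forall>f\<in>dspace D \<epsilon>. \<forall>z \<alpha>. \<forall>\<phi>\<in>test_functions s r.
     ennreal \<bar>emb D \<epsilon> f (rescale s z \<epsilon> \<phi>)\<bar>
       \<le> ennreal (C * \<epsilon> powr \<alpha>) * xnorm D \<alpha> (tsupp s \<phi> z \<epsilon>) z \<epsilon> f))"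

lemma control_ge_1: "1 \<le> control"
  and control_bound: "\<epsilon> \<in> {0<..1} \<Longrightarrow> f \<in> dspace D \<epsilon> \<Longrightarrow> \<phi> \<in> test_functions s r \<Longrightarrow>
     ennreal \<bar>emb D \<epsilon> f (rescale s z \<epsilon> \<phi>)\<bar>
       \<le> ennreal (control * \<epsilon> powr \<alpha>) * xnorm D \<alpha> (tsupp s \<phi> z \<epsilon>) z \<epsilon> f"
  using someI_ex[OF control_exists] unfolding control_def[symmetric] by auto

lemma emb_add:
  "\<epsilon> \<in> {0<..1} \<Longrightarrow> f \<in> dspace D \<epsilon> \<Longrightarrow> g \<in> dspace D \<epsilon> \<Longrightarrow> emb D \<epsilon> (f + g) \<phi> = emb D \<epsilon> f \<phi> + emb D \<epsilon> g \<phi>"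
  using dspaces by (simp add: dspaces_def)

lemma emb_scale:
  "\<epsilon> \<in> {0<..1} \<Longrightarrow> f \<in> dspace D \<epsilon> \<Longrightarrow> emb D \<epsilon> (a *\<^sub>R f) \<phi> = a * emb D \<epsilon> f \<phi>"
  using dspaces by (simp add: dspaces_def)

lemma subspace_dspace: "\<epsilon> \<in> {0<..1} \<Longrightarrow> subspace (dspace D \<epsilon>)"
  using dspaces by (simp add: dspaces_def)

lemma emb_diff:
  assumes "\<epsilon> \<in> {0<..1}" "f \<in> dspace D \<epsilon>" "g \<in> dspace D \<epsilon>"
  shows "emb D \<epsilon> (f - g) \<phi> = emb D \<epsilon> f \<phi> - emb D \<epsilon> g \<phi>"
proof -
  have "emb D \<epsilon> ((f - g) + g) \<phi> = emb D \<epsilon> (f - g) \<phi> + emb D \<epsilon> g \<phi>"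
    using assms by (intro emb_add subspace_diff subspace_dspace)
  then show ?thesis by simp
qed

lemma Cc_linear_emb:
  assumes "\<epsilon> \<in> {0<..1}" "f \<in> dspace D \<epsilon>"
  shows "Cc_linear r (emb D \<epsilon> f)"
proof -
  have "emb D \<epsilon> f \<in> distributions r" using assms dspaces by (simp add: dspaces_def)
  then show ?thesis by (simp add: distributions_def Cc_linear_def)
qed

lemma linear_emb:
  assumes "\<epsilon> \<in> {0<..1}" "linear p" "range p \<subseteq> dspace D \<epsilon>"
  shows "linear (\<lambda>\<tau>. emb D \<epsilon> (p \<tau>) \<phi>)"
  using assms by (intro linearI)
    (auto simp: linear_add[OF assms(2)] linear_cmul[OF assms(2)] emb_add emb_scale range_subsetD)

lemma xnorm_scale:
  assumes "\<epsilon> \<in> {0<..1}" "small_compact s \<epsilon> L" "f \<in> dspace D \<epsilon>"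
  shows "xnorm D \<alpha> L z \<epsilon> (a *\<^sub>R f) = ennreal \<bar>a\<bar> * xnorm D \<alpha> L z \<epsilon> f"
  using assms local_xnorms unfolding local_xnorms_def by blast

lemma rnorm_scale:
  assumes "\<alpha> \<in> homs T" "\<tau> \<in> hom_space T \<alpha>"
  shows "rnorm T \<alpha> (a *\<^sub>R \<tau>) = \<bar>a\<bar> * rnorm T \<alpha> \<tau>"
  using assms banach unfolding banach_components_def by blast

lemma rnorm_nonneg: "\<alpha> \<in> homs T \<Longrightarrow> \<tau> \<in> hom_space T \<alpha> \<Longrightarrow> 0 \<le> rnorm T \<alpha> \<tau>"
  using banach unfolding banach_components_def by blast

lemma rnorm_eq_0: "\<alpha> \<in> homs T \<Longrightarrow> \<tau> \<in> hom_space T \<alpha> \<Longrightarrow> rnorm T \<alpha> \<tau> = 0 \<Longrightarrow> \<tau> = 0"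
  using banach unfolding banach_components_def by blast

text \<open>A bound on the unit ball extends to the whole component by homogeneity. Vectors of norm 0
  vanish, which also settles the case \<open>N = top\<close>.\<close>

lemma homogeneous_bound:
  fixes q :: "'v \<Rightarrow> ennreal"
  assumes q: "\<And>a \<tau>. q (a *\<^sub>R \<tau>) = ennreal \<bar>a\<bar> * q \<tau>"
    and N: "\<And>\<tau>. (\<alpha>, \<tau>) \<in> unit_hom T \<gamma> \<Longrightarrow> q \<tau> \<le> N"
    and \<sigma>: "\<alpha> \<in> levels" "\<sigma> \<in> hom_space T \<alpha>"
  shows "q \<sigma> \<le> N * ennreal (rnorm T \<alpha> \<sigma>)"
proof -
  have \<alpha>: "\<alpha> \<in> homs T" "\<alpha> < \<gamma>" using \<sigma> by (auto simp: levels_def)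
  define c where "c = rnorm T \<alpha> \<sigma>"
  show ?thesis
  proof (cases "c = 0")
    case True
    then have "\<sigma> = 0" using rnorm_eq_0 \<alpha> \<sigma> by (simp add: c_def)
    then show ?thesis using q[of 0 0] by simp
  next
    case False
    then have c: "c > 0" using rnorm_nonneg[OF \<alpha>(1) \<sigma>(2)] by (simp add: c_def)
    obtain \<sigma>0 where \<sigma>0: "\<sigma> = proj T \<alpha> \<sigma>0" using \<sigma>(2) by (auto simp: hom_space_def)
    have "inverse c *\<^sub>R \<sigma> = proj T \<alpha> (inverse c *\<^sub>R \<sigma>0)"
      by (simp add: \<sigma>0 linear_cmul[OF linear_proj])
    then have "inverse c *\<^sub>R \<sigma> \<in> hom_space T \<alpha>" by (auto simp: hom_space_def)
    moreover have "rnorm T \<alpha> (inverse c *\<^sub>R \<sigma>) = 1"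
      using rnorm_scale[OF \<alpha>(1) \<sigma>(2)] c by (simp add: c_def)
    ultimately have "q (inverse c *\<^sub>R \<sigma>) \<le> N" using \<alpha> by (intro N) (simp add: unit_hom_def)
    then have "ennreal c * q (inverse c *\<^sub>R \<sigma>) \<le> ennreal c * N" by (rule mult_left_mono) simp
    moreover have "q (c *\<^sub>R (inverse c *\<^sub>R \<sigma>)) = ennreal c * q (inverse c *\<^sub>R \<sigma>)"
      using q[of c "inverse c *\<^sub>R \<sigma>"] c by simp
    ultimately show ?thesis using c by (simp add: c_def mult.commute)
  qed
qed

text \<open>An infinite constant is admissible because vectors of norm 0 vanish. Hence the model norm
  is itself an admissible constant, for a single model and for the difference of two models alike.\<close>

lemma Pi_bound_top:
  assumes e: "\<epsilon> \<in> {0<..1}" and P: "\<And>z. linear (P z)" "\<And>z. range (P z) \<subseteq> dspace D \<epsilon>"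
  shows "Pi_bound s r T D \<epsilon> \<gamma> F P top"
  unfolding Pi_bound_def
proof (intro ballI impI conjI allI)
  fix z \<alpha> \<tau> assume *: "\<alpha> \<in> homs T" "\<alpha> < \<gamma>" "\<tau> \<in> hom_space T \<alpha>"
  have top_mult: "top * ennreal c = top" if "0 < c" for c
    using that by (simp add: ennreal_top_mult ennreal_eq_0_iff)
  have pos: "0 < rnorm T \<alpha> \<tau>" if "\<tau> \<noteq> 0"
    using rnorm_nonneg[OF *(1,3)] rnorm_eq_0[OF *(1,3)] that by fastforce
  show "ennreal \<bar>emb D \<epsilon> (P z \<tau>) (rescale s z l \<phi>)\<bar> \<le> top * ennreal (rnorm T \<alpha> \<tau> * l powr \<alpha>)"
    if "l \<in> {\<epsilon><..1}" for l \<phi>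
  proof (cases "\<tau> = 0")
    case True
    then show ?thesis using linear_0[OF linear_emb[OF e P]] by simp
  next
    case False
    then have "0 < rnorm T \<alpha> \<tau> * l powr \<alpha>" using pos that e by simp
    then show ?thesis by (simp only: top_mult top_greatest)
  qed
  show "xnorm D \<alpha> L z \<epsilon> (P z \<tau>) \<le> top * ennreal (rnorm T \<alpha> \<tau>)" if "small_compact s \<epsilon> L" for L
  proof (cases "\<tau> = 0")
    case True
    then show ?thesis
      using linear_0[OF P(1)] xnorm_scale[OF e that subspace_0[OF subspace_dspace[OF e]], of \<alpha> z 0] by simp
  next
    case False
    then have "0 < rnorm T \<alpha> \<tau>" by (rule pos)
    then show ?thesis by (simp only: top_mult top_greatest)
  qed
qed

text \<open>The model norm bounds tests at scales above \<open>\<epsilon>\<close> directly. At scale \<open>\<epsilon>\<close> itself it bounds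
  the local seminorm, which in turn dominates the test.\<close>

lemma Pi_norm_test:
  assumes e: "\<epsilon> \<in> {0<..1}" and P: "\<And>z. linear (P z)" "\<And>z. range (P z) \<subseteq> dspace D \<epsilon>"
    and z: "z \<in> F" and \<sigma>: "\<alpha> \<in> levels" "\<sigma> \<in> hom_space T \<alpha>"
    and l: "l \<in> {\<epsilon>..1}" and \<phi>: "\<phi> \<in> test_functions s r"
  shows "ennreal \<bar>emb D \<epsilon> (P z \<sigma>) (rescale s z l \<phi>)\<bar>
    \<le> ennreal control * Pi_norm s r T D \<epsilon> \<gamma> F P * ennreal (rnorm T \<alpha> \<sigma> * l powr \<alpha>)"
proof -
  let ?N = "Pi_norm s r T D \<epsilon> \<gamma> F P"
  have \<alpha>: "\<alpha> \<in> homs T" "\<alpha> < \<gamma>" using \<sigma> by (auto simp: levels_def)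
  have ne: "{C. Pi_bound s r T D \<epsilon> \<gamma> F P C} \<noteq> {}" using Pi_bound_top[of \<epsilon> P F, OF e P] by blast
  show ?thesis
  proof (cases "l = \<epsilon>")
    case True
    have sc: "small_compact s \<epsilon> (tsupp s \<phi> z \<epsilon>)"
      using e by (intro small_compact_tsupp[OF s _ \<phi>]) simp
    have x: "xnorm D \<alpha> (tsupp s \<phi> z \<epsilon>) z \<epsilon> (P z \<sigma>) \<le> ?N * ennreal (rnorm T \<alpha> \<sigma>)"
      unfolding Pi_norm_def using ne
      by (rule le_Inf_mult_ennreal) (use z \<alpha> \<sigma> sc in \<open>auto simp: Pi_bound_def\<close>)
    have "ennreal \<bar>emb D \<epsilon> (P z \<sigma>) (rescale s z \<epsilon> \<phi>)\<bar> \<le>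
        ennreal (control * \<epsilon> powr \<alpha>) * xnorm D \<alpha> (tsupp s \<phi> z \<epsilon>) z \<epsilon> (P z \<sigma>)"
      using P(2) by (intro control_bound[OF e _ \<phi>]) auto
    also have "\<dots> \<le> ennreal (control * \<epsilon> powr \<alpha>) * (?N * ennreal (rnorm T \<alpha> \<sigma>))"
      by (intro mult_left_mono x) simp
    also have "\<dots> = ennreal control * ?N * ennreal (rnorm T \<alpha> \<sigma> * l powr \<alpha>)"
      unfolding True ennreal_mult''[OF powr_ge_zero] by (simp only: mult_ac)
    finally show ?thesis using True by simp
  next
    case False
    then have l': "l \<in> {\<epsilon><..1}" using l by auto
    have "ennreal \<bar>emb D \<epsilon> (P z \<sigma>) (rescale s z l \<phi>)\<bar> \<le> ?N * ennreal (rnorm T \<alpha> \<sigma> * l powr \<alpha>)"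
      unfolding Pi_norm_def using ne
      by (rule le_Inf_mult_ennreal) (use z \<alpha> \<sigma> l' \<phi> in \<open>auto simp: Pi_bound_def\<close>)
    also have "\<dots> \<le> ennreal control * (?N * ennreal (rnorm T \<alpha> \<sigma> * l powr \<alpha>))"
      using mult_right_mono[of 1 "ennreal control"] control_ge_1 by simp
    finally show ?thesis by (simp add: mult.assoc)
  qed
qed

text \<open>At scale \<open>\<epsilon>\<close> the two models are not compared but bounded separately: the discrete one through the
  local seminorm, the continuous one through the supremum over scales up to \<open>\<epsilon>\<close>.\<close>

lemma Pi_dist_test:
  assumes e: "\<epsilon> \<in> {0<..1}" and P: "\<And>z. linear (P z)" "\<And>z. range (P z) \<subseteq> dspace D \<epsilon>"
    and Pc: "\<And>z \<phi>. linear (\<lambda>\<tau>. Pc z \<tau> \<phi>)"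
    and z: "z \<in> F" and \<sigma>: "\<alpha> \<in> levels" "\<sigma> \<in> hom_space T \<alpha>"
    and l: "l \<in> {\<epsilon>..1}" and \<phi>: "\<phi> \<in> test_functions s r"
  shows "ennreal \<bar>Pc z \<sigma> (rescale s z l \<phi>) - emb D \<epsilon> (P z \<sigma>) (rescale s z l \<phi>)\<bar>
    \<le> ennreal (control + 1) * Pi_dist s r T D \<epsilon> \<gamma> F Pc P * ennreal (rnorm T \<alpha> \<sigma> * l powr \<alpha>)"
proof -
  let ?N = "Pi_dist s r T D \<epsilon> \<gamma> F Pc P" and ?\<psi> = "rescale s z l \<phi>"
  have \<alpha>: "\<alpha> \<in> homs T" "\<alpha> < \<gamma>" using \<sigma> by (auto simp: levels_def)
  have l0: "0 < l" using l e by auto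
  have weight: "ennreal x = ennreal (l powr \<alpha>) * ennreal (l powr (- \<alpha>) * x)" for x
    using l0 by (simp add: ennreal_mult'[symmetric] mult.assoc[symmetric] powr_add[symmetric])
  have bound: "ennreal \<bar>w \<sigma>\<bar> \<le> N * ennreal (rnorm T \<alpha> \<sigma> * l powr \<alpha>)"
    if w: "linear w" and le: "\<And>\<tau>. (\<alpha>, \<tau>) \<in> unit_hom T \<gamma> \<Longrightarrow> ennreal (l powr (- \<alpha>) * \<bar>w \<tau>\<bar>) \<le> N"
    for w N
  proof -
    have "ennreal (l powr (- \<alpha>) * \<bar>w \<sigma>\<bar>) \<le> N * ennreal (rnorm T \<alpha> \<sigma>)"
      by (rule homogeneous_bound[OF _ le \<sigma>])
        (auto simp: linear_cmul[OF w] abs_mult ennreal_mult'[symmetric] mult_ac)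
    then have "ennreal (l powr \<alpha>) * ennreal (l powr (- \<alpha>) * \<bar>w \<sigma>\<bar>)
        \<le> ennreal (l powr \<alpha>) * (N * ennreal (rnorm T \<alpha> \<sigma>))"
      by (rule mult_left_mono) simp
    then show ?thesis
      unfolding weight[of "\<bar>w \<sigma>\<bar>"] ennreal_mult''[OF powr_ge_zero] by (simp only: mult_ac)
  qed
  have linP: "linear (\<lambda>\<tau>. emb D \<epsilon> (P z \<tau>) ?\<psi>)" by (rule linear_emb[OF e P])
  show ?thesis
  proof (cases "l = \<epsilon>")
    case False
    have "ennreal \<bar>Pc z \<sigma> ?\<psi> - emb D \<epsilon> (P z \<sigma>) ?\<psi>\<bar> \<le> ?N * ennreal (rnorm T \<alpha> \<sigma> * l powr \<alpha>)"
    proof (rule bound[of "\<lambda>\<tau>. Pc z \<tau> ?\<psi> - emb D \<epsilon> (P z \<tau>) ?\<psi>"])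
      show "linear (\<lambda>\<tau>. Pc z \<tau> ?\<psi> - emb D \<epsilon> (P z \<tau>) ?\<psi>)"
        by (intro linear_compose_sub Pc linP)
      fix \<tau> assume \<tau>: "(\<alpha>, \<tau>) \<in> unit_hom T \<gamma>"
      have "l \<in> {\<epsilon><..1}" using False l by auto
      then have "ennreal (l powr (- \<alpha>) * \<bar>Pc z \<tau> ?\<psi> - emb D \<epsilon> (P z \<tau>) ?\<psi>\<bar>)
          \<le> Pi_diff_above s r T D \<epsilon> \<gamma> F Pc P"
        unfolding Pi_diff_above_def using z \<tau> \<phi>
        by (intro SUP_upper2[OF z] SUP_upper2[OF \<tau>]) (auto intro!: SUP_upper2[of l] SUP_upper2[of \<phi>])
      also have "\<dots> \<le> ?N" unfolding Pi_dist_def by (simp add: add.assoc)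
      finally show "ennreal (l powr (- \<alpha>) * \<bar>Pc z \<tau> ?\<psi> - emb D \<epsilon> (P z \<tau>) ?\<psi>\<bar>) \<le> ?N" .
    qed
    also have "\<dots> \<le> ennreal (control + 1) * (?N * ennreal (rnorm T \<alpha> \<sigma> * l powr \<alpha>))"
      using mult_right_mono[of 1 "ennreal (control + 1)"] control_ge_1 by simp
    finally show ?thesis by (simp add: mult.assoc)
  next
    case True
    have c: "ennreal \<bar>Pc z \<sigma> ?\<psi>\<bar> \<le> ?N * ennreal (rnorm T \<alpha> \<sigma> * l powr \<alpha>)"
    proof (rule bound[OF Pc])
      fix \<tau> assume \<tau>: "(\<alpha>, \<tau>) \<in> unit_hom T \<gamma>"
      have "ennreal (l powr (- \<alpha>) * \<bar>Pc z \<tau> ?\<psi>\<bar>)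
          \<le> (SUP z\<in>F. SUP (\<alpha>, \<tau>)\<in>unit_hom T \<gamma>. SUP l\<in>{\<epsilon><..1} \<union> {0<..\<epsilon>}. SUP \<phi>\<in>test_functions s r.
              ennreal (l powr (-\<alpha>) * \<bar>Pc z \<tau> (rescale s z l \<phi>)\<bar>))"
        using z \<tau> \<phi> True l0
        by (intro SUP_upper2[OF z] SUP_upper2[OF \<tau>]) (auto intro!: SUP_upper2[of \<epsilon>] SUP_upper2[of \<phi>])
      also have "\<dots> \<le> ?N" unfolding Pi_dist_def by simp
      finally show "ennreal (l powr (- \<alpha>) * \<bar>Pc z \<tau> ?\<psi>\<bar>) \<le> ?N" .
    qed
    have sc: "small_compact s \<epsilon> (tsupp s \<phi> z \<epsilon>)"
      using e by (intro small_compact_tsupp[OF s _ \<phi>]) simp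
    have x: "xnorm D \<alpha> (tsupp s \<phi> z \<epsilon>) z \<epsilon> (P z \<sigma>) \<le> ?N * ennreal (rnorm T \<alpha> \<sigma>)"
    proof (rule homogeneous_bound[OF _ _ \<sigma>])
      show "xnorm D \<alpha> (tsupp s \<phi> z \<epsilon>) z \<epsilon> (P z (a *\<^sub>R \<tau>)) =
          ennreal \<bar>a\<bar> * xnorm D \<alpha> (tsupp s \<phi> z \<epsilon>) z \<epsilon> (P z \<tau>)" for a \<tau>
        using P(2) by (simp add: linear_cmul[OF P(1)] xnorm_scale[OF e sc] range_subsetD)
      fix \<tau> assume \<tau>: "(\<alpha>, \<tau>) \<in> unit_hom T \<gamma>"
      have "xnorm D \<alpha> (tsupp s \<phi> z \<epsilon>) z \<epsilon> (P z \<tau>) \<le>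
          (SUP z\<in>F. SUP (\<alpha>, \<tau>)\<in>unit_hom T \<gamma>. SUP L\<in>{L. small_compact s \<epsilon> L}. xnorm D \<alpha> L z \<epsilon> (P z \<tau>))"
        using sc by (intro SUP_upper2[OF z] SUP_upper2[OF \<tau>]) (auto intro!: SUP_upper)
      also have "\<dots> \<le> ?N" unfolding Pi_dist_def by (simp add: add.commute add.left_commute)
      finally show "xnorm D \<alpha> (tsupp s \<phi> z \<epsilon>) z \<epsilon> (P z \<tau>) \<le> ?N" .
    qed
    have "ennreal \<bar>emb D \<epsilon> (P z \<sigma>) (rescale s z \<epsilon> \<phi>)\<bar> \<le>
        ennreal (control * \<epsilon> powr \<alpha>) * xnorm D \<alpha> (tsupp s \<phi> z \<epsilon>) z \<epsilon> (P z \<sigma>)"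
      using P(2) by (intro control_bound[OF e _ \<phi>]) auto
    also have "\<dots> \<le> ennreal (control * \<epsilon> powr \<alpha>) * (?N * ennreal (rnorm T \<alpha> \<sigma>))"
      by (intro mult_left_mono x) simp
    also have "\<dots> = ennreal control * ?N * ennreal (rnorm T \<alpha> \<sigma> * l powr \<alpha>)"
      unfolding True ennreal_mult''[OF powr_ge_zero] by (simp only: mult_ac)
    finally have d: "ennreal \<bar>- emb D \<epsilon> (P z \<sigma>) ?\<psi>\<bar> \<le> ennreal control * ?N * ennreal (rnorm T \<alpha> \<sigma> * l powr \<alpha>)"
      using True by simp
    show ?thesis
      using ennreal_abs_add_le[OF c d] control_ge_1
      by (simp add: distrib_right add.commute)
  qed
qed

section \<open>The reconstruction bounds\<close>

lemma discrete_modelD: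
  assumes "discrete_model s r T D \<epsilon> p \<Gamma>"
  shows "linear (p z)" "range (p z) \<subseteq> dspace D \<epsilon>" "\<Gamma> \<in> transports T" "p x v = p y (\<Gamma> y x v)"
proof -
  show "linear (p z)" "range (p z) \<subseteq> dspace D \<epsilon>" "\<Gamma> \<in> transports T"
    using assms by (auto simp: discrete_model_def transport_rules_def)
  have "p x = p y \<circ> \<Gamma> y x" using assms by (simp add: discrete_model_def)
  then show "p x v = p y (\<Gamma> y x v)" by simp
qed

lemma Pi_increment_bound:
  assumes e: "\<epsilon> \<in> {0<..1}" and p: "\<And>z. linear (p z)" "\<And>z. range (p z) \<subseteq> dspace D \<epsilon>"
    and G: "G x y \<in> below T \<gamma>" and xy: "x \<in> S" "y \<in> S" "y \<in> F"
    and t: "\<epsilon> \<le> sdist s x y" "sdist s x y \<le> 1"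
    and l: "l \<in> {\<epsilon>..1}" and \<phi>: "\<phi> \<in> test_functions s r"
  shows "ennreal \<bar>emb D \<epsilon> (p y (G x y)) (rescale s y l \<phi>)\<bar> \<le>
    ennreal (control * (\<Sum>\<beta>\<in>levels. sdist s x y powr (\<gamma> - \<beta>) * l powr \<beta>))
      * (Pi_norm s r T D \<epsilon> \<gamma> F p * increment_sup s T \<gamma> S {\<epsilon>..1} G)"
proof (rule functional_increment_bound[where w = "\<lambda>\<tau>. emb D \<epsilon> (p y \<tau>) (rescale s y l \<phi>)"])
  show "linear (\<lambda>\<tau>. emb D \<epsilon> (p y \<tau>) (rescale s y l \<phi>))" by (rule linear_emb[OF e p])
  show "ennreal \<bar>emb D \<epsilon> (p y \<sigma>) (rescale s y l \<phi>)\<bar>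
      \<le> ennreal control * Pi_norm s r T D \<epsilon> \<gamma> F p * ennreal (rnorm T \<beta> \<sigma> * l powr \<beta>)"
    if "\<beta> \<in> levels" "\<sigma> \<in> hom_space T \<beta>" for \<beta> \<sigma>
    by (rule Pi_norm_test[OF e p xy(3) that l \<phi>])
qed (use G xy t e control_ge_1 in auto)

lemma small_scale_bound:
  assumes e: "\<epsilon> \<in> {0<..1}" and g: "g \<in> dspace D \<epsilon>" and \<phi>: "\<phi> \<in> test_functions s r"
    and x: "xnorm D \<gamma> (tsupp s \<phi> x \<epsilon>) x \<epsilon> g \<le> ennreal C * X" and X: "X \<le> Q"
  shows "ennreal \<bar>emb D \<epsilon> g (rescale s x \<epsilon> \<phi>)\<bar> \<le> ennreal (control * max 0 C * \<epsilon> powr \<gamma>) * Q"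
proof -
  have "ennreal \<bar>emb D \<epsilon> g (rescale s x \<epsilon> \<phi>)\<bar>
      \<le> ennreal (control * \<epsilon> powr \<gamma>) * xnorm D \<gamma> (tsupp s \<phi> x \<epsilon>) x \<epsilon> g"
    by (rule control_bound[OF e g \<phi>])
  also have "\<dots> \<le> ennreal (control * \<epsilon> powr \<gamma>) * (ennreal (max 0 C) * Q)"
  proof (rule mult_left_mono)
    have "ennreal C * X \<le> ennreal (max 0 C) * Q"
      by (intro mult_mono X ennreal_leI) auto
    with x show "xnorm D \<gamma> (tsupp s \<phi> x \<epsilon>) x \<epsilon> g \<le> ennreal (max 0 C) * Q"
      by (rule order_trans)
  qed simp
  also have "\<dots> = ennreal (control * \<epsilon> powr \<gamma> * max 0 C) * Q"
    by (subst ennreal_mult''[of "max 0 C"]) (auto simp: mult.assoc)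
  finally show ?thesis by (simp add: mult_ac)
qed

lemma fnorm_mono:
  assumes "\<Gamma> \<in> transports T" "\<epsilon> \<in> {0<..1}" "f \<in> functions_below T \<gamma>" "compact K" "compact L" "K \<subseteq> L"
  shows "fnorm D \<Gamma> \<gamma> K \<epsilon> f \<le> fnorm D \<Gamma> \<gamma> L \<epsilon> f"
  by (rule mono[unfolded monotone_seminorms_def, THEN conjunct1, rule_format, OF assms(1-3)])
    (use assms in simp)

lemma pnorm_mono:
  assumes "\<Gamma> \<in> transports T" "\<Gamma>' \<in> transports T" "\<epsilon> \<in> {0<..1}"
    "f \<in> functions_below T \<gamma>" "f' \<in> functions_below T \<gamma>" "compact K" "compact L" "K \<subseteq> L"
  shows "pnorm D \<Gamma> \<Gamma>' \<gamma> K \<epsilon> f f' \<le> pnorm D \<Gamma> \<Gamma>' \<gamma> L \<epsilon> f f'"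
  by (rule mono[unfolded monotone_seminorms_def, THEN conjunct2, rule_format, OF assms(1-5)])
    (use assms in simp)

text \<open>The local assumptions are uniform over base points in a compact set. The base points used below
  lie in supports of test functions centred in \<open>K\<close>, all of which are contained in this one.\<close>

lemma neighbourhood:
  assumes "compact K"
  shows "compact (closure (fatten s K))"
    and "\<delta> \<in> {0<..1} \<Longrightarrow> \<eta> \<in> test_functions s r \<Longrightarrow> z \<in> K \<Longrightarrow> tsupp s \<eta> z \<delta> \<subseteq> closure (fatten s K)"
proof -
  show "compact (closure (fatten s K))"
    using bounded_fatten[OF s compact_imp_bounded[OF assms]] by (simp add: compact_closure)
  assume "\<delta> \<in> {0<..1}" "\<eta> \<in> test_functions s r" "z \<in> K"
  then have "tsupp s \<eta> z \<delta> \<subseteq> fatten s K"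
    by (intro tsupp_subset_fatten[OF s]) auto
  then show "tsupp s \<eta> z \<delta> \<subseteq> closure (fatten s K)"
    using closure_subset by (rule order_trans)
qed

text \<open>The induction over scales is applied to \<open>U x = R f - \<Pi>\<^sub>x f(x)\<close> on the support of the rescaled test
  function. At scale \<open>\<epsilon>\<close> it is bounded by the assumption on \<open>R\<close>; a change of base point
  removes \<open>R f\<close> and leaves, up to sign, \<open>\<Pi>\<^sub>y\<close> applied to \<open>f(y) - \<Gamma>\<^sub>y\<^sub>x f(x)\<close>, because \<open>\<Pi>\<^sub>x = \<Pi>\<^sub>y \<Gamma>\<^sub>y\<^sub>x\<close>.\<close>

lemma reconstruction_bound:
  assumes K: "compact K"
    and model: "\<And>\<epsilon>. \<epsilon> \<in> {0<..1} \<Longrightarrow> discrete_model s r T D \<epsilon> (P \<epsilon>) (\<Gamma> \<epsilon>)"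
    and rec: "reconstruction s r T D \<gamma> P \<Gamma> R"
  shows "\<exists>C::real. \<forall>\<epsilon>\<in>{0<..1}. \<forall>\<delta>\<in>{\<epsilon><..1}. \<forall>\<eta>\<in>test_functions s r. \<forall>z\<in>K.
       \<forall>f\<in>D_space s T D \<epsilon> \<gamma> (\<Gamma> \<epsilon>).
         ennreal \<bar>emb D \<epsilon> (R \<epsilon> f - P \<epsilon> z (f z)) (rescale s z \<delta> \<eta>)\<bar>
           \<le> ennreal (C * \<delta> powr \<gamma>) *
             (Pi_norm s r T D \<epsilon> \<gamma> (fatten s (K \<union> tsupp s \<eta> z \<delta>)) (P \<epsilon>)
              * D_norm s T D \<epsilon> \<gamma> (tsupp s \<eta> z \<delta>) (\<Gamma> \<epsilon>) f)"
proof -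
  have "R1 s r T D \<gamma> P \<Gamma> R" using rec by (simp add: reconstruction_def)
  from this[unfolded R1_def, rule_format, OF neighbourhood(1)[OF K]]
  obtain C1 :: real where C1: "\<forall>\<epsilon>\<in>{0<..1}. \<forall>z\<in>closure (fatten s K). \<forall>L. small_compact s \<epsilon> L \<and> z \<in> L \<longrightarrow>
      (\<forall>f\<in>D_space s T D \<epsilon> \<gamma> (\<Gamma> \<epsilon>). xnorm D \<gamma> L z \<epsilon> (R \<epsilon> f - P \<epsilon> z (f z))
        \<le> ennreal C1 * (Pi_norm s r T D \<epsilon> \<gamma> (fatten s L) (P \<epsilon>) * fnorm D (\<Gamma> \<epsilon>) \<gamma> L \<epsilon> f))" ..
  obtain C where C: "multiscale_constant s r \<gamma> levels (control * max 0 C1) control C"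
    using multiscale_bound[of s \<gamma> levels "control * max 0 C1" control r] s \<gamma> control_ge_1
    by (auto simp: levels_def)
  show ?thesis
  proof (intro exI[of _ C] ballI)
    fix \<epsilon> \<delta> \<eta> z f
    assume e: "\<epsilon> \<in> {0<..1}" and \<delta>: "\<delta> \<in> {\<epsilon><..1}" and \<eta>: "\<eta> \<in> test_functions s r" and z: "z \<in> K"
      and f: "f \<in> D_space s T D \<epsilon> \<gamma> (\<Gamma> \<epsilon>)"
    let ?S = "tsupp s \<eta> z \<delta>" and ?G = "\<lambda>y z. f z - \<Gamma> \<epsilon> z y (f y)"
    let ?F = "fatten s (K \<union> ?S)"
    let ?Q = "Pi_norm s r T D \<epsilon> \<gamma> ?F (P \<epsilon>) * D_norm s T D \<epsilon> \<gamma> ?S (\<Gamma> \<epsilon>) f"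
    note m = discrete_modelD[OF model[OF e]]
    have fb: "f \<in> functions_below T \<gamma>" using f by (simp add: D_space_def)
    have Rf: "R \<epsilon> f \<in> dspace D \<epsilon>" using rec e f by (simp add: reconstruction_def)
    have Pf: "P \<epsilon> x \<tau> \<in> dspace D \<epsilon>" for x \<tau> using m(2) by auto
    have U: "R \<epsilon> f - P \<epsilon> x (f x) \<in> dspace D \<epsilon>" for x
      by (intro subspace_diff subspace_dspace e Rf Pf)
    have SF: "?S \<subseteq> ?F" using subset_fatten by blast
    have SK: "?S \<subseteq> closure (fatten s K)" using e \<delta> by (intro neighbourhood(2)[OF K _ \<eta> z]) auto
    have cS: "compact ?S" using e \<delta> by (intro compact_tsupp[OF s _ \<eta>]) auto
    show "ennreal \<bar>emb D \<epsilon> (R \<epsilon> f - P \<epsilon> z (f z)) (rescale s z \<delta> \<eta>)\<bar> \<le> ennreal (C * \<delta> powr \<gamma>) * ?Q"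
    proof (rule multiscale_constantD[OF C, where U = "\<lambda>x. emb D \<epsilon> (R \<epsilon> f - P \<epsilon> x (f x))" and S = ?S and \<epsilon> = \<epsilon>])
      show "\<forall>x\<in>?S. Cc_linear r (emb D \<epsilon> (R \<epsilon> f - P \<epsilon> x (f x)))"
        by (intro ballI Cc_linear_emb e U)
      show "\<forall>x\<in>?S. \<forall>\<phi>\<in>test_functions s r. tsupp s \<phi> x \<epsilon> \<subseteq> ?S \<longrightarrow>
          ennreal \<bar>emb D \<epsilon> (R \<epsilon> f - P \<epsilon> x (f x)) (rescale s x \<epsilon> \<phi>)\<bar>
            \<le> ennreal (control * max 0 C1 * \<epsilon> powr \<gamma>) * ?Q"
      proof (intro ballI impI)
        fix x \<phi> assume x: "x \<in> ?S" and \<phi>: "\<phi> \<in> test_functions s r" and L: "tsupp s \<phi> x \<epsilon> \<subseteq> ?S"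
        let ?L = "tsupp s \<phi> x \<epsilon>"
        have sc: "small_compact s \<epsilon> ?L" using e by (intro small_compact_tsupp[OF s _ \<phi>]) simp
        have "xnorm D \<gamma> ?L x \<epsilon> (R \<epsilon> f - P \<epsilon> x (f x))
            \<le> ennreal C1 * (Pi_norm s r T D \<epsilon> \<gamma> (fatten s ?L) (P \<epsilon>) * fnorm D (\<Gamma> \<epsilon>) \<gamma> ?L \<epsilon> f)"
          using SK x sc by (intro C1[rule_format, OF e _ _ f]) (auto simp: tsupp_def)
        moreover have "Pi_norm s r T D \<epsilon> \<gamma> (fatten s ?L) (P \<epsilon>) \<le> Pi_norm s r T D \<epsilon> \<gamma> ?F (P \<epsilon>)"
          using L by (intro Pi_norm_mono fatten_mono) auto
        moreover have "fnorm D (\<Gamma> \<epsilon>) \<gamma> ?L \<epsilon> f \<le> D_norm s T D \<epsilon> \<gamma> ?S (\<Gamma> \<epsilon>) f"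
        proof -
          have "fnorm D (\<Gamma> \<epsilon>) \<gamma> ?L \<epsilon> f \<le> fnorm D (\<Gamma> \<epsilon>) \<gamma> ?S \<epsilon> f"
            using sc by (intro fnorm_mono m(3) e fb cS L) (simp add: small_compact_def)
          then show ?thesis unfolding D_norm_def by (rule add_increasing[rotated]) simp
        qed
        ultimately show "ennreal \<bar>emb D \<epsilon> (R \<epsilon> f - P \<epsilon> x (f x)) (rescale s x \<epsilon> \<phi>)\<bar>
            \<le> ennreal (control * max 0 C1 * \<epsilon> powr \<gamma>) * ?Q"
          by (intro small_scale_bound[OF e U \<phi>]) (assumption, intro mult_mono, auto)
      qed
      show "\<forall>x\<in>?S. \<forall>y\<in>?S. \<forall>l\<in>{\<epsilon>..1}. \<forall>\<phi>\<in>test_functions s r. \<epsilon> \<le> sdist s x y \<longrightarrow> sdist s x y \<le> 1 \<longrightarrow>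
          ennreal \<bar>emb D \<epsilon> (R \<epsilon> f - P \<epsilon> y (f y)) (rescale s y l \<phi>)
              - emb D \<epsilon> (R \<epsilon> f - P \<epsilon> x (f x)) (rescale s y l \<phi>)\<bar>
            \<le> ennreal (control * (\<Sum>\<beta>\<in>levels. sdist s x y powr (\<gamma> - \<beta>) * l powr \<beta>)) * ?Q"
      proof (intro ballI impI)
        fix x y l \<phi> assume xy: "x \<in> ?S" "y \<in> ?S" and l: "l \<in> {\<epsilon>..1}" and \<phi>: "\<phi> \<in> test_functions s r"
          and t: "\<epsilon> \<le> sdist s x y" "sdist s x y \<le> 1"
        have yF: "y \<in> ?F" using xy SF by blast
        have "emb D \<epsilon> (R \<epsilon> f - P \<epsilon> y (f y)) \<psi> - emb D \<epsilon> (R \<epsilon> f - P \<epsilon> x (f x)) \<psi>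
            = - emb D \<epsilon> (P \<epsilon> y (?G x y)) \<psi>" for \<psi>
          by (simp add: emb_diff[OF e Rf Pf] emb_diff[OF e Pf Pf] linear_diff[OF m(1)] m(4)[of x _ y])
        then have eq: "\<bar>emb D \<epsilon> (R \<epsilon> f - P \<epsilon> y (f y)) (rescale s y l \<phi>)
              - emb D \<epsilon> (R \<epsilon> f - P \<epsilon> x (f x)) (rescale s y l \<phi>)\<bar>
            = \<bar>emb D \<epsilon> (P \<epsilon> y (?G x y)) (rescale s y l \<phi>)\<bar>"
          by (simp only: abs_minus_cancel)
        have "ennreal \<bar>emb D \<epsilon> (P \<epsilon> y (?G x y)) (rescale s y l \<phi>)\<bar>
            \<le> ennreal (control * (\<Sum>\<beta>\<in>levels. sdist s x y powr (\<gamma> - \<beta>) * l powr \<beta>))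
              * (Pi_norm s r T D \<epsilon> \<gamma> ?F (P \<epsilon>) * increment_sup s T \<gamma> ?S {\<epsilon>..1} ?G)"
          by (rule Pi_increment_bound[where p = "P \<epsilon>", OF e m(1,2) increment_below[OF m(3) fb] xy yF t l \<phi>])
        also have "\<dots> \<le> ennreal (control * (\<Sum>\<beta>\<in>levels. sdist s x y powr (\<gamma> - \<beta>) * l powr \<beta>)) * ?Q"
          by (intro mult_left_mono) (auto simp: D_norm_def)
        finally show "ennreal \<bar>emb D \<epsilon> (R \<epsilon> f - P \<epsilon> y (f y)) (rescale s y l \<phi>)
              - emb D \<epsilon> (R \<epsilon> f - P \<epsilon> x (f x)) (rescale s y l \<phi>)\<bar>
            \<le> ennreal (control * (\<Sum>\<beta>\<in>levels. sdist s x y powr (\<gamma> - \<beta>) * l powr \<beta>)) * ?Q"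
          unfolding eq .
      qed
    qed (use e \<delta> \<eta> in auto)
  qed
qed

text \<open>With \<open>G\<close> the increment of \<open>f\<close> and \<open>H\<close> that of the pair, the change of base point now produces, up to sign,the change of base point now produces
  \<open>\<Pi>\<^sub>y G - \<Pi>'\<^sub>y (G - H) = \<Pi>'\<^sub>y H + (\<Pi>\<^sub>y - \<Pi>'\<^sub>y) G\<close>, one summand for each product on the right-hand side.\<close>

lemma reconstruction_difference_bound:
  assumes K: "compact K"
    and model: "\<And>\<epsilon>. \<epsilon> \<in> {0<..1} \<Longrightarrow> discrete_model s r T D \<epsilon> (P \<epsilon>) (\<Gamma> \<epsilon>)"
    and model': "\<And>\<epsilon>. \<epsilon> \<in> {0<..1} \<Longrightarrow> discrete_model s r T D \<epsilon> (P' \<epsilon>) (\<Gamma>' \<epsilon>)"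
    and rec: "reconstruction s r T D \<gamma> P \<Gamma> R" and rec': "reconstruction s r T D \<gamma> P' \<Gamma>' R'"
    and R2: "R2 s r T D \<gamma> P \<Gamma> R P' \<Gamma>' R'"
  shows "\<exists>C::real. \<forall>\<epsilon>\<in>{0<..1}. \<forall>\<delta>\<in>{\<epsilon><..1}. \<forall>\<eta>\<in>test_functions s r. \<forall>z\<in>K.
         \<forall>f\<in>D_space s T D \<epsilon> \<gamma> (\<Gamma> \<epsilon>). \<forall>f'\<in>D_space s T D \<epsilon> \<gamma> (\<Gamma>' \<epsilon>).
           ennreal \<bar>emb D \<epsilon> (R \<epsilon> f - R' \<epsilon> f' - P \<epsilon> z (f z) + P' \<epsilon> z (f' z)) (rescale s z \<delta> \<eta>)\<bar>
             \<le> ennreal (C * \<delta> powr \<gamma>) *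
               (Pi_norm s r T D \<epsilon> \<gamma> (fatten s (K \<union> tsupp s \<eta> z \<delta>)) (P' \<epsilon>)
                  * D_dist s T D \<epsilon> \<gamma> (tsupp s \<eta> z \<delta>) (\<Gamma> \<epsilon>) (\<Gamma>' \<epsilon>) f f'
                + Pi_norm s r T D \<epsilon> \<gamma> (fatten s (K \<union> tsupp s \<eta> z \<delta>)) (\<lambda>x \<tau>. P \<epsilon> x \<tau> - P' \<epsilon> x \<tau>)
                  * D_norm s T D \<epsilon> \<gamma> (tsupp s \<eta> z \<delta>) (\<Gamma> \<epsilon>) f)"
proof -
  from R2[unfolded R2_def, rule_format, OF neighbourhood(1)[OF K]]
  obtain C2 :: real where C2: "\<forall>\<epsilon>\<in>{0<..1}. \<forall>z\<in>closure (fatten s K). \<forall>L. small_compact s \<epsilon> L \<and> z \<in> L \<longrightarrow>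
     (\<forall>f\<in>D_space s T D \<epsilon> \<gamma> (\<Gamma> \<epsilon>). \<forall>f'\<in>D_space s T D \<epsilon> \<gamma> (\<Gamma>' \<epsilon>).
       xnorm D \<gamma> L z \<epsilon> (R \<epsilon> f - P \<epsilon> z (f z) - R' \<epsilon> f' + P' \<epsilon> z (f' z))
         \<le> ennreal C2 *
           (Pi_norm s r T D \<epsilon> \<gamma> (fatten s L) (P' \<epsilon>) * pnorm D (\<Gamma> \<epsilon>) (\<Gamma>' \<epsilon>) \<gamma> L \<epsilon> f f'
            + Pi_norm s r T D \<epsilon> \<gamma> (fatten s L) (\<lambda>x \<tau>. P \<epsilon> x \<tau> - P' \<epsilon> x \<tau>)
              * fnorm D (\<Gamma> \<epsilon>) \<gamma> L \<epsilon> f))" ..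
  obtain C where C: "multiscale_constant s r \<gamma> levels (control * max 0 C2) control C"
    using multiscale_bound[of s \<gamma> levels "control * max 0 C2" control r] s \<gamma> control_ge_1
    by (auto simp: levels_def)
  show ?thesis
  proof (intro exI[of _ C] ballI)
    fix \<epsilon> \<delta> \<eta> z f f'
    assume e: "\<epsilon> \<in> {0<..1}" and \<delta>: "\<delta> \<in> {\<epsilon><..1}" and \<eta>: "\<eta> \<in> test_functions s r" and z: "z \<in> K"
      and f: "f \<in> D_space s T D \<epsilon> \<gamma> (\<Gamma> \<epsilon>)" and f': "f' \<in> D_space s T D \<epsilon> \<gamma> (\<Gamma>' \<epsilon>)"
    let ?S = "tsupp s \<eta> z \<delta>" and ?p = "\<lambda>x \<tau>. P \<epsilon> x \<tau> - P' \<epsilon> x \<tau>"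
    let ?G = "\<lambda>y z. f z - \<Gamma> \<epsilon> z y (f y)"
    let ?H = "\<lambda>y z. f z - f' z - \<Gamma> \<epsilon> z y (f y) + \<Gamma>' \<epsilon> z y (f' y)"
    let ?F = "fatten s (K \<union> ?S)"
    let ?Q = "Pi_norm s r T D \<epsilon> \<gamma> ?F (P' \<epsilon>) * D_dist s T D \<epsilon> \<gamma> ?S (\<Gamma> \<epsilon>) (\<Gamma>' \<epsilon>) f f'
      + Pi_norm s r T D \<epsilon> \<gamma> ?F ?p * D_norm s T D \<epsilon> \<gamma> ?S (\<Gamma> \<epsilon>) f"
    let ?U = "\<lambda>x. R \<epsilon> f - R' \<epsilon> f' - P \<epsilon> x (f x) + P' \<epsilon> x (f' x)"
    note m = discrete_modelD[OF model[OF e]] and m' = discrete_modelD[OF model'[OF e]]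
    have fb: "f \<in> functions_below T \<gamma>" "f' \<in> functions_below T \<gamma>" using f f' by (auto simp: D_space_def)
    have Rf: "R \<epsilon> f \<in> dspace D \<epsilon>" "R' \<epsilon> f' \<in> dspace D \<epsilon>"
      using rec rec' e f f' by (auto simp: reconstruction_def)
    have Pf: "P \<epsilon> x \<tau> \<in> dspace D \<epsilon>" "P' \<epsilon> x \<tau> \<in> dspace D \<epsilon>" for x \<tau>
      by (rule range_subsetD[OF m(2)] range_subsetD[OF m'(2)])+
    note sub = subspace_dspace[OF e]
    have U: "?U x \<in> dspace D \<epsilon>" for x
      by (intro subspace_diff[OF sub] subspace_add[OF sub] Rf Pf)
    have p: "linear (?p x)" "range (?p x) \<subseteq> dspace D \<epsilon>" for x
      by (intro linear_compose_sub m(1) m'(1)) (auto intro: subspace_diff[OF sub] Pf)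
    have SF: "?S \<subseteq> ?F" using subset_fatten by blast
    have SK: "?S \<subseteq> closure (fatten s K)" using e \<delta> by (intro neighbourhood(2)[OF K _ \<eta> z]) auto
    have cS: "compact ?S" using e \<delta> by (intro compact_tsupp[OF s _ \<eta>]) auto
    show "ennreal \<bar>emb D \<epsilon> (?U z) (rescale s z \<delta> \<eta>)\<bar> \<le> ennreal (C * \<delta> powr \<gamma>) * ?Q"
    proof (rule multiscale_constantD[OF C, where U = "\<lambda>x. emb D \<epsilon> (?U x)" and S = ?S and \<epsilon> = \<epsilon>])
      show "\<forall>x\<in>?S. Cc_linear r (emb D \<epsilon> (?U x))"
        by (intro ballI Cc_linear_emb e U)
      show "\<forall>x\<in>?S. \<forall>\<phi>\<in>test_functions s r. tsupp s \<phi> x \<epsilon> \<subseteq> ?S \<longrightarrow>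
          ennreal \<bar>emb D \<epsilon> (?U x) (rescale s x \<epsilon> \<phi>)\<bar>
            \<le> ennreal (control * max 0 C2 * \<epsilon> powr \<gamma>) * ?Q"
      proof (intro ballI impI)
        fix x \<phi> assume x: "x \<in> ?S" and \<phi>: "\<phi> \<in> test_functions s r" and L: "tsupp s \<phi> x \<epsilon> \<subseteq> ?S"
        let ?L = "tsupp s \<phi> x \<epsilon>"
        have sc: "small_compact s \<epsilon> ?L" using e by (intro small_compact_tsupp[OF s _ \<phi>]) simp
        then have cL: "compact ?L" by (simp add: small_compact_def)
        have FL: "fatten s ?L \<subseteq> ?F" using L by (intro fatten_mono) auto
        have "xnorm D \<gamma> ?L x \<epsilon> (R \<epsilon> f - P \<epsilon> x (f x) - R' \<epsilon> f' + P' \<epsilon> x (f' x))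
            \<le> ennreal C2 * (Pi_norm s r T D \<epsilon> \<gamma> (fatten s ?L) (P' \<epsilon>) * pnorm D (\<Gamma> \<epsilon>) (\<Gamma>' \<epsilon>) \<gamma> ?L \<epsilon> f f'
            + Pi_norm s r T D \<epsilon> \<gamma> (fatten s ?L) ?p * fnorm D (\<Gamma> \<epsilon>) \<gamma> ?L \<epsilon> f)"
          using SK x sc by (intro C2[rule_format, OF e _ _ f f']) (auto simp: tsupp_def)
        moreover have "R \<epsilon> f - P \<epsilon> x (f x) - R' \<epsilon> f' + P' \<epsilon> x (f' x) = ?U x" by simp
        ultimately have xn: "xnorm D \<gamma> ?L x \<epsilon> (?U x)
            \<le> ennreal C2 * (Pi_norm s r T D \<epsilon> \<gamma> (fatten s ?L) (P' \<epsilon>) * pnorm D (\<Gamma> \<epsilon>) (\<Gamma>' \<epsilon>) \<gamma> ?L \<epsilon> f f'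
            + Pi_norm s r T D \<epsilon> \<gamma> (fatten s ?L) ?p * fnorm D (\<Gamma> \<epsilon>) \<gamma> ?L \<epsilon> f)"
          by (simp only:)
        have "fnorm D (\<Gamma> \<epsilon>) \<gamma> ?L \<epsilon> f \<le> fnorm D (\<Gamma> \<epsilon>) \<gamma> ?S \<epsilon> f"
          by (intro fnorm_mono m(3) e fb cS cL L)
        then have fn: "fnorm D (\<Gamma> \<epsilon>) \<gamma> ?L \<epsilon> f \<le> D_norm s T D \<epsilon> \<gamma> ?S (\<Gamma> \<epsilon>) f"
          unfolding D_norm_def by (rule add_increasing[rotated]) simp
        have "pnorm D (\<Gamma> \<epsilon>) (\<Gamma>' \<epsilon>) \<gamma> ?L \<epsilon> f f' \<le> pnorm D (\<Gamma> \<epsilon>) (\<Gamma>' \<epsilon>) \<gamma> ?S \<epsilon> f f'"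
          by (intro pnorm_mono m(3) m'(3) e fb cS cL L)
        then have pn: "pnorm D (\<Gamma> \<epsilon>) (\<Gamma>' \<epsilon>) \<gamma> ?L \<epsilon> f f' \<le> D_dist s T D \<epsilon> \<gamma> ?S (\<Gamma> \<epsilon>) (\<Gamma>' \<epsilon>) f f'"
          unfolding D_dist_def by (rule add_increasing[rotated]) simp
        show "ennreal \<bar>emb D \<epsilon> (?U x) (rescale s x \<epsilon> \<phi>)\<bar>
            \<le> ennreal (control * max 0 C2 * \<epsilon> powr \<gamma>) * ?Q"
          by (rule small_scale_bound[OF e U \<phi> xn])
            (intro add_mono mult_mono fn pn Pi_norm_mono FL zero_le)
      qed
      show "\<forall>x\<in>?S. \<forall>y\<in>?S. \<forall>l\<in>{\<epsilon>..1}. \<forall>\<phi>\<in>test_functions s r. \<epsilon> \<le> sdist s x y \<longrightarrow> sdist s x y \<le> 1 \<longrightarrow>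
          ennreal \<bar>emb D \<epsilon> (?U y) (rescale s y l \<phi>) - emb D \<epsilon> (?U x) (rescale s y l \<phi>)\<bar>
            \<le> ennreal (control * (\<Sum>\<beta>\<in>levels. sdist s x y powr (\<gamma> - \<beta>) * l powr \<beta>)) * ?Q"
      proof (intro ballI impI)
        fix x y l \<phi> assume xy: "x \<in> ?S" "y \<in> ?S" and l: "l \<in> {\<epsilon>..1}" and \<phi>: "\<phi> \<in> test_functions s r"
          and t: "\<epsilon> \<le> sdist s x y" "sdist s x y \<le> 1"
        let ?\<psi> = "rescale s y l \<phi>"
        let ?c = "control * (\<Sum>\<beta>\<in>levels. sdist s x y powr (\<gamma> - \<beta>) * l powr \<beta>)"
        have yF: "y \<in> ?F" using xy SF by blast
        have "?U y - ?U x = (-1) *\<^sub>R (P' \<epsilon> y (?H x y) + ?p y (?G x y))"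
          by (simp add: linear_diff[OF m(1)] linear_diff[OF m'(1)] linear_add[OF m'(1)]
              m(4)[of x _ y] m'(4)[of x _ y] algebra_simps)
        then have "emb D \<epsilon> (?U y) ?\<psi> - emb D \<epsilon> (?U x) ?\<psi>
            = emb D \<epsilon> ((-1) *\<^sub>R (P' \<epsilon> y (?H x y) + ?p y (?G x y))) ?\<psi>"
          by (simp only: emb_diff[OF e U U, symmetric])
        also have "\<dots> = - (emb D \<epsilon> (P' \<epsilon> y (?H x y)) ?\<psi> + emb D \<epsilon> (?p y (?G x y)) ?\<psi>)"
          by (subst emb_scale[OF e], (intro subspace_add[OF sub] subspace_diff[OF sub] Pf),
              subst emb_add[OF e], (intro subspace_diff[OF sub] Pf)+) simp
        finally have eq: "\<bar>emb D \<epsilon> (?U y) ?\<psi> - emb D \<epsilon> (?U x) ?\<psi>\<bar>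
            = \<bar>emb D \<epsilon> (P' \<epsilon> y (?H x y)) ?\<psi> + emb D \<epsilon> (?p y (?G x y)) ?\<psi>\<bar>"
          by (simp only: abs_minus_cancel)
        have "?H x y = ?G x y - (f' y - \<Gamma>' \<epsilon> y x (f' x))" by simp
        then have Hb: "?H x y \<in> below T \<gamma>"
          by (simp only:) (intro subspace_diff[OF subspace_below] increment_below[OF m(3) fb(1)]
              increment_below[OF m'(3) fb(2)])
        have "ennreal \<bar>emb D \<epsilon> (P' \<epsilon> y (?H x y)) ?\<psi>\<bar>
            \<le> ennreal ?c * (Pi_norm s r T D \<epsilon> \<gamma> ?F (P' \<epsilon>) * increment_sup s T \<gamma> ?S {\<epsilon>..1} ?H)"
          by (rule Pi_increment_bound[where p = "P' \<epsilon>" and G = ?H, OF e m'(1,2) Hb xy yF t l \<phi>])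
        also have "\<dots> \<le> ennreal ?c * (Pi_norm s r T D \<epsilon> \<gamma> ?F (P' \<epsilon>) * D_dist s T D \<epsilon> \<gamma> ?S (\<Gamma> \<epsilon>) (\<Gamma>' \<epsilon>) f f')"
          by (intro mult_left_mono) (auto simp: D_dist_def)
        finally have 1: "ennreal \<bar>emb D \<epsilon> (P' \<epsilon> y (?H x y)) ?\<psi>\<bar>
            \<le> ennreal ?c * (Pi_norm s r T D \<epsilon> \<gamma> ?F (P' \<epsilon>) * D_dist s T D \<epsilon> \<gamma> ?S (\<Gamma> \<epsilon>) (\<Gamma>' \<epsilon>) f f')" .
        have "ennreal \<bar>emb D \<epsilon> (?p y (?G x y)) ?\<psi>\<bar>
            \<le> ennreal ?c * (Pi_norm s r T D \<epsilon> \<gamma> ?F ?p * increment_sup s T \<gamma> ?S {\<epsilon>..1} ?G)"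
          by (rule Pi_increment_bound[where p = ?p, OF e p increment_below[OF m(3) fb(1)] xy yF t l \<phi>])
        also have "\<dots> \<le> ennreal ?c * (Pi_norm s r T D \<epsilon> \<gamma> ?F ?p * D_norm s T D \<epsilon> \<gamma> ?S (\<Gamma> \<epsilon>) f)"
          by (intro mult_left_mono) (auto simp: D_norm_def)
        finally have 2: "ennreal \<bar>emb D \<epsilon> (?p y (?G x y)) ?\<psi>\<bar>
            \<le> ennreal ?c * (Pi_norm s r T D \<epsilon> \<gamma> ?F ?p * D_norm s T D \<epsilon> \<gamma> ?S (\<Gamma> \<epsilon>) f)" .
        show "ennreal \<bar>emb D \<epsilon> (?U y) ?\<psi> - emb D \<epsilon> (?U x) ?\<psi>\<bar> \<le> ennreal ?c * ?Q"
          unfolding eq distrib_left[of "ennreal ?c"] by (rule ennreal_abs_add_le[OF 1 2])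
      qed
    qed (use e \<delta> \<eta> in auto)
  qed
qed

text \<open>The same splitting, with the continuous increment \<open>G\<close> and \<open>H\<close> the difference of the two increments:
  the change of base point is \<open>\<Pi>\<^sup>\<epsilon>\<^sub>y H + (\<Pi>\<^sub>y - \<Pi>\<^sup>\<epsilon>\<^sub>y) G\<close>.\<close>

lemma continuous_comparison_bound:
  assumes K: "compact K"
    and model: "\<And>\<epsilon>. \<epsilon> \<in> {0<..1} \<Longrightarrow> discrete_model s r T D \<epsilon> (P \<epsilon>) (\<Gamma> \<epsilon>)"
    and rec: "reconstruction s r T D \<gamma> P \<Gamma> R"
    and cmodel: "continuous_model s r T Pc \<Gamma>c"
    and crec: "continuous_reconstruction s r T \<gamma> Pc \<Gamma>c Rc"
    and R3: "R3 s r T D \<gamma> P \<Gamma> R Pc \<Gamma>c Rc"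
  shows "\<exists>C::real. \<forall>\<epsilon>\<in>{0<..1}. \<forall>\<delta>\<in>{\<epsilon><..1}. \<forall>\<eta>\<in>test_functions s r. \<forall>z\<in>K.
         \<forall>f\<in>Dc_space s T \<gamma> \<Gamma>c. \<forall>fe\<in>D_space s T D \<epsilon> \<gamma> (\<Gamma> \<epsilon>).
           ennreal \<bar>emb D \<epsilon> (R \<epsilon> fe - P \<epsilon> z (fe z)) (rescale s z \<delta> \<eta>)
                    - Rc f (rescale s z \<delta> \<eta>) + Pc z (f z) (rescale s z \<delta> \<eta>)\<bar>
             \<le> ennreal (C * \<delta> powr \<gamma>) *
               (Pi_norm s r T D \<epsilon> \<gamma> (fatten s (K \<union> tsupp s \<eta> z \<delta>)) (P \<epsilon>)
                  * Dc_dist s T D \<epsilon> \<gamma> (tsupp s \<eta> z \<delta>) \<Gamma>c (\<Gamma> \<epsilon>) f fe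
                + Pi_dist s r T D \<epsilon> \<gamma> (fatten s (K \<union> tsupp s \<eta> z \<delta>)) Pc (P \<epsilon>)
                  * Dc_norm s T \<gamma> (tsupp s \<eta> z \<delta>) \<Gamma>c f)"
proof -
  from R3[unfolded R3_def, rule_format, OF neighbourhood(1)[OF K]]
  obtain C3 :: real where C3: "\<forall>\<epsilon>\<in>{0<..1}. \<forall>z\<in>closure (fatten s K). \<forall>\<eta>\<in>test_functions s r.
     \<forall>f\<in>Dc_space s T \<gamma> \<Gamma>c. \<forall>fe\<in>D_space s T D \<epsilon> \<gamma> (\<Gamma> \<epsilon>).
       ennreal \<bar>emb D \<epsilon> (R \<epsilon> fe - P \<epsilon> z (fe z)) (rescale s z \<epsilon> \<eta>)
                - (Rc f (rescale s z \<epsilon> \<eta>) - Pc z (f z) (rescale s z \<epsilon> \<eta>))\<bar>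
         \<le> ennreal (C3 * \<epsilon> powr \<gamma>) *
           (Pi_norm s r T D \<epsilon> \<gamma> (fatten s (tsupp s \<eta> z \<epsilon>)) (P \<epsilon>)
              * Dc_dist s T D \<epsilon> \<gamma> (tsupp s \<eta> z \<epsilon>) \<Gamma>c (\<Gamma> \<epsilon>) f fe
            + Pi_dist s r T D \<epsilon> \<gamma> (fatten s (tsupp s \<eta> z \<epsilon>)) Pc (P \<epsilon>)
              * Dc_norm s T \<gamma> (tsupp s \<eta> z \<epsilon>) \<Gamma>c f)" ..
  obtain C where C: "multiscale_constant s r \<gamma> levels (max 0 C3) (control + 1) C"
    using multiscale_bound[of s \<gamma> levels "max 0 C3" "control + 1" r] s \<gamma> control_ge_1
    by (auto simp: levels_def)
  have Pclin: "linear (\<lambda>\<tau>. Pc z \<tau> \<psi>)" for z \<psi>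
    using cmodel by (intro linearI) (auto simp: continuous_model_def)
  have Pcc: "Pc x v \<psi> = Pc y (\<Gamma>c y x v) \<psi>" for x y v \<psi>
  proof -
    have "Pc x = Pc y \<circ> \<Gamma>c y x" using cmodel by (simp add: continuous_model_def)
    then show ?thesis by simp
  qed
  have \<Gamma>c: "\<Gamma>c \<in> transports T"
    using cmodel by (simp add: continuous_model_def transport_rules_def)
  show ?thesis
  proof (intro exI[of _ C] ballI)
    fix \<epsilon> \<delta> \<eta> z f fe
    assume e: "\<epsilon> \<in> {0<..1}" and \<delta>: "\<delta> \<in> {\<epsilon><..1}" and \<eta>: "\<eta> \<in> test_functions s r" and z: "z \<in> K"
      and f: "f \<in> Dc_space s T \<gamma> \<Gamma>c" and fe: "fe \<in> D_space s T D \<epsilon> \<gamma> (\<Gamma> \<epsilon>)"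
    let ?S = "tsupp s \<eta> z \<delta>"
    let ?G = "\<lambda>y z. f z - \<Gamma>c z y (f y)" and ?Ge = "\<lambda>y z. fe z - \<Gamma> \<epsilon> z y (fe y)"
    let ?H = "\<lambda>y z. f z - fe z - \<Gamma>c z y (f y) + \<Gamma> \<epsilon> z y (fe y)"
    let ?F = "fatten s (K \<union> ?S)"
    let ?Q = "Pi_norm s r T D \<epsilon> \<gamma> ?F (P \<epsilon>) * Dc_dist s T D \<epsilon> \<gamma> ?S \<Gamma>c (\<Gamma> \<epsilon>) f fe
      + Pi_dist s r T D \<epsilon> \<gamma> ?F Pc (P \<epsilon>) * Dc_norm s T \<gamma> ?S \<Gamma>c f"
    let ?U = "\<lambda>x \<psi>. emb D \<epsilon> (R \<epsilon> fe - P \<epsilon> x (fe x)) \<psi> - Rc f \<psi> + Pc x (f x) \<psi>"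
    note m = discrete_modelD[OF model[OF e]]
    have fb: "f \<in> functions_below T \<gamma>" "fe \<in> functions_below T \<gamma>"
      using f fe by (auto simp: D_space_def Dc_space_def)
    have Rf: "R \<epsilon> fe \<in> dspace D \<epsilon>" using rec e fe by (simp add: reconstruction_def)
    have Pf: "P \<epsilon> x \<tau> \<in> dspace D \<epsilon>" for x \<tau> using m(2) by auto
    note sub = subspace_dspace[OF e]
    have SF: "?S \<subseteq> ?F" using subset_fatten by blast
    have SK: "?S \<subseteq> closure (fatten s K)" using e \<delta> by (intro neighbourhood(2)[OF K _ \<eta> z]) auto
    have cS: "compact ?S" using e \<delta> by (intro compact_tsupp[OF s _ \<eta>]) auto
    show "ennreal \<bar>emb D \<epsilon> (R \<epsilon> fe - P \<epsilon> z (fe z)) (rescale s z \<delta> \<eta>)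
        - Rc f (rescale s z \<delta> \<eta>) + Pc z (f z) (rescale s z \<delta> \<eta>)\<bar> \<le> ennreal (C * \<delta> powr \<gamma>) * ?Q"
    proof (rule multiscale_constantD[OF C, where U = ?U and S = ?S and \<epsilon> = \<epsilon>])
      show "\<forall>x\<in>?S. Cc_linear r (?U x)"
      proof
        fix x
        have "Cc_linear r (emb D \<epsilon> (R \<epsilon> fe - P \<epsilon> x (fe x)))"
          by (intro Cc_linear_emb e subspace_diff[OF sub] Rf Pf)
        moreover have "Rc f \<in> distributions r" "Pc x (f x) \<in> distributions r"
          using crec cmodel f by (auto simp: continuous_reconstruction_def continuous_model_def)
        ultimately show "Cc_linear r (?U x)"
          by (simp add: distributions_def Cc_linear_def algebra_simps)
      qed
      show "\<forall>x\<in>?S. \<forall>\<phi>\<in>test_functions s r. tsupp s \<phi> x \<epsilon> \<subseteq> ?S \<longrightarrow>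
          ennreal \<bar>?U x (rescale s x \<epsilon> \<phi>)\<bar> \<le> ennreal (max 0 C3 * \<epsilon> powr \<gamma>) * ?Q"
      proof (intro ballI impI)
        fix x \<phi> assume x: "x \<in> ?S" and \<phi>: "\<phi> \<in> test_functions s r" and L: "tsupp s \<phi> x \<epsilon> \<subseteq> ?S"
        let ?L = "tsupp s \<phi> x \<epsilon>"
        have sc: "small_compact s \<epsilon> ?L" using e by (intro small_compact_tsupp[OF s _ \<phi>]) simp
        then have cL: "compact ?L" by (simp add: small_compact_def)
        have FL: "fatten s ?L \<subseteq> ?F" using L by (intro fatten_mono) auto
        have Ud: "?U x (rescale s x \<epsilon> \<phi>) = emb D \<epsilon> (R \<epsilon> fe - P \<epsilon> x (fe x)) (rescale s x \<epsilon> \<phi>)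
            - (Rc f (rescale s x \<epsilon> \<phi>) - Pc x (f x) (rescale s x \<epsilon> \<phi>))" by simp
        have "ennreal \<bar>?U x (rescale s x \<epsilon> \<phi>)\<bar> \<le> ennreal (C3 * \<epsilon> powr \<gamma>) *
           (Pi_norm s r T D \<epsilon> \<gamma> (fatten s ?L) (P \<epsilon>) * Dc_dist s T D \<epsilon> \<gamma> ?L \<Gamma>c (\<Gamma> \<epsilon>) f fe
            + Pi_dist s r T D \<epsilon> \<gamma> (fatten s ?L) Pc (P \<epsilon>) * Dc_norm s T \<gamma> ?L \<Gamma>c f)"
          unfolding Ud using SK x by (intro C3[rule_format, OF e _ \<phi> f fe]) auto
        also have "\<dots> \<le> ennreal (max 0 C3 * \<epsilon> powr \<gamma>) * ?Q"
        proof (intro mult_mono add_mono Pi_norm_mono Pi_dist_mono FL zero_le)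
          show "Dc_dist s T D \<epsilon> \<gamma> ?L \<Gamma>c (\<Gamma> \<epsilon>) f fe \<le> Dc_dist s T D \<epsilon> \<gamma> ?S \<Gamma>c (\<Gamma> \<epsilon>) f fe"
            unfolding Dc_dist_def
            by (intro add_mono increment_sup_mono order_refl L fnorm_mono m(3) e fb cS cL)
          show "Dc_norm s T \<gamma> ?L \<Gamma>c f \<le> Dc_norm s T \<gamma> ?S \<Gamma>c f"
            unfolding Dc_norm_def by (intro increment_sup_mono order_refl L)
          show "ennreal (C3 * \<epsilon> powr \<gamma>) \<le> ennreal (max 0 C3 * \<epsilon> powr \<gamma>)"
            by (intro ennreal_leI mult_right_mono) auto
        qed
        finally show "ennreal \<bar>?U x (rescale s x \<epsilon> \<phi>)\<bar> \<le> ennreal (max 0 C3 * \<epsilon> powr \<gamma>) * ?Q" .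
      qed
      show "\<forall>x\<in>?S. \<forall>y\<in>?S. \<forall>l\<in>{\<epsilon>..1}. \<forall>\<phi>\<in>test_functions s r. \<epsilon> \<le> sdist s x y \<longrightarrow> sdist s x y \<le> 1 \<longrightarrow>
          ennreal \<bar>?U y (rescale s y l \<phi>) - ?U x (rescale s y l \<phi>)\<bar>
            \<le> ennreal ((control + 1) * (\<Sum>\<beta>\<in>levels. sdist s x y powr (\<gamma> - \<beta>) * l powr \<beta>)) * ?Q"
      proof (intro ballI impI)
        fix x y l \<phi> assume xy: "x \<in> ?S" "y \<in> ?S" and l: "l \<in> {\<epsilon>..1}" and \<phi>: "\<phi> \<in> test_functions s r"
          and t: "\<epsilon> \<le> sdist s x y" "sdist s x y \<le> 1"
        let ?\<psi> = "rescale s y l \<phi>"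
        let ?\<Sigma> = "\<Sum>\<beta>\<in>levels. sdist s x y powr (\<gamma> - \<beta>) * l powr \<beta>"
        have yF: "y \<in> ?F" using xy SF by blast
        have Hd: "?H x y = ?G x y - ?Ge x y" by simp
        have split: "emb D \<epsilon> (P \<epsilon> y (?G x y - ?Ge x y)) ?\<psi>
            = emb D \<epsilon> (P \<epsilon> y (?G x y)) ?\<psi> - emb D \<epsilon> (P \<epsilon> y (?Ge x y)) ?\<psi>"
          by (rule linear_diff[OF linear_emb[OF e m(1,2)]])
        have "?U y ?\<psi> - ?U x ?\<psi> = Pc y (?G x y) ?\<psi> - emb D \<epsilon> (P \<epsilon> y (?Ge x y)) ?\<psi>"
          by (simp add: emb_diff[OF e Rf Pf] emb_diff[OF e Pf Pf] linear_diff[OF m(1)]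
              linear_diff[OF Pclin] m(4)[of x _ y] Pcc[of x _ _ y])
        also have "emb D \<epsilon> (P \<epsilon> y (?Ge x y)) ?\<psi> = emb D \<epsilon> (P \<epsilon> y (?G x y)) ?\<psi> - emb D \<epsilon> (P \<epsilon> y (?H x y)) ?\<psi>"
          unfolding Hd split by simp
        finally have eq: "?U y ?\<psi> - ?U x ?\<psi> = emb D \<epsilon> (P \<epsilon> y (?H x y)) ?\<psi>
            + (Pc y (?G x y) ?\<psi> - emb D \<epsilon> (P \<epsilon> y (?G x y)) ?\<psi>)" by simp
        have Gb: "?G x y \<in> below T \<gamma>" by (rule increment_below[OF \<Gamma>c fb(1)])
        have Hb: "?H x y \<in> below T \<gamma>"
          unfolding Hd by (intro subspace_diff[OF subspace_below] Gb increment_below[OF m(3) fb(2)])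
        have \<Sigma>: "0 \<le> ?\<Sigma>" by (intro sum_nonneg) auto
        have "ennreal \<bar>emb D \<epsilon> (P \<epsilon> y (?H x y)) ?\<psi>\<bar>
            \<le> ennreal (control * ?\<Sigma>) * (Pi_norm s r T D \<epsilon> \<gamma> ?F (P \<epsilon>) * increment_sup s T \<gamma> ?S {\<epsilon>..1} ?H)"
          by (rule Pi_increment_bound[where p = "P \<epsilon>" and G = ?H, OF e m(1,2) Hb xy yF t l \<phi>])
        also have "\<dots> \<le> ennreal ((control + 1) * ?\<Sigma>) *
            (Pi_norm s r T D \<epsilon> \<gamma> ?F (P \<epsilon>) * Dc_dist s T D \<epsilon> \<gamma> ?S \<Gamma>c (\<Gamma> \<epsilon>) f fe)"
          using \<Sigma> by (intro mult_mono ennreal_leI mult_right_mono) (auto simp: Dc_dist_def)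
        finally have 1: "ennreal \<bar>emb D \<epsilon> (P \<epsilon> y (?H x y)) ?\<psi>\<bar> \<le> ennreal ((control + 1) * ?\<Sigma>) *
            (Pi_norm s r T D \<epsilon> \<gamma> ?F (P \<epsilon>) * Dc_dist s T D \<epsilon> \<gamma> ?S \<Gamma>c (\<Gamma> \<epsilon>) f fe)" .
        have 2: "ennreal \<bar>Pc y (?G x y) ?\<psi> - emb D \<epsilon> (P \<epsilon> y (?G x y)) ?\<psi>\<bar>
            \<le> ennreal ((control + 1) * ?\<Sigma>) * (Pi_dist s r T D \<epsilon> \<gamma> ?F Pc (P \<epsilon>) * Dc_norm s T \<gamma> ?S \<Gamma>c f)"
          unfolding Dc_norm_def
        proof (rule functional_increment_bound[where w = "\<lambda>\<tau>. Pc y \<tau> ?\<psi> - emb D \<epsilon> (P \<epsilon> y \<tau>) ?\<psi>" and G = ?G])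
          show "linear (\<lambda>\<tau>. Pc y \<tau> ?\<psi> - emb D \<epsilon> (P \<epsilon> y \<tau>) ?\<psi>)"
            by (intro linear_compose_sub Pclin linear_emb[OF e m(1,2)])
          show "ennreal \<bar>Pc y \<sigma> ?\<psi> - emb D \<epsilon> (P \<epsilon> y \<sigma>) ?\<psi>\<bar>
              \<le> ennreal (control + 1) * Pi_dist s r T D \<epsilon> \<gamma> ?F Pc (P \<epsilon>) * ennreal (rnorm T \<beta> \<sigma> * l powr \<beta>)"
            if "\<beta> \<in> levels" "\<sigma> \<in> hom_space T \<beta>" for \<beta> \<sigma>
            by (rule Pi_dist_test[where P = "P \<epsilon>" and Pc = Pc, OF e m(1,2) Pclin yF that l \<phi>])
        qed (use Gb xy t e control_ge_1 in auto)
        show "ennreal \<bar>?U y ?\<psi> - ?U x ?\<psi>\<bar> \<le> ennreal ((control + 1) * ?\<Sigma>) * ?Q"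
          unfolding eq distrib_left[of "ennreal ((control + 1) * ?\<Sigma>)"]
          by (rule ennreal_abs_add_le[OF 1 2])
      qed
    qed (use e \<delta> \<eta> in auto)
  qed
qed

end

theorem theorem3p6:
  fixes s :: "'d::finite \<Rightarrow> nat" and r :: nat
    and T :: "('d, 'v::real_vector) reg_struct"
    and D :: "('d, 'v, 'x::real_vector) discretisation"
    and P :: "real \<Rightarrow> real^'d \<Rightarrow> 'v \<Rightarrow> 'x" and \<Gamma> :: "real \<Rightarrow> ('d, 'v) transport"
    and R :: "real \<Rightarrow> (real^'d \<Rightarrow> 'v) \<Rightarrow> 'x"
    and \<gamma> :: real and K :: "(real^'d) set"
  assumes "\<And>i. s i \<ge> 1"
    and "regularity_structure s T" and "real r > \<bar>Inf (homs T)\<bar>"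
    and "discretisation s r T D" and "monotone_seminorms T D"
    and "\<gamma> > 0" and "compact K"
    and "\<And>\<epsilon>. \<epsilon> \<in> {0<..1} \<Longrightarrow> discrete_model s r T D \<epsilon> (P \<epsilon>) (\<Gamma> \<epsilon>)"
    and "reconstruction s r T D \<gamma> P \<Gamma> R"
  shows
    "(\<exists>C::real. \<forall>\<epsilon>\<in>{0<..1}. \<forall>\<delta>\<in>{\<epsilon><..1}. \<forall>\<eta>\<in>test_functions s r. \<forall>z\<in>K.
       \<forall>f\<in>D_space s T D \<epsilon> \<gamma> (\<Gamma> \<epsilon>).
         ennreal \<bar>emb D \<epsilon> (R \<epsilon> f - P \<epsilon> z (f z)) (rescale s z \<delta> \<eta>)\<bar>
           \<le> ennreal (C * \<delta> powr \<gamma>) *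
             (Pi_norm s r T D \<epsilon> \<gamma> (fatten s (K \<union> tsupp s \<eta> z \<delta>)) (P \<epsilon>)
              * D_norm s T D \<epsilon> \<gamma> (tsupp s \<eta> z \<delta>) (\<Gamma> \<epsilon>) f))
     \<and>
     (\<forall>P' \<Gamma>' R'.
       (\<forall>\<epsilon>\<in>{0<..1}. discrete_model s r T D \<epsilon> (P' \<epsilon>) (\<Gamma>' \<epsilon>)) \<longrightarrow>
       reconstruction s r T D \<gamma> P' \<Gamma>' R' \<longrightarrow>
       R2 s r T D \<gamma> P \<Gamma> R P' \<Gamma>' R' \<longrightarrow>
       (\<exists>C::real. \<forall>\<epsilon>\<in>{0<..1}. \<forall>\<delta>\<in>{\<epsilon><..1}. \<forall>\<eta>\<in>test_functions s r. \<forall>z\<in>K.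
         \<forall>f\<in>D_space s T D \<epsilon> \<gamma> (\<Gamma> \<epsilon>). \<forall>f'\<in>D_space s T D \<epsilon> \<gamma> (\<Gamma>' \<epsilon>).
           ennreal \<bar>emb D \<epsilon> (R \<epsilon> f - R' \<epsilon> f' - P \<epsilon> z (f z) + P' \<epsilon> z (f' z)) (rescale s z \<delta> \<eta>)\<bar>
             \<le> ennreal (C * \<delta> powr \<gamma>) *
               (Pi_norm s r T D \<epsilon> \<gamma> (fatten s (K \<union> tsupp s \<eta> z \<delta>)) (P' \<epsilon>)
                  * D_dist s T D \<epsilon> \<gamma> (tsupp s \<eta> z \<delta>) (\<Gamma> \<epsilon>) (\<Gamma>' \<epsilon>) f f'
                + Pi_norm s r T D \<epsilon> \<gamma> (fatten s (K \<union> tsupp s \<eta> z \<delta>)) (\<lambda>x \<tau>. P \<epsilon> x \<tau> - P' \<epsilon> x \<tau>)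
                  * D_norm s T D \<epsilon> \<gamma> (tsupp s \<eta> z \<delta>) (\<Gamma> \<epsilon>) f)))
     \<and>
     (\<forall>Pc \<Gamma>c Rc.
       continuous_model s r T Pc \<Gamma>c \<longrightarrow>
       continuous_reconstruction s r T \<gamma> Pc \<Gamma>c Rc \<longrightarrow>
       R3 s r T D \<gamma> P \<Gamma> R Pc \<Gamma>c Rc \<longrightarrow>
       (\<exists>C::real. \<forall>\<epsilon>\<in>{0<..1}. \<forall>\<delta>\<in>{\<epsilon><..1}. \<forall>\<eta>\<in>test_functions s r. \<forall>z\<in>K.
         \<forall>f\<in>Dc_space s T \<gamma> \<Gamma>c. \<forall>fe\<in>D_space s T D \<epsilon> \<gamma> (\<Gamma> \<epsilon>).
           ennreal \<bar>emb D \<epsilon> (R \<epsilon> fe - P \<epsilon> z (fe z)) (rescale s z \<delta> \<eta>)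
                    - Rc f (rescale s z \<delta> \<eta>) + Pc z (f z) (rescale s z \<delta> \<eta>)\<bar>
             \<le> ennreal (C * \<delta> powr \<gamma>) *
               (Pi_norm s r T D \<epsilon> \<gamma> (fatten s (K \<union> tsupp s \<eta> z \<delta>)) (P \<epsilon>)
                  * Dc_dist s T D \<epsilon> \<gamma> (tsupp s \<eta> z \<delta>) \<Gamma>c (\<Gamma> \<epsilon>) f fe
                + Pi_dist s r T D \<epsilon> \<gamma> (fatten s (K \<union> tsupp s \<eta> z \<delta>)) Pc (P \<epsilon>)
                  * Dc_norm s T \<gamma> (tsupp s \<eta> z \<delta>) \<Gamma>c f)))"
proof -
  interpret discretised_structure s r T D \<gamma>
    using assms(1,2,4,5,6) by unfold_locales
  show ?thesis
    by (intro conjI allI impI reconstruction_bound reconstruction_difference_bound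
        continuous_comparison_bound assms(7,8,9)) auto
qed

end
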